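(* Let $\Omega\subset\mathbb{R}^n$ be a simply connected domain. If $f:\Omega\to\mathbb{R}^m$ is a locally Lipschitz map satisfying $\operatorname{rank} Df\leq 1$ almost everywhere in $\Omega$, then there exist $C^\infty$-smooth maps $f_i:\Omega\to\mathbb{R}^m$, $i=1,2,\ldots$, with $\operatorname{rank} Df_i\leq 1$ everywhere in $\Omega$, such that for every compact set $K\subset\Omega$ the maps $f_i$ converge uniformly to $f$ on $K$ as $i\to\infty$.
   Context: A domain in $\mathbb{R}^n$ is an open and connected subset of $\mathbb{R}^n$. A map $f$ on an open set $\Omega\subset\mathbb{R}^n$ is locally Lipschitz if every $x\in\Omega$ has a ball around it on which $f$ is Lipschitz; such a map into $\mathbb{R}^m$ is differentiable almost everywhere (with respect to Lebesgue measure) by Rademacher's theorem, and $Df$ denotes its derivative at points of differentiability. *)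

theory Defs
  imports "HOL-Analysis.Analysis"
begin

definition domain :: "(real ^ 'n) set \<Rightarrow> bool" where
  "domain \<Omega> \<longleftrightarrow> open \<Omega> \<and> connected \<Omega>"

definition locally_lipschitz_on :: "'a::metric_space set \<Rightarrow> ('a \<Rightarrow> 'b::metric_space) \<Rightarrow> bool" where
  "locally_lipschitz_on \<Omega> f \<longleftrightarrow>
     (\<forall>x\<in>\<Omega>. \<exists>r>0. ball x r \<subseteq> \<Omega> \<and> (\<exists>L. L-lipschitz_on (ball x r) f))"

(* Meant for open S. In finite dimension, Df is of class C^k iff x |-> Df(x) v is of class C^k
   for every fixed vector v; recursing on these directional derivatives keeps the codomain type
   constant. *)
primrec Ck_on :: "nat \<Rightarrow> 'a::euclidean_space set \<Rightarrow> ('a \<Rightarrow> 'b::real_normed_vector) \<Rightarrow> bool" where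
  "Ck_on 0 S f \<longleftrightarrow> continuous_on S f"
| "Ck_on (Suc k) S f \<longleftrightarrow>
     (\<forall>x\<in>S. f differentiable at x) \<and> (\<forall>v. Ck_on k S (\<lambda>x. frechet_derivative f (at x) v))"

definition smooth_on :: "'a::euclidean_space set \<Rightarrow> ('a \<Rightarrow> 'b::real_normed_vector) \<Rightarrow> bool" where
  "smooth_on S f \<longleftrightarrow> (\<forall>k. Ck_on k S f)"

end

theory Submission
  imports Defs
begin

text \<open>
  By Rademacher's theorem and Sard's theorem, every continuous square in \<open>\<Omega>\<close> can be perturbed so
  that any two linear coordinates of \<open>f\<close> map it to a null set of the plane. Suppose that two paths in
  \<open>\<Omega>\<close> have nearby end points, and that \<open>f\<close> maps the first into the slab where \<open>a \<bullet> y\<close> is nearly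
  constant and the second into the slab where \<open>(a + s b) \<bullet> y\<close> is nearly constant, while \<open>b \<bullet> f\<close>
  changes by \<open>\<epsilon>\<close> along them. The homotopy between them, which exists as \<open>\<Omega>\<close> is simply connected, must
  sweep over an open set of the \<open>(a, b)\<close>-plane, a contradiction. Hence, for a compact set \<open>K\<close>, only a
  bounded number of the directions \<open>a + k b\<close> with \<open>k\<close> an integer are bad, and by counting some
  direction \<open>a\<close> is good for all coordinate vectors \<open>b\<close>: the map \<open>f\<close> oscillates by at most \<open>\<epsilon>\<close> on the
  part in \<open>K\<close> of each component of a thin slab of \<open>a \<bullet> f\<close>. A smooth approximation of \<open>a \<bullet> f\<close> thus
  yields a cover of \<open>\<Omega>\<close> whose nerve is a graph, and \<open>f\<close> is approximated by a map through this graph.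
\<close>

subsection \<open>Lipschitz functions of one variable are differentiable almost everywhere\<close>

text \<open>The obstacle is that one coordinate \<open>a \<bullet> f\<close> may lose sight of
  \<open>f\<close>: where \<open>f\<close> runs along a segment orthogonal to \<open>a\<close>, a
  single component of a slab carries a large oscillation. No estimate can hold for a prescribed
  \<open>a\<close>; it has to be chosen for the given \<open>f\<close>, K and \<epsilon>.

  What makes most directions good is planar. Two paths along which \<open>b \<bullet> f\<close>
  climbs by \<epsilon>, while (\<open>a \<bullet> f\<close>, \<open>b \<bullet> f\<close>) stays in
  narrow strips of different inclination, give two curves that lie apart at some height, and a
  homotopy between them has to fill the gap. Integer steps k keep the inclinations at distance at
  least 1 however many directions are tried, so the bound on the number of bad ones is uniform.

  The rank condition holds only almost everywhere and says nothing on a given square, whose image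
  may itself be a null set. This is why squares are translated by a generic vector: by Fubini,
  almost every parameter of the translated square is then mapped to a good point.\<close>

lemma negligible_outer_open:
  fixes S :: "'a::euclidean_space set"
  assumes "negligible S" "e > 0"
  obtains T where "open T" "S \<subseteq> T" "T \<in> lmeasurable" "measure lebesgue T < e"
proof -
  have S: "S \<in> sets lebesgue" "measure lebesgue S = 0" "S \<in> lmeasurable"
    using assms by (auto simp: negligible_imp_sets negligible_imp_measure0 negligible_imp_measurable)
  obtain T where T: "open T" "S \<subseteq> T" "T - S \<in> lmeasurable" "emeasure lebesgue (T - S) < ennreal e"
    using sets_lebesgue_outer_open[OF S(1) \<open>e > 0\<close>] by blast
  have TS: "T = (T - S) \<union> S" using T(2) by auto
  then have Tm: "T \<in> lmeasurable" using T(3) S(3) by (metis fmeasurable.Un)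
  have "measure lebesgue T \<le> measure lebesgue (T - S) + measure lebesgue S"
    by (subst TS, rule measure_Un_le) (use T(3) S in auto)
  also have "\<dots> < e"
    using T(3,4) S(2) by (simp add: emeasure_eq_measure2 ennreal_less_iff)
  finally show ?thesis using that T Tm by blast
qed

text \<open>Intervals inside \<open>U\<close> with mean slope at most \<open>p\<close> form a Vitali
  cover of \<open>E\<close>. The images of a disjoint subfamily have total length at most
  \<open>p\<close> times the measure of \<open>U\<close>, and what the subfamily misses is a null
  set, whose image is null as \<open>g\<close> is Lipschitz. Outer measure is expressed through open
  supersets because \<open>E\<close> is an arbitrary set.\<close>

lemma outer_measure_image_le:
  fixes g :: "real \<Rightarrow> real"
  assumes lip: "M-lipschitz_on UNIV g" and mono: "strict_mono g" and p: "p \<ge> 0"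
    and E: "\<And>x e. \<lbrakk>x \<in> E; e > 0\<rbrakk> \<Longrightarrow> \<exists>c d. c < x \<and> x < d \<and> d - c < e \<and> g d - g c \<le> p * (d - c)"
    and U: "open U" "E \<subseteq> U" "U \<in> lmeasurable" and \<epsilon>: "\<epsilon> > 0"
  obtains V where "open V" "g ` E \<subseteq> V" "V \<in> lmeasurable"
    "measure lebesgue V \<le> p * measure lebesgue U + \<epsilon>"
proof -
  define K where "K = {(a,r). r > 0 \<and> ball a r \<subseteq> U \<and> g (a + r) - g (a - r) \<le> p * (2 * r)}"
  have Kex: "\<exists>i. i \<in> K \<and> x \<in> ball (fst i) (snd i) \<and> snd i < d" if "x \<in> E" "d > 0" for x d
  proof -
    obtain e0 where e0: "e0 > 0" "ball x e0 \<subseteq> U"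
      using U \<open>x \<in> E\<close> by (meson openE subsetD)
    obtain c b where cb: "c < x" "x < b" "b - c < min e0 d" "g b - g c \<le> p * (b - c)"
      using E[OF \<open>x \<in> E\<close>, of "min e0 d"] e0 \<open>d > 0\<close> by auto
    \<comment> \<open>The covering theorem speaks of balls, so the interval from \<open>c\<close> to
      \<open>b\<close> is recorded by its midpoint and half its length; \<open>x\<close> may be off
      centre.\<close>
    define a r where "a = (c + b) / 2" and "r = (b - c) / 2"
    have ar: "a - r = c" "a + r = b" "2 * r = b - c"
      by (auto simp: a_def r_def field_simps)
    have ball: "ball a r = {c<..<b}" by (simp only: ball_eq_greaterThanLessThan ar)
    have "{c<..<b} \<subseteq> ball x e0"
      using cb by (auto simp: dist_real_def)
    then have "ball a r \<subseteq> U" "r > 0" "g (a + r) - g (a - r) \<le> p * (2 * r)"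
      unfolding ball ar using e0 cb by (auto simp: r_def)
    then have "(a,r) \<in> K" unfolding K_def by auto
    moreover have "x \<in> ball a r" using ball cb by auto
    moreover have "r < d" using cb unfolding r_def by auto
    ultimately show ?thesis by (intro exI[of _ "(a,r)"]) auto
  qed
  obtain C where C: "countable C" "C \<subseteq> K"
     "pairwise (\<lambda>i j. disjnt (ball (fst i) (snd i)) (ball (fst j) (snd j))) C"
     "negligible (E - (\<Union>i \<in> C. ball (fst i) (snd i)))"
    by (rule Vitali_covering_theorem_balls[of E K fst snd, OF Kex])
  define N where "N = E - (\<Union>i \<in> C. ball (fst i) (snd i))"
  have "negligible (g ` N)"
  proof (rule negligible_locally_Lipschitz_image)
    show "negligible N" using C N_def by simp
    fix x
    show "\<exists>T B. open T \<and> x \<in> T \<and> (\<forall>y\<in>N \<inter> T. norm (g y - g x) \<le> B * norm (y - x))"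
      using lipschitz_onD[OF lip] by (intro exI[of _ UNIV] exI[of _ M]) (auto simp: dist_norm)
  qed auto
  then obtain W where W: "open W" "g ` N \<subseteq> W" "W \<in> lmeasurable" "measure lebesgue W < \<epsilon>"
    using negligible_outer_open[OF _ \<epsilon>] by blast
  define J where "J i = {g (fst i - snd i)<..<g (fst i + snd i)}" for i
  have Jm: "J i \<in> lmeasurable" for i unfolding J_def by simp
  have bound: "measure lebesgue (\<Union>i\<in>I. J i) \<le> p * measure lebesgue U" if "I \<subseteq> C" "finite I" for I
  proof -
    have "measure lebesgue (\<Union>i\<in>I. J i) \<le> (\<Sum>i\<in>I. measure lebesgue (J i))"
      using Jm that by (intro measure_UNION_le) auto
    also have "\<dots> \<le> (\<Sum>i\<in>I. p * measure lebesgue (ball (fst i) (snd i)))"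
    proof (rule sum_mono)
      fix i assume "i \<in> I"
      then have i: "snd i > 0" "g (fst i + snd i) - g (fst i - snd i) \<le> p * (2 * snd i)"
        using that C unfolding K_def by auto
      have "g (fst i - snd i) < g (fst i + snd i)" using mono i by (auto simp: strict_mono_def)
      then show "measure lebesgue (J i) \<le> p * measure lebesgue (ball (fst i) (snd i))"
        using i unfolding J_def ball_eq_greaterThanLessThan by simp
    qed
    also have "\<dots> = p * measure lebesgue (\<Union>i\<in>I. ball (fst i) (snd i))"
      using that C(3) by (subst measure_UNION') (auto simp: sum_distrib_left elim: pairwise_mono)
    also have "\<dots> \<le> p * measure lebesgue U"
    proof (intro mult_left_mono measure_mono_fmeasurable p U)
      show "(\<Union>i\<in>I. ball (fst i) (snd i)) \<subseteq> U"
      proof (rule UN_least)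
        fix i assume "i \<in> I"
        then have "i \<in> K" using that(1) C(2) by auto
        then show "ball (fst i) (snd i) \<subseteq> U" unfolding K_def by (auto simp: case_prod_unfold)
      qed
      show "(\<Union>i\<in>I. ball (fst i) (snd i)) \<in> sets lebesgue"
        using that(2) by (intro sets.finite_UN) simp_all
    qed
    finally show ?thesis .
  qed
  define V where "V = W \<union> (\<Union>i\<in>C. J i)"
  have JU: "(\<Union>i\<in>C. J i) \<in> lmeasurable"
    using fmeasurable_UN_bound[OF C(1) Jm bound] by blast
  have JU': "measure lebesgue (\<Union>i\<in>C. J i) \<le> p * measure lebesgue U"
    using measure_UN_bound[OF C(1) Jm bound] by blast
  show ?thesis
  proof
    show "open V" unfolding V_def J_def by (intro open_Un open_UN ballI W(1) open_greaterThanLessThan)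
    show "g ` E \<subseteq> V"
    proof
      fix y assume "y \<in> g ` E"
      then obtain x where x: "x \<in> E" "y = g x" by auto
      show "y \<in> V"
      proof (cases "x \<in> N")
        case True then show ?thesis using W x unfolding V_def by auto
      next
        case False
        then obtain i where i: "i \<in> C" "x \<in> ball (fst i) (snd i)" using x unfolding N_def by auto
        then have "y \<in> J i" using x mono unfolding J_def ball_eq_greaterThanLessThan
          by (auto simp: strict_mono_def)
        then show ?thesis using i unfolding V_def by auto
      qed
    qed
    show "V \<in> lmeasurable" using W JU unfolding V_def by auto
    have "measure lebesgue V \<le> measure lebesgue W + measure lebesgue (\<Union>i\<in>C. J i)"
      unfolding V_def using W(3) JU by (intro measure_Un_le) (auto dest: fmeasurableD)
    then show "measure lebesgue V \<le> p * measure lebesgue U + \<epsilon>" using W(4) JU' by linarith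
  qed
qed


text \<open>The infimum \<open>m\<close> of the measures of open supersets satisfies m \<le>
  \<kappa> m in the limit, hence m = 0. Boundedness of \<open>E\<close> provides a superset of
  finite measure to start from.\<close>

lemma negligible_of_outer_contraction:
  fixes E :: "'a::euclidean_space set"
  assumes bdd: "bounded E" and \<kappa>: "0 \<le> \<kappa>" "\<kappa> < 1"
    and step: "\<And>U \<epsilon>. \<lbrakk>open U; E \<subseteq> U; U \<in> lmeasurable; \<epsilon> > 0\<rbrakk> \<Longrightarrow>
      \<exists>V. open V \<and> E \<subseteq> V \<and> V \<in> lmeasurable \<and> measure lebesgue V \<le> \<kappa> * measure lebesgue U + \<epsilon>"
  shows "negligible E"
proof -
  define A where "A = {measure lebesgue U |U. open U \<and> E \<subseteq> U \<and> U \<in> lmeasurable}"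
  obtain R where R: "E \<subseteq> ball 0 R" using bdd bounded_subset_ballD by blast
  have Ane: "A \<noteq> {}" unfolding A_def using R by (auto intro!: exI[of _ "ball 0 R"])
  have Abdd: "bdd_below A" unfolding A_def by (auto intro!: bdd_belowI[of _ 0])
  define m where "m = Inf A"
  have m0: "m \<ge> 0" unfolding m_def by (rule cInf_greatest[OF Ane]) (auto simp: A_def)
  have le: "m \<le> \<kappa> * u + \<epsilon>" if uA: "u \<in> A" and "\<epsilon> > 0" for u \<epsilon>
  proof -
    obtain U where U: "u = measure lebesgue U" "open U" "E \<subseteq> U" "U \<in> lmeasurable"
      using uA unfolding A_def by blast
    obtain V where V: "open V" "E \<subseteq> V" "V \<in> lmeasurable" "measure lebesgue V \<le> \<kappa> * u + \<epsilon>"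
      using step[OF U(2-4) \<open>\<epsilon> > 0\<close>] U(1) by blast
    then have "measure lebesgue V \<in> A" unfolding A_def by blast
    then have "m \<le> measure lebesgue V" unfolding m_def using Abdd by (rule cInf_lower)
    then show ?thesis using V(4) by linarith
  qed
  have "m = 0"
  proof (rule ccontr)
    assume "m \<noteq> 0"
    then have "m > 0" using m0 by auto
    \<comment> \<open>The error enters twice, through the choice of \<open>u\<close> and through
      \<open>le\<close>; two quarters of the gap m (1 - \<kappa>) stay below the gap.\<close>
    define \<eta> where "\<eta> = m * (1 - \<kappa>) / 4"
    have "\<eta> > 0" using \<open>m > 0\<close> \<kappa> unfolding \<eta>_def by auto
    then obtain u where u: "u \<in> A" "u < m + \<eta>"
      using cInf_lessD[OF Ane, of "m + \<eta>"] unfolding m_def by auto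
    have "m \<le> \<kappa> * u + \<eta>" using le u \<open>\<eta> > 0\<close> by blast
    also have "\<dots> \<le> \<kappa> * m + \<kappa> * \<eta> + \<eta>"
      using mult_left_mono[of u "m + \<eta>" \<kappa>] u \<kappa> by (simp add: algebra_simps)
    also have "\<dots> \<le> \<kappa> * m + 2 * \<eta>" using mult_right_mono[of \<kappa> 1 \<eta>] \<kappa> \<open>\<eta> > 0\<close> by simp
    finally have "m * (1 - \<kappa>) \<le> 2 * \<eta>" by (simp add: algebra_simps)
    then have "m * (1 - \<kappa>) \<le> 0" unfolding \<eta>_def by linarith
    then show False using \<open>m > 0\<close> \<kappa> by (simp add: mult_le_0_iff)
  qed
  show ?thesis
    unfolding negligible_outer
  proof (intro allI impI)
    fix e :: real assume "e > 0"
    then obtain u where "u \<in> A" "u < e"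
      using cInf_lessD[OF Ane, of e] \<open>m = 0\<close> unfolding m_def by auto
    then show "\<exists>T. E \<subseteq> T \<and> T \<in> lmeasurable \<and> measure lebesgue T < e" unfolding A_def by blast
  qed
qed

text \<open>The first slope bound makes \<open>g\<close> contract outer measure by \<open>p\<close> on \<open>E\<close>, the second makes its inverse
  contract by \<open>1 / q\<close>, so the outer measure of \<open>E\<close> is at most \<open>p / q\<close> times itself.\<close>

lemma negligible_slopes:
  fixes g :: "real \<Rightarrow> real"
  assumes lip: "M-lipschitz_on UNIV g" and expand: "\<And>x y. x \<le> y \<Longrightarrow> y - x \<le> g y - g x"
    and pq: "0 < p" "p < q" and bdd: "bounded E"
    and Ep: "\<And>x e. \<lbrakk>x \<in> E; e > 0\<rbrakk> \<Longrightarrow> \<exists>c d. c < x \<and> x < d \<and> d - c < e \<and> g d - g c \<le> p * (d - c)"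
    and Eq: "\<And>x e. \<lbrakk>x \<in> E; e > 0\<rbrakk> \<Longrightarrow> \<exists>c d. c < x \<and> x < d \<and> d - c < e \<and> q * (d - c) \<le> g d - g c"
  shows "negligible E"
proof -
  have mono: "strict_mono g"
    unfolding strict_mono_def using expand by (metis diff_gt_0_iff_gt less_imp_le less_le_trans)
  then have inj: "inj g" by (simp add: strict_mono_imp_inj_on)
  have contg: "continuous_on UNIV g" using lip by (rule lipschitz_on_continuous_on)
  have M: "M \<ge> 0" using lip lipschitz_on_nonneg by blast
  have surj: "\<exists>x. g x = y" for y
  proof -
    define b where "b = \<bar>y - g 0\<bar>"
    have "b \<ge> 0" unfolding b_def by auto
    have "g (-b) \<le> y" "y \<le> g b"
      using expand[of "-b" 0] expand[of 0 b] \<open>b \<ge> 0\<close> unfolding b_def by auto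
    then show ?thesis using IVT'[of g "-b" y b] \<open>b \<ge> 0\<close> continuous_on_subset[OF contg, of "{-b..b}"] by auto
  qed
  define h where "h = inv g"
  have gh: "g (h y) = y" for y unfolding h_def using surj by (metis f_inv_into_f rangeI)
  have hg: "h (g x) = x" for x unfolding h_def using inj by simp
  have monoh: "strict_mono h"
    by (rule strict_monoI) (metis gh mono strict_mono_less)
  have h1: "\<bar>h x - h y\<bar> \<le> \<bar>x - y\<bar>" for x y
    using expand[of "h x" "h y"] expand[of "h y" "h x"] gh by (smt (verit))
  have liph: "1-lipschitz_on UNIV h"
    by (rule lipschitz_onI) (use h1 in \<open>auto simp: dist_real_def\<close>)
  show ?thesis
  proof (rule negligible_of_outer_contraction[OF bdd])
    show "0 \<le> p / q" "p / q < 1" using pq by auto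
    fix U :: "real set" and \<epsilon> :: real
    assume U: "open U" "E \<subseteq> U" "U \<in> lmeasurable" and "\<epsilon> > 0"
    \<comment> \<open>The first covering error is passed on to the inverse and so divided by
      \<open>q\<close>, the second is not; each may cost half of \<epsilon>.\<close>
    define \<epsilon>' where "\<epsilon>' = min (\<epsilon> / 2) (q * \<epsilon> / 2)"
    have \<epsilon>': "\<epsilon>' > 0" "\<epsilon>' \<le> \<epsilon> / 2" "\<epsilon>' / q \<le> \<epsilon> / 2"
      using \<open>\<epsilon> > 0\<close> pq unfolding \<epsilon>'_def by (auto simp: field_simps min_def)
    obtain V where V: "open V" "g ` E \<subseteq> V" "V \<in> lmeasurable" "measure lebesgue V \<le> p * measure lebesgue U + \<epsilon>'"
      using outer_measure_image_le[OF lip mono _ Ep U \<epsilon>'(1)] pq by (metis less_imp_le)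
    have slope: "\<exists>c d. c < x \<and> x < d \<and> d - c < e \<and> h d - h c \<le> (1 / q) * (d - c)"
      if x: "x \<in> g ` E" and "e > 0" for x e
    proof -
      obtain z where z: "z \<in> E" "x = g z" using x by auto
      \<comment> \<open>The interval from \<open>g c\<close> to \<open>g d\<close> has to be shorter
        than \<open>e\<close>, and \<open>g\<close> stretches by at most \<open>M\<close>; taking
        \<open>M + 1\<close> avoids a division by zero.\<close>
      obtain c d where cd: "c < z" "z < d" "d - c < e / (M + 1)" "q * (d - c) \<le> g d - g c"
        using Eq[OF z(1), of "e / (M + 1)"] M \<open>e > 0\<close> by auto
      have "g c < x" "x < g d" using mono cd z by (auto simp: strict_mono_def)
      moreover have "g d - g c < e"
      proof -
        have "g d - g c \<le> M * (d - c)"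
          using lipschitz_onD[OF lip, of d c] cd by (auto simp: dist_real_def)
        also have "\<dots> \<le> (M + 1) * (d - c)" using cd M by (intro mult_right_mono) auto
        also have "\<dots> < e" using cd(3) M by (simp add: field_simps)
        finally show ?thesis .
      qed
      moreover have "h (g d) - h (g c) \<le> (1 / q) * (g d - g c)"
        using cd(4) pq by (simp add: hg field_simps)
      ultimately show ?thesis by blast
    qed
    obtain U' where U': "open U'" "h ` (g ` E) \<subseteq> U'" "U' \<in> lmeasurable"
        "measure lebesgue U' \<le> (1 / q) * measure lebesgue V + \<epsilon>'"
      using outer_measure_image_le[OF liph monoh _ slope V(1-3) \<epsilon>'(1)] pq
      by (metis less_eq_real_def less_trans zero_less_divide_1_iff)
    have "h ` (g ` E) = E" by (simp add: image_image hg)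
    moreover have "measure lebesgue U' \<le> (p / q) * measure lebesgue U + \<epsilon>"
    proof -
      have "measure lebesgue U' \<le> (1 / q) * (p * measure lebesgue U + \<epsilon>') + \<epsilon>'"
        using U'(4) V(4) pq by (smt (verit) divide_nonneg_pos mult_left_mono)
      also have "\<dots> = (p / q) * measure lebesgue U + \<epsilon>' / q + \<epsilon>'" using pq by (simp add: field_simps)
      also have "\<dots> \<le> (p / q) * measure lebesgue U + \<epsilon>" using \<epsilon>' by linarith
      finally show ?thesis .
    qed
    ultimately show "\<exists>V. open V \<and> E \<subseteq> V \<and> V \<in> lmeasurable \<and> measure lebesgue V \<le> p / q * measure lebesgue U + \<epsilon>"
      using U' by metis
  qed
qed

text \<open>Covering arguments control slopes over intervals with \<open>x\<close> strictly inside.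
  Letting one end tend to \<open>x\<close> turns these, by continuity, into difference quotients at
  \<open>x\<close>.\<close>

lemma has_real_derivative_of_straddling_slopes:
  fixes g :: "real \<Rightarrow> real"
  assumes cont: "continuous_on UNIV g"
    and D: "\<And>e. e > 0 \<Longrightarrow> \<exists>\<delta>>0. \<forall>c d. c < x \<longrightarrow> x < d \<longrightarrow> d - c < \<delta> \<longrightarrow> \<bar>g d - g c - D * (d - c)\<bar> \<le> e * (d - c)"
  shows "(g has_real_derivative D) (at x)"
  unfolding has_field_derivative_def has_derivative_at_alt
proof (intro conjI allI impI)
  show "bounded_linear ((*) D)" by (rule bounded_linear_mult_right)
  fix e :: real assume "e > 0"
  obtain \<delta> where \<delta>: "\<delta> > 0"
    "\<And>c d. c < x \<Longrightarrow> x < d \<Longrightarrow> d - c < \<delta> \<Longrightarrow> \<bar>g d - g c - D * (d - c)\<bar> \<le> e * (d - c)"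
    using D[OF \<open>e > 0\<close>] by blast
  have gx: "isCont g z" for z using cont by (simp add: continuous_on_eq_continuous_at)
  have "\<bar>g y - g x - D * (y - x)\<bar> \<le> e * \<bar>y - x\<bar>" if y: "\<bar>y - x\<bar> < \<delta>" for y
  proof -
    consider "y = x" | "y > x" | "y < x" by linarith
    then show ?thesis
    proof cases
      case 2
      have l: "((\<lambda>c. \<bar>g y - g c - D * (y - c)\<bar>) \<longlongrightarrow> \<bar>g y - g x - D * (y - x)\<bar>) (at_left x)"
        using gx[of x] by (intro tendsto_intros) (simp add: isCont_def filterlim_at_split)
      have r: "((\<lambda>c. e * (y - c)) \<longlongrightarrow> e * (y - x)) (at_left x)" by (intro tendsto_intros)
      have "\<forall>\<^sub>F c in at_left x. \<bar>g y - g c - D * (y - c)\<bar> \<le> e * (y - c)"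
        unfolding eventually_at_left_field
        using \<delta>(2) 2 y by (intro exI[of _ "y - \<delta>"]) auto
      from tendsto_le[OF _ r l this] show ?thesis using 2 by simp
    next
      case 3
      have l: "((\<lambda>c. \<bar>g c - g y - D * (c - y)\<bar>) \<longlongrightarrow> \<bar>g x - g y - D * (x - y)\<bar>) (at_right x)"
        using gx[of x] by (intro tendsto_intros) (simp add: isCont_def filterlim_at_split)
      have r: "((\<lambda>c. e * (c - y)) \<longlongrightarrow> e * (x - y)) (at_right x)" by (intro tendsto_intros)
      have "\<forall>\<^sub>F c in at_right x. \<bar>g c - g y - D * (c - y)\<bar> \<le> e * (c - y)"
        unfolding eventually_at_right_field
        using \<delta>(2) 3 y by (intro exI[of _ "y + \<delta>"]) auto
      from tendsto_le[OF _ r l this] show ?thesis using 3 by (simp add: abs_if algebra_simps split: if_splits)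
    qed auto
  qed
  then show "\<exists>d>0. \<forall>y. norm (y - x) < d \<longrightarrow> norm (g y - g x - D * (y - x)) \<le> e * norm (y - x)"
    using \<delta>(1) by auto
qed

text \<open>Where \<open>f\<close> is not differentiable, the lower and upper limits of the slopes
  over shrinking intervals around the point differ; rationals p < q between them put the point into
  one of the countably many null sets \<open>E p q N\<close>.\<close>

lemma lipschitz_real_differentiable_ae:
  fixes f :: "real \<Rightarrow> real"
  assumes lip: "L-lipschitz_on UNIV f"
  shows "negligible {x. \<not> f differentiable at x}"
proof -
  have L: "L \<ge> 0" using lip lipschitz_on_nonneg by blast
  \<comment> \<open>The linear term forces all slopes to be at least 1, so that \<open>g\<close> is
    invertible with a 1-Lipschitz inverse.\<close>
  define g where "g x = f x + (L + 1) * x" for x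
  have fl: "\<bar>f y - f x\<bar> \<le> L * \<bar>y - x\<bar>" for x y
    using lipschitz_onD[OF lip, of y x] by (simp add: dist_real_def)
  have expand: "y - x \<le> g y - g x" if "x \<le> y" for x y
    using fl[of y x] that unfolding g_def by (simp add: algebra_simps)
  have upper: "g y - g x \<le> (2 * L + 1) * (y - x)" if "x \<le> y" for x y
    using fl[of y x] that unfolding g_def by (simp add: algebra_simps)
  have lipg: "(2 * L + 1)-lipschitz_on UNIV g"
  proof (rule lipschitz_onI)
    fix x y
    show "dist (g x) (g y) \<le> (2 * L + 1) * dist x y"
      using expand[of x y] upper[of x y] expand[of y x] upper[of y x]
      by (cases "x \<le> y") (auto simp: dist_real_def)
  qed (use L in auto)
  define P where "P p x \<longleftrightarrow> (\<forall>e>0. \<exists>c d. c < x \<and> x < d \<and> d - c < e \<and> g d - g c \<le> p * (d - c))" for p x :: real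
  define Q where "Q p x \<longleftrightarrow> (\<forall>e>0. \<exists>c d. c < x \<and> x < d \<and> d - c < e \<and> p * (d - c) \<le> g d - g c)" for p x :: real
  define E where "E p q N = {x \<in> ball 0 (real N). P p x \<and> Q q x}" for p q and N :: nat
  have negE: "negligible (E p q N)" if "0 < p" "p < q" for p q N
  proof (rule negligible_slopes[OF lipg expand that])
    show "bounded (E p q N)"
      by (rule bounded_subset[OF bounded_ball[of 0 "real N"]]) (auto simp: E_def)
  qed (auto simp: E_def P_def Q_def)
  have cont: "continuous_on UNIV g" using lipg by (rule lipschitz_on_continuous_on)
  have diff: "f differentiable at x" if x: "\<And>p q. p \<in> \<rat> \<Longrightarrow> q \<in> \<rat> \<Longrightarrow> 0 < p \<Longrightarrow> p < q \<Longrightarrow> \<not> (P p x \<and> Q q x)" for x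
  proof -
    \<comment> \<open>The numbers exceeded by the slopes over all sufficiently short intervals
      around \<open>x\<close>; their supremum \<open>D\<close> is the lower derivative of
      \<open>g\<close>.\<close>
    define S where "S = {p. \<not> P p x}"
    have half: "1/2 \<in> S"
      unfolding S_def P_def using expand by (simp, intro exI[of _ 1]) (smt (verit) field_sum_of_halves)
    have up: "p \<le> 2 * L + 1" if "p \<in> S" for p
    proof (rule ccontr)
      assume "\<not> p \<le> 2 * L + 1"
      have "P p x"
        unfolding P_def
      proof (intro allI impI)
        fix e :: real assume "e > 0"
        have "g (x + e/3) - g (x - e/3) \<le> (2 * L + 1) * (2 * e / 3)"
          using upper[of "x - e/3" "x + e/3"] \<open>e > 0\<close> by simp
        also have "\<dots> \<le> p * (2 * e / 3)"
          using \<open>\<not> p \<le> 2 * L + 1\<close> \<open>e > 0\<close> by (intro mult_right_mono) auto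
        finally show "\<exists>c d. c < x \<and> x < d \<and> d - c < e \<and> g d - g c \<le> p * (d - c)"
          using \<open>e > 0\<close> by (intro exI[of _ "x - e/3"] exI[of _ "x + e/3"]) auto
      qed
      then show False using that unfolding S_def by auto
    qed
    have bdd: "bdd_above S" using up by (rule bdd_aboveI)
    define D where "D = Sup S"
    have "1/2 \<le> D" unfolding D_def using half bdd by (rule cSup_upper)
    have "(g has_real_derivative D) (at x)"
    proof (rule has_real_derivative_of_straddling_slopes[OF cont])
      fix e :: real assume "e > 0"
      obtain p where p: "p \<in> S" "D - e < p"
        using less_cSupD[of S "D - e"] half \<open>e > 0\<close> unfolding D_def by auto
      obtain \<delta>1 where \<delta>1: "\<delta>1 > 0" "\<And>c d. c < x \<Longrightarrow> x < d \<Longrightarrow> d - c < \<delta>1 \<Longrightarrow> p * (d - c) < g d - g c"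
        using p(1) unfolding S_def P_def by force
      \<comment> \<open>Two rationals above \<open>D\<close> are taken: slopes of at most
        \<open>p'\<close> recur at all scales, so by the assumption on \<open>x\<close> slopes of at
        least \<open>q\<close> do not.\<close>
      obtain p' where p': "p' \<in> \<rat>" "D < p'" "p' < D + e" using Rats_dense_in_real[of D "D + e"] \<open>e > 0\<close> by auto
      obtain q where q: "q \<in> \<rat>" "p' < q" "q < D + e" using Rats_dense_in_real[of p' "D + e"] p' by auto
      have "p' \<notin> S" using p' bdd unfolding D_def by (meson cSup_upper not_le)
      then have "P p' x" unfolding S_def by auto
      then have "\<not> Q q x" using x[of p' q] p' q \<open>1/2 \<le> D\<close> by auto
      then obtain \<delta>2 where \<delta>2: "\<delta>2 > 0" "\<And>c d. c < x \<Longrightarrow> x < d \<Longrightarrow> d - c < \<delta>2 \<Longrightarrow> g d - g c < q * (d - c)"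
        unfolding Q_def by force
      show "\<exists>\<delta>>0. \<forall>c d. c < x \<longrightarrow> x < d \<longrightarrow> d - c < \<delta> \<longrightarrow> \<bar>g d - g c - D * (d - c)\<bar> \<le> e * (d - c)"
      proof (intro exI[of _ "min \<delta>1 \<delta>2"] conjI allI impI)
        show "min \<delta>1 \<delta>2 > 0" using \<delta>1 \<delta>2 by auto
        fix c d assume cd: "c < x" "x < d" "d - c < min \<delta>1 \<delta>2"
        have "p * (d - c) < g d - g c" "g d - g c < q * (d - c)" using \<delta>1 \<delta>2 cd by auto
        moreover have "(D - e) * (d - c) \<le> p * (d - c)" using p cd by (intro mult_right_mono) auto
        moreover have "q * (d - c) \<le> (D + e) * (d - c)" using q cd by (intro mult_right_mono) auto
        ultimately show "\<bar>g d - g c - D * (d - c)\<bar> \<le> e * (d - c)" by (simp add: algebra_simps)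
      qed
    qed
    then have "((\<lambda>x. g x - (L + 1) * x) has_real_derivative D - (L + 1)) (at x)"
      by (auto intro!: derivative_eq_intros)
    then show ?thesis unfolding g_def by (auto simp: real_differentiable_def)
  qed
  define I where "I = {(p,q). p \<in> \<rat> \<and> q \<in> \<rat> \<and> 0 < p \<and> p < (q::real)}"
  have "countable I" by (rule countable_subset[of _ "\<rat> \<times> \<rat>"]) (auto simp: I_def countable_rat)
  then have "countable (I \<times> (UNIV :: nat set))" by auto
  then have "negligible (\<Union>i \<in> I \<times> (UNIV :: nat set). E (fst (fst i)) (snd (fst i)) (snd i))"
    by (intro negligible_countable_Union) (auto simp: I_def intro!: negE)
  moreover have "{x. \<not> f differentiable at x} \<subseteq> (\<Union>i \<in> I \<times> (UNIV :: nat set). E (fst (fst i)) (snd (fst i)) (snd i))"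
  proof
    fix x assume "x \<in> {x. \<not> f differentiable at x}"
    then obtain p q where pq: "p \<in> \<rat>" "q \<in> \<rat>" "0 < p" "p < q" "P p x" "Q q x" using diff by blast
    obtain N :: nat where "\<bar>x\<bar> < real N" using reals_Archimedean2 by blast
    then have "x \<in> E p q N" using pq unfolding E_def by auto
    then show "x \<in> (\<Union>i \<in> I \<times> (UNIV :: nat set). E (fst (fst i)) (snd (fst i)) (snd i))"
      using pq by (intro UN_I[of "((p,q),N)"]) (auto simp: I_def)
  qed
  ultimately show ?thesis by (rule negligible_subset)
qed

subsection \<open>Rademacher's theorem\<close>

lemma negligible_iff_AE_lborel:
  fixes N :: "'a::euclidean_space set"
  shows "negligible N \<longleftrightarrow> (AE x in lborel. x \<notin> N)"
  by (simp add: negligible_iff_null_sets null_sets_completion_iff2 eventually_ae_filter subset_eq)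

text \<open>Fubini for the Borel set of pairs (t, v) with \<open>T t + v \<notin> N\<close>. Taking
  for \<open>T\<close> the parametrization of a line gives null sets from null sections; taking a
  polynomial map of the plane gives generic squares.\<close>

lemma AE_translate_commute:
  fixes N :: "'a::euclidean_space set" and T :: "'b::euclidean_space \<Rightarrow> 'a"
  assumes N: "N \<in> sets borel" and T: "T \<in> borel_measurable borel"
  shows "(AE t in lborel. AE v in lborel. T t + v \<notin> N) \<longleftrightarrow> (AE v in lborel. AE t in lborel. T t + v \<notin> N)"
proof (rule lborel_pair.AE_commute)
  have "(\<lambda>x::'b\<times>'a. T (fst x) + snd x) \<in> measurable (lborel \<Otimes>\<^sub>M lborel) borel"
    using T by measurable
  then show "{x \<in> space (lborel \<Otimes>\<^sub>M lborel). T (fst x) + snd x \<notin> N} \<in> sets (lborel \<Otimes>\<^sub>M lborel)"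
    using N by measurable
qed

lemma negligible_translate_preimage:
  fixes N :: "'a::euclidean_space set"
  shows "negligible {v. a + v \<in> N} \<longleftrightarrow> negligible N"
proof -
  have "(+) a ` {v. a + v \<in> N} = N"
    by (auto simp: image_iff) (metis add_diff_cancel_left' diff_add_cancel add.commute)
  then show ?thesis
    using negligible_translation[of "{v. a + v \<in> N}" a] negligible_translation_rev[of a "{v. a + v \<in> N}"] by auto
qed

text \<open>For fixed \<open>t\<close> the \<open>v\<close> with \<open>T t + v \<in> N\<close> form
  a translate of \<open>N\<close>. Exchanging the quantifiers, a generic translate of the map
  \<open>T\<close> meets \<open>N\<close> only in a null set of parameters.\<close>

lemma AE_negligible_translate_preimage:
  fixes N :: "'a::euclidean_space set" and T :: "'b::euclidean_space \<Rightarrow> 'a"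
  assumes N: "N \<in> sets borel" "negligible N" and T: "T \<in> borel_measurable borel"
  shows "AE v in lborel. negligible {t. T t + v \<in> N}"
  using AE_translate_commute[OF N(1) T] N(2) negligible_translate_preimage[of _ N]
  by (simp add: negligible_iff_AE_lborel)

text \<open>After the exchange of quantifiers one good \<open>t\<close> is enough, since for fixed
  \<open>t\<close> the condition concerns a translate of \<open>N\<close>.\<close>

lemma negligible_line_sections:
  fixes N :: "'a::euclidean_space set" and v :: 'a
  assumes N: "N \<in> sets borel" and sec: "\<And>x. negligible {t::real. x + t *\<^sub>R v \<in> N}"
  shows "negligible N"
proof -
  have T: "(\<lambda>t::real. t *\<^sub>R v) \<in> borel_measurable borel" by measurable
  have "AE t in (lborel :: real measure). AE x in lborel. t *\<^sub>R v + x \<notin> N"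
    using AE_translate_commute[OF N T] sec by (simp add: negligible_iff_AE_lborel add.commute)
  moreover have "ae_filter (lborel :: real measure) \<noteq> bot"
    by (simp add: ae_filter_eq_bot_iff)
  ultimately obtain t :: real where "AE x in lborel. t *\<^sub>R v + x \<notin> N"
    using eventually_happens' by blast
  then show ?thesis using negligible_translate_preimage[of "t *\<^sub>R v" N]
    by (simp add: negligible_iff_AE_lborel)
qed

text \<open>This takes the place of Lebesgue density: balls around points of \<open>P\<close> have
  holes of a fixed proportion, so after a Vitali covering by such balls the holes can be cut out of
  any open superset, which shrinks its measure by a fixed factor.\<close>

lemma negligible_porous:
  fixes P :: "'a::euclidean_space set"
  assumes c: "0 < c" "c \<le> 1"
    and por: "\<And>x r. \<lbrakk>x \<in> P; r > 0\<rbrakk> \<Longrightarrow> \<exists>t z. 0 < t \<and> t < r \<and> dist x z \<le> t \<and> ball z (c * t) \<inter> P = {}"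
  shows "negligible P"
proof -
  define n where "n = DIM('a)"
  have n: "n > 0" unfolding n_def by simp
  \<comment> \<open>A covering ball has radius 2 t and its hole radius c t. Half of the latter is
    removed, the fraction c / 4 of the radius of the ball.\<close>
  define \<kappa> where "\<kappa> = 1 - (c / 4) ^ n"
  have \<kappa>: "0 \<le> \<kappa>" "\<kappa> < 1" unfolding \<kappa>_def using c n by (auto intro!: power_le_one)
  have main: "negligible (P \<inter> ball 0 R)" for R
  proof (rule negligible_of_outer_contraction[OF _ \<kappa>])
    show "bounded (P \<inter> ball 0 R)" by (simp add: bounded_Int)
    fix U :: "'a set" and \<epsilon> :: real
    assume U: "open U" "P \<inter> ball 0 R \<subseteq> U" "U \<in> lmeasurable" and "\<epsilon> > 0"
    define E where "E = P \<inter> ball 0 R"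
    define K where "K = {(x,r). r > 0 \<and> ball x r \<subseteq> U \<and> (\<exists>z. dist x z \<le> r / 2 \<and> ball z (c * r / 2) \<inter> P = {})}"
    have Kex: "\<exists>i. i \<in> K \<and> x \<in> ball (fst i) (snd i) \<and> snd i < d" if "x \<in> E" "d > 0" for x d
    proof -
      obtain e0 where e0: "e0 > 0" "ball x e0 \<subseteq> U" using U \<open>x \<in> E\<close> unfolding E_def by (meson openE subsetD)
      obtain t z where tz: "0 < t" "t < min e0 d / 2" "dist x z \<le> t" "ball z (c * t) \<inter> P = {}"
        using por[of x "min e0 d / 2"] \<open>x \<in> E\<close> e0 \<open>d > 0\<close> unfolding E_def by auto
      have "ball x (2 * t) \<subseteq> U" using e0 tz by (auto simp: subset_iff)
      then have "(x, 2 * t) \<in> K" unfolding K_def using tz by (auto intro!: exI[of _ z])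
      then show ?thesis using tz by (intro exI[of _ "(x, 2 * t)"]) auto
    qed
    obtain C where C: "countable C" "C \<subseteq> K"
       "pairwise (\<lambda>i j. disjnt (ball (fst i) (snd i)) (ball (fst j) (snd j))) C"
       "negligible (E - (\<Union>i \<in> C. ball (fst i) (snd i)))"
      by (rule Vitali_covering_theorem_balls[of E K fst snd, OF Kex])
    define N where "N = E - (\<Union>i \<in> C. ball (fst i) (snd i))"
    obtain W where W: "open W" "N \<subseteq> W" "W \<in> lmeasurable" "measure lebesgue W < \<epsilon>"
      using negligible_outer_open[OF _ \<open>\<epsilon> > 0\<close>] C(4) unfolding N_def by blast
    have "\<exists>z. dist (fst i) z \<le> snd i / 2 \<and> ball z (c * snd i / 2) \<inter> P = {}" if "i \<in> K" for i
      using that unfolding K_def by (auto simp: case_prod_unfold)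
    then obtain Z where Z: "\<And>i. i \<in> K \<Longrightarrow> dist (fst i) (Z i) \<le> snd i / 2 \<and> ball (Z i) (c * snd i / 2) \<inter> P = {}"
      by metis
    have Kpos: "snd i > 0" "ball (fst i) (snd i) \<subseteq> U" if "i \<in> K" for i
      using that unfolding K_def by (auto simp: case_prod_unfold)
    \<comment> \<open>A closed ball of half the radius of the hole is removed: this keeps
      \<open>J i\<close> open and loses no point of \<open>P\<close>.\<close>
    define J where "J i = ball (fst i) (snd i) - cball (Z i) (c * snd i / 4)" for i
    have Jm: "J i \<in> lmeasurable" for i unfolding J_def by (intro fmeasurable.Diff) auto
    have J\<kappa>: "measure lebesgue (J i) \<le> \<kappa> * measure lebesgue (ball (fst i) (snd i))" if "i \<in> K" for i
    proof -
      have r: "snd i > 0" using Kpos that by auto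
      have "c * snd i / 4 \<le> snd i / 4" using c r by simp
      have sub: "cball (Z i) (c * snd i / 4) \<subseteq> ball (fst i) (snd i)"
      proof
        fix t assume "t \<in> cball (Z i) (c * snd i / 4)"
        then have "dist (Z i) t \<le> snd i / 4" using \<open>c * snd i / 4 \<le> snd i / 4\<close> by simp
        moreover have "dist (fst i) (Z i) \<le> snd i / 2" using Z[OF that] by simp
        ultimately show "t \<in> ball (fst i) (snd i)" using dist_triangle[of "fst i" t "Z i"] r by simp
      qed
      have "measure lebesgue (J i) = measure lebesgue (ball (fst i) (snd i)) - measure lebesgue (cball (Z i) (c * snd i / 4))"
        unfolding J_def using sub by (intro measurable_measure_Diff) auto
      also have "\<dots> = \<kappa> * measure lebesgue (ball (fst i) (snd i))"
        using c r by (simp add: content_ball content_cball \<kappa>_def n_def power_mult_distrib power_divide algebra_simps)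
      finally show ?thesis by simp
    qed
    have bound: "measure lebesgue (\<Union>i\<in>I. J i) \<le> \<kappa> * measure lebesgue U" if "I \<subseteq> C" "finite I" for I
    proof -
      have "measure lebesgue (\<Union>i\<in>I. J i) \<le> (\<Sum>i\<in>I. measure lebesgue (J i))"
        using Jm that by (intro measure_UNION_le) auto
      also have "\<dots> \<le> (\<Sum>i\<in>I. \<kappa> * measure lebesgue (ball (fst i) (snd i)))"
        using that C by (intro sum_mono J\<kappa>) auto
      also have "\<dots> = \<kappa> * measure lebesgue (\<Union>i\<in>I. ball (fst i) (snd i))"
        using that C(3) by (subst measure_UNION') (auto simp: sum_distrib_left elim: pairwise_mono)
      also have "\<dots> \<le> \<kappa> * measure lebesgue U"
      proof (intro mult_left_mono measure_mono_fmeasurable \<kappa> U)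
        show "(\<Union>i\<in>I. ball (fst i) (snd i)) \<subseteq> U"
        proof (rule UN_least)
          fix i assume "i \<in> I"
          then show "ball (fst i) (snd i) \<subseteq> U" using that(1) C(2) by (intro Kpos) auto
        qed
        show "(\<Union>i\<in>I. ball (fst i) (snd i)) \<in> sets lebesgue"
          using that(2) by (intro sets.finite_UN) simp_all
      qed
      finally show ?thesis .
    qed
    define V where "V = W \<union> (\<Union>i\<in>C. J i)"
    have JU: "(\<Union>i\<in>C. J i) \<in> lmeasurable"
      using fmeasurable_UN_bound[OF C(1) Jm bound] by blast
    have JU': "measure lebesgue (\<Union>i\<in>C. J i) \<le> \<kappa> * measure lebesgue U"
      using measure_UN_bound[OF C(1) Jm bound] by blast
    have "open V"
      unfolding V_def J_def by (intro open_Un open_UN ballI W(1) open_Diff) auto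
    moreover have "P \<inter> ball 0 R \<subseteq> V"
    proof
      fix x assume "x \<in> P \<inter> ball 0 R"
      then have x: "x \<in> E" "x \<in> P" unfolding E_def by auto
      show "x \<in> V"
      proof (cases "x \<in> N")
        case True then show ?thesis using W unfolding V_def by auto
      next
        case False
        then obtain i where i: "i \<in> C" "x \<in> ball (fst i) (snd i)" using x unfolding N_def by auto
        then have iK: "i \<in> K" using C by auto
        then have "x \<notin> ball (Z i) (c * snd i / 2)" using Z x by blast
        moreover have "c * snd i / 4 < c * snd i / 2" using c Kpos[OF iK] by simp
        ultimately have "x \<in> J i" using i unfolding J_def by auto
        then show ?thesis using i unfolding V_def by auto
      qed
    qed
    moreover have "V \<in> lmeasurable" using W(3) JU unfolding V_def by auto
    moreover have "measure lebesgue V \<le> \<kappa> * measure lebesgue U + \<epsilon>"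
    proof -
      have "measure lebesgue V \<le> measure lebesgue W + measure lebesgue (\<Union>i\<in>C. J i)"
        unfolding V_def using W(3) JU by (intro measure_Un_le) (auto dest: fmeasurableD)
      then show ?thesis using W(4) JU' by linarith
    qed
    ultimately show "\<exists>V. open V \<and> P \<inter> ball 0 R \<subseteq> V \<and> V \<in> lmeasurable \<and> measure lebesgue V \<le> \<kappa> * measure lebesgue U + \<epsilon>"
      by blast
  qed
  have "negligible (\<Union>k::nat. P \<inter> ball 0 (real k))" using main by (intro negligible_countable_Union) auto
  moreover have "P \<subseteq> (\<Union>k::nat. P \<inter> ball 0 (real k))"
  proof
    fix x assume "x \<in> P"
    moreover obtain k :: nat where "norm x < real k" using reals_Archimedean2 by blast
    ultimately show "x \<in> (\<Union>k::nat. P \<inter> ball 0 (real k))" by auto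
  qed
  ultimately show ?thesis by (rule negligible_subset)
qed


text \<open>The right-hand side quantifies over naturals and rationals only, so the points of
  differentiability along a line will form a Borel set. Rational increments decide because the
  difference quotient is continuous off 0, and the Cauchy criterion avoids naming the
  derivative.\<close>

lemma differentiable_real_iff_rational_Cauchy:
  fixes F :: "real \<Rightarrow> real"
  assumes cont: "continuous_on UNIV F"
  shows "F differentiable at 0 \<longleftrightarrow>
    (\<forall>k::nat. \<exists>j::nat. \<forall>s t::rat. 0 < \<bar>s\<bar> \<and> \<bar>of_rat s\<bar> < 1 / (real j + 1) \<and> 0 < \<bar>t\<bar> \<and> \<bar>of_rat t\<bar> < 1 / (real j + 1) \<longrightarrow>
      \<bar>(F (of_rat s) - F 0) / of_rat s - (F (of_rat t) - F 0) / of_rat t\<bar> \<le> 1 / (real k + 1))"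
    (is "_ \<longleftrightarrow> (\<forall>k. \<exists>j. ?C k j)")
proof
  assume "F differentiable at 0"
  then obtain D where "(F has_real_derivative D) (at 0)" by (auto simp: real_differentiable_def)
  then have lim: "((\<lambda>h. (F h - F 0) / h) \<longlongrightarrow> D) (at 0)" by (simp add: has_field_derivative_iff)
  show "\<forall>k. \<exists>j. ?C k j"
  proof
    fix k :: nat
    define e where "e = 1 / (real k + 1)"
    have "e > 0" unfolding e_def by simp
    then obtain d where d: "d > 0" "\<And>h. h \<noteq> 0 \<Longrightarrow> \<bar>h\<bar> < d \<Longrightarrow> \<bar>(F h - F 0) / h - D\<bar> < e / 2"
      using lim half_gt_zero[OF \<open>e > 0\<close>] unfolding LIM_def dist_real_def diff_0_right by blast
    obtain j :: nat where j: "1 / (real j + 1) < d"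
      using reals_Archimedean[OF d(1)] by (auto simp: field_simps)
    have "?C k j"
    proof (intro allI impI)
      fix s t :: rat
      assume st: "0 < \<bar>s\<bar> \<and> \<bar>of_rat s\<bar> < 1 / (real j + 1) \<and> 0 < \<bar>t\<bar> \<and> \<bar>of_rat t\<bar> < 1 / (real j + 1)"
      have "\<bar>(F (of_rat s) - F 0) / of_rat s - D\<bar> < e / 2" "\<bar>(F (of_rat t) - F 0) / of_rat t - D\<bar> < e / 2"
        using d(2)[of "of_rat s"] d(2)[of "of_rat t"] st j by auto
      moreover have "\<bar>u - v\<bar> \<le> e" if "\<bar>u - D\<bar> < e / 2" "\<bar>v - D\<bar> < e / 2" for u v using that by linarith
      ultimately show "\<bar>(F (of_rat s) - F 0) / of_rat s - (F (of_rat t) - F 0) / of_rat t\<bar> \<le> 1 / (real k + 1)"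
        unfolding e_def by blast
    qed
    then show "\<exists>j. ?C k j" by blast
  qed
next
  assume R: "\<forall>k. \<exists>j. ?C k j"
  define Q where "Q h = (F h - F 0) / h" for h
  have Fc: "isCont F x" for x using cont by (simp add: continuous_on_eq_continuous_at)
  have Qc: "isCont Q x" if "x \<noteq> 0" for x unfolding Q_def using that Fc by (intro continuous_intros) auto
  have ratlim: "\<exists>r :: nat \<Rightarrow> rat. (\<lambda>n. of_rat (r n)) \<longlonglongrightarrow> x \<and> (\<forall>n. of_rat (r n) \<noteq> (0::real) \<and> \<bar>of_rat (r n)\<bar> < d)"
    if "x \<noteq> 0" "\<bar>x\<bar> < d" for x d :: real
  proof -
    have "\<exists>r::rat. \<bar>of_rat r - x\<bar> < 1 / (real n + 1) \<and> of_rat r \<noteq> (0::real) \<and> \<bar>of_rat r\<bar> < d" for n :: nat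
    proof -
      define m where "m = min (1 / (real n + 1)) (min \<bar>x\<bar> (d - \<bar>x\<bar>))"
      have "m > 0" unfolding m_def using that by auto
      then obtain q where q: "q \<in> \<rat>" "x < q" "q < x + m" using Rats_dense_in_real[of x "x + m"] by auto
      then obtain r :: rat where r: "q = of_rat r" by (auto elim: Rats_cases)
      have "\<bar>q - x\<bar> < 1 / (real n + 1) \<and> q \<noteq> 0 \<and> \<bar>q\<bar> < d" using q unfolding m_def by auto
      then show ?thesis unfolding r by blast
    qed
    then obtain r :: "nat \<Rightarrow> rat" where r: "\<And>n. \<bar>of_rat (r n) - x\<bar> < 1 / (real n + 1)" "\<And>n. of_rat (r n) \<noteq> (0::real)" "\<And>n. \<bar>of_rat (r n)\<bar> < d"
      by metis
    have "(\<lambda>n. of_rat (r n) - x) \<longlonglongrightarrow> 0"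
    proof (rule Lim_null_comparison)
      show "\<forall>\<^sub>F n in sequentially. norm (of_rat (r n) - x) \<le> 1 / (real n + 1)"
        using r(1) by (auto intro!: always_eventually less_imp_le)
      show "(\<lambda>n. 1 / (real n + 1)) \<longlonglongrightarrow> 0" using LIMSEQ_inverse_real_of_nat by (simp add: inverse_eq_divide add.commute)
    qed
    then show ?thesis using r by (auto simp: LIM_zero_iff)
  qed
  have real_C: "\<exists>d>0. \<forall>s t. s \<noteq> 0 \<and> \<bar>s\<bar> < d \<and> t \<noteq> 0 \<and> \<bar>t\<bar> < d \<longrightarrow> \<bar>Q s - Q t\<bar> \<le> 1 / (real k + 1)" for k :: nat
  proof -
    obtain j where j: "?C k j" using R by blast
    define d where "d = 1 / (real j + 1)"
    have "\<bar>Q s - Q t\<bar> \<le> 1 / (real k + 1)" if st: "s \<noteq> 0" "\<bar>s\<bar> < d" "t \<noteq> 0" "\<bar>t\<bar> < d" for s t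
    proof -
      obtain r r' :: "nat \<Rightarrow> rat" where r: "(\<lambda>n. of_rat (r n)) \<longlonglongrightarrow> s" "\<And>n. of_rat (r n) \<noteq> (0::real)" "\<And>n. \<bar>of_rat (r n)\<bar> < d"
        and r': "(\<lambda>n. of_rat (r' n)) \<longlonglongrightarrow> t" "\<And>n. of_rat (r' n) \<noteq> (0::real)" "\<And>n. \<bar>of_rat (r' n)\<bar> < d"
        using ratlim[OF st(1,2)] ratlim[OF st(3,4)] by metis
      have l: "(\<lambda>n. \<bar>Q (of_rat (r n)) - Q (of_rat (r' n))\<bar>) \<longlonglongrightarrow> \<bar>Q s - Q t\<bar>"
        using r(1) r'(1) st Qc by (intro tendsto_intros isCont_tendsto_compose[where g=Q]) auto
      show ?thesis
      proof (rule LIMSEQ_le_const2[OF l], intro exI allI impI)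
        fix n show "\<bar>Q (of_rat (r n)) - Q (of_rat (r' n))\<bar> \<le> 1 / (real k + 1)"
          unfolding Q_def using j r(2,3) r'(2,3) unfolding d_def by simp
      qed
    qed
    moreover have "d > 0" unfolding d_def by simp
    ultimately show ?thesis by blast
  qed
  define h where "h n = 1 / (real n + 1)" for n :: nat
  have h: "h \<longlonglongrightarrow> 0" "\<And>n. h n > 0" unfolding h_def using LIMSEQ_inverse_real_of_nat
    by (auto simp: inverse_eq_divide add.commute)
  have small: "\<exists>k::nat. 1 / (real k + 1) < e" if "e > 0" for e
    using reals_Archimedean[OF that] by (auto simp: inverse_eq_divide field_simps)
  have "Cauchy (\<lambda>n. Q (h n))"
  proof (rule metric_CauchyI)
    fix e :: real assume "e > 0"
    then obtain k :: nat where k: "1 / (real k + 1) < e" using small by blast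
    obtain d where d: "d > 0" "\<And>s t. s \<noteq> 0 \<Longrightarrow> \<bar>s\<bar> < d \<Longrightarrow> t \<noteq> 0 \<Longrightarrow> \<bar>t\<bar> < d \<Longrightarrow> \<bar>Q s - Q t\<bar> \<le> 1 / (real k + 1)"
      using real_C[of k] by blast
    obtain N where N: "\<And>n. n \<ge> N \<Longrightarrow> \<bar>h n\<bar> < d"
      using LIMSEQ_D[OF h(1) d(1)] by auto
    show "\<exists>M. \<forall>m\<ge>M. \<forall>n\<ge>M. dist (Q (h m)) (Q (h n)) < e"
      using d(2) N h(2) k by (intro exI[of _ N]) (metis dist_real_def less_irrefl le_less_trans)
  qed
  then obtain D where D: "(\<lambda>n. Q (h n)) \<longlonglongrightarrow> D" using Cauchy_convergent convergent_def by blast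
  have "(Q \<longlongrightarrow> D) (at 0)"
    unfolding LIM_def
  proof (intro allI impI)
    fix e :: real assume "e > 0"
    then obtain k :: nat where k: "1 / (real k + 1) < e" using small by blast
    obtain d where d: "d > 0" "\<And>s t. s \<noteq> 0 \<Longrightarrow> \<bar>s\<bar> < d \<Longrightarrow> t \<noteq> 0 \<Longrightarrow> \<bar>t\<bar> < d \<Longrightarrow> \<bar>Q s - Q t\<bar> \<le> 1 / (real k + 1)"
      using real_C[of k] by blast
    obtain N where N: "\<And>n. n \<ge> N \<Longrightarrow> \<bar>h n\<bar> < d"
      using LIMSEQ_D[OF h(1) d(1)] by auto
    have "\<bar>Q s - D\<bar> < e" if s: "s \<noteq> 0" "\<bar>s\<bar> < d" for s
    proof -
      have "(\<lambda>n. \<bar>Q s - Q (h n)\<bar>) \<longlonglongrightarrow> \<bar>Q s - D\<bar>" using D by (intro tendsto_intros)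
      then have "\<bar>Q s - D\<bar> \<le> 1 / (real k + 1)"
        by (rule LIMSEQ_le_const2) (use d(2) s N h(2) in \<open>auto intro!: exI[of _ N] simp: less_le\<close>)
      then show ?thesis using k by linarith
    qed
    then show "\<exists>s>0. \<forall>x. x \<noteq> 0 \<and> dist x 0 < s \<longrightarrow> dist (Q x) D < e"
      using d(1) by (auto simp: dist_real_def)
  qed
  then have "(F has_real_derivative D) (at 0)" unfolding has_field_derivative_iff Q_def by simp
  then show "F differentiable at 0" by (auto simp: real_differentiable_def)
qed

text \<open>On each line in direction \<open>v\<close> the restriction is Lipschitz, so the
  exceptional set has null sections by the one-dimensional theorem.\<close>

lemma lipschitz_directional_derivative_ae:
  fixes f :: "'a::euclidean_space \<Rightarrow> real"
  assumes lip: "L-lipschitz_on UNIV f"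
  shows "negligible {x. \<not> (\<lambda>t::real. f (x + t *\<^sub>R v)) differentiable at 0}"
proof (rule negligible_line_sections)
  have fcont: "continuous_on UNIV f" using lip by (rule lipschitz_on_continuous_on)
  then have [measurable]: "f \<in> borel_measurable borel" by (rule borel_measurable_continuous_onI)
  have line: "continuous_on UNIV (\<lambda>t::real. f (x + t *\<^sub>R v))" for x
    by (intro continuous_on_compose2[OF fcont] continuous_intros) auto
  show "{x. \<not> (\<lambda>t::real. f (x + t *\<^sub>R v)) differentiable at 0} \<in> sets borel"
    unfolding differentiable_real_iff_rational_Cauchy[OF line] by measurable
  fix x
  define F where "F t = f (x + t *\<^sub>R v)" for t
  have "(L * norm v)-lipschitz_on UNIV F"
  proof (rule lipschitz_onI)
    fix s t
    have "dist (F s) (F t) \<le> L * dist (x + s *\<^sub>R v) (x + t *\<^sub>R v)"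
      unfolding F_def using lip by (rule lipschitz_onD) auto
    also have "dist (x + s *\<^sub>R v) (x + t *\<^sub>R v) = norm v * dist s t"
      by (simp add: dist_norm flip: scaleR_left_diff_distrib)
    finally show "dist (F s) (F t) \<le> L * norm v * dist s t" by (simp add: mult.assoc)
  qed (use lipschitz_on_nonneg[OF lip] in auto)
  then have "negligible {t. \<not> F differentiable at t}" by (rule lipschitz_real_differentiable_ae)
  moreover have "(\<lambda>s. f (x + t *\<^sub>R v + s *\<^sub>R v)) differentiable at 0 \<longleftrightarrow> F differentiable at t" for t
  proof -
    have eq: "(\<lambda>s. f (x + t *\<^sub>R v + s *\<^sub>R v)) = (\<lambda>s. F (t + s))" by (auto simp: F_def algebra_simps)
    show ?thesis unfolding eq real_differentiable_def
      using DERIV_shift[of F _ 0 t] by (simp add: add.commute)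
  qed
  ultimately show "negligible {t. x + t *\<^sub>R v \<in> {x. \<not> (\<lambda>t. f (x + t *\<^sub>R v)) differentiable at 0}}"
    by simp
qed


text \<open>The linear form may depend on the error. Two forms that are accurate to e and e' on a
  common ball differ by at most e + e', as testing in the direction of their difference shows; hence
  they converge, and the limit is the gradient.\<close>

lemma differentiable_of_approx_linear:
  fixes f :: "'a::euclidean_space \<Rightarrow> real"
  assumes "\<And>e. e > 0 \<Longrightarrow> \<exists>y. \<exists>\<rho>>0. \<forall>w. norm w < \<rho> \<longrightarrow> \<bar>f (x + w) - f x - y \<bullet> w\<bar> \<le> e * norm w"
  shows "f differentiable at x"
proof -
  have "\<forall>k::nat. \<exists>y \<rho>. \<rho> > 0 \<and> (\<forall>w. norm w < \<rho> \<longrightarrow> \<bar>f (x + w) - f x - y \<bullet> w\<bar> \<le> 1 / (real k + 1) * norm w)"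
  proof
    fix k :: nat
    show "\<exists>y \<rho>. \<rho> > 0 \<and> (\<forall>w. norm w < \<rho> \<longrightarrow> \<bar>f (x + w) - f x - y \<bullet> w\<bar> \<le> 1 / (real k + 1) * norm w)"
      using assms[of "1 / (real k + 1)"] by auto
  qed
  then obtain y \<rho> where \<rho>: "\<And>k. \<rho> k > 0"
    and y: "\<And>k w. norm w < \<rho> k \<Longrightarrow> \<bar>f (x + w) - f x - y k \<bullet> w\<bar> \<le> 1 / (real k + 1) * norm w"
    by metis
  have close: "norm (y k - y l) \<le> 1 / (real k + 1) + 1 / (real l + 1)" for k l
  proof (cases "y k = y l")
    case False
    define u where "u = y k - y l"
    \<comment> \<open>Gives \<open>w\<close> half the smaller radius as its length, so that both
      estimates apply to it.\<close>
    define s where "s = min (\<rho> k) (\<rho> l) / (2 * norm u)"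
    have u: "norm u > 0" using False unfolding u_def by simp
    have s: "s > 0" unfolding s_def using \<rho> u by simp
    define w where "w = s *\<^sub>R u"
    have nw: "norm w = s * norm u" unfolding w_def using s by simp
    have "norm w < \<rho> k" "norm w < \<rho> l"
      unfolding nw s_def using u \<rho>[of k] \<rho>[of l] by (auto simp: min_def)
    then have "\<bar>(y k - y l) \<bullet> w\<bar> \<le> (1 / (real k + 1) + 1 / (real l + 1)) * norm w"
      using y[of w k] y[of w l] by (simp add: inner_diff_left distrib_right)
    moreover have "(y k - y l) \<bullet> w = norm u * norm w"
      unfolding u_def[symmetric] w_def using s by (simp add: dot_square_norm power2_eq_square)
    ultimately have "norm u * norm w \<le> (1 / (real k + 1) + 1 / (real l + 1)) * norm w" by linarith
    then show ?thesis using u s nw unfolding u_def by (simp add: mult_le_cancel_right)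
  qed auto
  have small: "\<exists>k::nat. \<forall>n\<ge>k. 1 / (real n + 1) < e" if e: "e > 0" for e
  proof -
    obtain k :: nat where k: "1 / (real k + 1) < e"
      using reals_Archimedean[OF e] by (auto simp: inverse_eq_divide field_simps)
    have "1 / (real n + 1) \<le> 1 / (real k + 1)" if "n \<ge> k" for n
      using that by (simp add: frac_le)
    then show ?thesis using k by (meson le_less_trans)
  qed
  have "Cauchy y"
  proof (rule metric_CauchyI)
    fix e :: real assume "e > 0"
    then obtain k where k: "\<And>n. n \<ge> k \<Longrightarrow> 1 / (real n + 1) < e / 2" using small half_gt_zero by meson
    show "\<exists>M. \<forall>m\<ge>M. \<forall>n\<ge>M. dist (y m) (y n) < e"
    proof (intro exI allI impI)
      fix m n assume "m \<ge> k" "n \<ge> k"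
      then show "dist (y m) (y n) < e" using k[of m] k[of n] close[of m n] by (simp add: dist_norm)
    qed
  qed
  then obtain Y where Y: "y \<longlonglongrightarrow> Y" using Cauchy_convergent convergent_def by blast
  have closeY: "norm (y k - Y) \<le> 1 / (real k + 1)" for k
  proof -
    have l: "(\<lambda>l. norm (y k - y l)) \<longlonglongrightarrow> norm (y k - Y)" using Y by (intro tendsto_intros)
    have r: "(\<lambda>l. 1 / (real k + 1) + 1 / (real l + 1)) \<longlonglongrightarrow> 1 / (real k + 1) + 0"
      using LIMSEQ_inverse_real_of_nat by (intro tendsto_intros) (simp add: inverse_eq_divide add.commute)
    show ?thesis using LIMSEQ_le[OF l r] close by auto
  qed
  have "(f has_derivative (\<lambda>w. Y \<bullet> w)) (at x)"
    unfolding has_derivative_at_alt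
  proof (intro conjI allI impI)
    show "bounded_linear ((\<bullet>) Y)" by (rule bounded_linear_inner_right)
    fix e :: real assume "e > 0"
    then obtain k where k: "1 / (real k + 1) < e / 2" using small half_gt_zero by (meson order_refl)
    show "\<exists>d>0. \<forall>z. norm (z - x) < d \<longrightarrow> norm (f z - f x - Y \<bullet> (z - x)) \<le> e * norm (z - x)"
    proof (intro exI[of _ "\<rho> k"] conjI allI impI \<rho>)
      fix z assume z: "norm (z - x) < \<rho> k"
      have "\<bar>f z - f x - y k \<bullet> (z - x)\<bar> \<le> 1 / (real k + 1) * norm (z - x)" using y[OF z] by simp
      moreover have "\<bar>(y k - Y) \<bullet> (z - x)\<bar> \<le> 1 / (real k + 1) * norm (z - x)"
        by (rule order_trans[OF Cauchy_Schwarz_ineq2]) (intro mult_right_mono closeY norm_ge_zero)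
      ultimately have "\<bar>f z - f x - Y \<bullet> (z - x)\<bar> \<le> 2 * (1 / (real k + 1)) * norm (z - x)"
        by (simp add: inner_diff_left)
      also have "\<dots> \<le> e * norm (z - x)" using k by (intro mult_right_mono) auto
      finally show "norm (f z - f x - Y \<bullet> (z - x)) \<le> e * norm (z - x)" by simp
    qed
  qed
  then show ?thesis by (auto simp: differentiable_def)
qed

text \<open>Near a point of \<open>A y k j\<close> at which this set is not porous, an arbitrary displacement is a sum of
  displacements along the axes that start, up to a small error, at points of \<open>A y k j\<close>.\<close>

lemma rademacher_real:
  fixes f :: "'a::euclidean_space \<Rightarrow> real"
  assumes lip: "L-lipschitz_on UNIV f"
  shows "negligible {x. \<not> f differentiable at x}"
proof -
  have L: "L \<ge> 0" using lip lipschitz_on_nonneg by blast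
  have fl: "\<bar>f y - f x\<bar> \<le> L * norm (y - x)" for x y
    using lipschitz_onD[OF lip, of y x] by (simp add: dist_norm)
  \<comment> \<open>Candidate gradients come from a countable dense set, so that only countably many
    sets \<open>A y k j\<close> arise.\<close>
  obtain Y :: "'a set" where Y: "countable Y" "\<And>S. open S \<Longrightarrow> S \<noteq> {} \<Longrightarrow> \<exists>d\<in>Y. d \<in> S"
    using countable_dense_exists[where 'a='a] by auto
  define D where "D = {x. \<forall>i\<in>Basis. (\<lambda>t::real. f (x + t *\<^sub>R i)) differentiable at 0}"
  define A where "A y k j = {x. \<forall>i\<in>Basis. \<forall>t. \<bar>t\<bar> < 1 / (real j + 1) \<longrightarrow>
    \<bar>f (x + t *\<^sub>R i) - f x - t * (y \<bullet> i)\<bar> \<le> \<bar>t\<bar> * (1 / (real k + 1))}" for y and k j :: nat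
  \<comment> \<open>A hole of \<open>A y k j\<close> is also a hole of its subset
    \<open>P y k j\<close>, which is therefore porous in the sense of
    \<open>negligible_porous\<close>.\<close>
  define P where "P y k j = {x \<in> A y k j. \<forall>r>0. \<exists>t z. 0 < t \<and> t < r \<and> dist x z \<le> t \<and>
    ball z (1 / (real k + 1) * t) \<inter> A y k j = {}}" for y k j
  have "negligible (P y k j)" for y k j
    by (rule negligible_porous[of "1 / (real k + 1)"]) (force simp: P_def)+
  then have negP: "negligible (\<Union>i\<in>Y \<times> (UNIV :: (nat \<times> nat) set). P (fst i) (fst (snd i)) (snd (snd i)))"
    using Y(1) by (intro negligible_countable_Union) auto
  have "- D = (\<Union>i\<in>Basis. {x. \<not> (\<lambda>t::real. f (x + t *\<^sub>R i)) differentiable at 0})" unfolding D_def by auto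
  then have negD: "negligible (- D)"
    using lipschitz_directional_derivative_ae[OF lip]
    by (simp only:) (intro negligible_countable_Union, auto simp: countable_finite)
  have DA: "\<exists>y\<in>Y. \<exists>j. x \<in> A y k j" if x: "x \<in> D" for x and k :: nat
  proof -
    define e where "e = 1 / (real k + 1)"
    have e: "e > 0" unfolding e_def by simp
    have "\<forall>i\<in>Basis. \<exists>d. ((\<lambda>t::real. f (x + t *\<^sub>R i)) has_real_derivative d) (at 0)"
      using x unfolding D_def by (auto simp: real_differentiable_def)
    then obtain d where d: "\<And>i. i \<in> Basis \<Longrightarrow> ((\<lambda>t::real. f (x + t *\<^sub>R i)) has_real_derivative d i) (at 0)"
      by metis
    define dd where "dd = (\<Sum>i\<in>Basis. d i *\<^sub>R i)"
    have dd: "dd \<bullet> i = d i" if "i \<in> Basis" for i unfolding dd_def using that by simp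
    obtain y where y: "y \<in> Y" "dist dd y < e / 2" using Y(2)[of "ball dd (e/2)"] e by auto
    have "\<exists>j::nat. \<forall>t. \<bar>t\<bar> < 1 / (real j + 1) \<longrightarrow> \<bar>f (x + t *\<^sub>R i) - f x - t * d i\<bar> \<le> \<bar>t\<bar> * (e / 2)"
      if i: "i \<in> Basis" for i
    proof -
      obtain \<delta> where \<delta>: "\<delta> > 0" "\<And>t. \<bar>t\<bar> < \<delta> \<Longrightarrow> \<bar>f (x + t *\<^sub>R i) - f x - d i * t\<bar> \<le> e / 2 * \<bar>t\<bar>"
      proof -
        have "\<exists>\<delta>>0. \<forall>t. \<bar>t\<bar> < \<delta> \<longrightarrow> \<bar>f (x + t *\<^sub>R i) - f x - d i * t\<bar> \<le> e / 2 * \<bar>t\<bar>"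
        proof -
          have "\<forall>e>0. \<exists>\<delta>>0. \<forall>t. \<bar>t\<bar> < \<delta> \<longrightarrow> \<bar>f (x + t *\<^sub>R i) - f x - d i * t\<bar> \<le> e * \<bar>t\<bar>"
            using d[OF i] unfolding has_field_derivative_def has_derivative_at_alt by simp
          then show ?thesis using half_gt_zero[OF e] by blast
        qed
        then show ?thesis using that by blast
      qed
      obtain j :: nat where "1 / (real j + 1) < \<delta>"
        using reals_Archimedean[OF \<delta>(1)] by (auto simp: inverse_eq_divide field_simps)
      then show ?thesis using \<delta>(2) by (intro exI[of _ j]) (auto simp: mult.commute)
    qed
    then obtain J :: "'a \<Rightarrow> nat" where J: "\<And>i t. i \<in> Basis \<Longrightarrow> \<bar>t\<bar> < 1 / (real (J i) + 1) \<Longrightarrow>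
        \<bar>f (x + t *\<^sub>R i) - f x - t * d i\<bar> \<le> \<bar>t\<bar> * (e / 2)" by metis
    define j where "j = Max (J ` Basis)"
    have "x \<in> A y k j"
      unfolding A_def
    proof (intro CollectI ballI allI impI)
      fix i :: 'a and t :: real assume i: "i \<in> Basis" and t: "\<bar>t\<bar> < 1 / (real j + 1)"
      have "J i \<le> j" unfolding j_def using i by simp
      then have "1 / (real j + 1) \<le> 1 / (real (J i) + 1)" by (simp add: frac_le)
      then have "\<bar>f (x + t *\<^sub>R i) - f x - t * d i\<bar> \<le> \<bar>t\<bar> * (e / 2)" using J[OF i] t by auto
      moreover have "\<bar>t * d i - t * (y \<bullet> i)\<bar> \<le> \<bar>t\<bar> * (e / 2)"
      proof -
        have "\<bar>(dd - y) \<bullet> i\<bar> \<le> e / 2"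
          using Basis_le_norm[OF i, of "dd - y"] y(2) by (simp add: dist_norm)
        then have "\<bar>t\<bar> * \<bar>d i - y \<bullet> i\<bar> \<le> \<bar>t\<bar> * (e / 2)"
          using dd[OF i] by (intro mult_left_mono) (auto simp: inner_diff_left)
        then show ?thesis by (simp flip: abs_mult right_diff_distrib)
      qed
      moreover have "\<bar>t\<bar> * (e / 2) + \<bar>t\<bar> * (e / 2) = \<bar>t\<bar> * e" by simp
      ultimately have "\<bar>f (x + t *\<^sub>R i) - f x - t * (y \<bullet> i)\<bar> \<le> \<bar>t\<bar> * e" by linarith
      then show "\<bar>f (x + t *\<^sub>R i) - f x - t * (y \<bullet> i)\<bar> \<le> \<bar>t\<bar> * (1 / (real k + 1))"
        unfolding e_def .
    qed
    then show ?thesis using y by blast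
  qed
  have diff: "f differentiable at x" if x: "x \<in> D" "x \<notin> (\<Union>i\<in>Y \<times> (UNIV :: (nat \<times> nat) set). P (fst i) (fst (snd i)) (snd (snd i)))" for x
  proof (rule differentiable_of_approx_linear)
    fix e :: real assume "e > 0"
    \<comment> \<open>With t the length of the displacement, each coordinate step costs \<epsilon> t
      for the linear approximation at a point of \<open>A y k j\<close>, and L \<epsilon> t for each
      of its two ends, which are moved there from the true position.\<close>
    define C where "C = real DIM('a) * (1 + 2 * L)"
    have C: "C > 0" unfolding C_def using L by simp
    obtain k :: nat where k: "1 / (real k + 1) < e / C"
      using reals_Archimedean[of "e / C"] \<open>e > 0\<close> C by (auto simp: inverse_eq_divide add.commute)
    define \<epsilon> where "\<epsilon> = 1 / (real k + 1)"
    have \<epsilon>: "\<epsilon> > 0" "C * \<epsilon> \<le> e" unfolding \<epsilon>_def using k C by (auto simp: field_simps)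
    obtain y j where yj: "y \<in> Y" "x \<in> A y k j" using DA[OF x(1)] by blast
    have "x \<notin> P y k j" using x(2) yj(1) by (auto dest!: bspec[of _ _ "(y, k, j)"])
    then obtain r where r: "r > 0" "\<And>t z. 0 < t \<Longrightarrow> t < r \<Longrightarrow> dist x z \<le> t \<Longrightarrow> ball z (\<epsilon> * t) \<inter> A y k j \<noteq> {}"
      using yj(2) unfolding P_def \<epsilon>_def by auto
    define \<rho> where "\<rho> = min r (1 / (real j + 1))"
    have "\<bar>f (x + w) - f x - y \<bullet> w\<bar> \<le> e * norm w" if w: "norm w < \<rho>" for w
    proof (cases "w = 0")
      case False
      define t where "t = norm w"
      have t: "t > 0" "t < r" "t < 1 / (real j + 1)" using w False unfolding t_def \<rho>_def by auto
      define W where "W S = (\<Sum>i\<in>S. (w \<bullet> i) *\<^sub>R i)" for S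
      have nW: "norm (W S) \<le> t" if "S \<subseteq> Basis" for S
      proof -
        have "finite S" using that by (rule finite_subset) simp
        have "norm (W S) \<le> norm w"
        proof (rule norm_le_componentwise)
        fix b :: 'a assume b: "b \<in> Basis"
        have "W S \<bullet> b = (\<Sum>i\<in>S. if i = b then w \<bullet> b else 0)"
          unfolding W_def inner_sum_left
        proof (rule sum.cong)
          fix i assume "i \<in> S"
          then have "i \<in> Basis" using that by auto
          then show "(w \<bullet> i) *\<^sub>R i \<bullet> b = (if i = b then w \<bullet> b else 0)" using b by (simp add: inner_Basis)
        qed simp
        also have "\<dots> = (if b \<in> S then w \<bullet> b else 0)" using \<open>finite S\<close> by simp
        finally show "\<bar>W S \<bullet> b\<bar> \<le> \<bar>w \<bullet> b\<bar>" by simp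
        qed
        then show ?thesis unfolding t_def .
      qed
      have main: "\<bar>f (x + W S) - f x - y \<bullet> W S\<bar> \<le> real (card S) * (1 + 2 * L) * \<epsilon> * t"
        if "finite S" "S \<subseteq> Basis" for S using that
      proof (induction S rule: finite_induct)
        case empty then show ?case by (simp add: W_def)
      next
        case (insert i S)
        define z where "z = x + W S"
        define s where "s = w \<bullet> i"
        have i: "i \<in> Basis" "S \<subseteq> Basis" using insert by auto
        have "\<bar>s\<bar> \<le> t" unfolding s_def t_def using i by (simp add: Basis_le_norm)
        have "dist x z \<le> t" unfolding z_def using nW[OF i(2)] by (simp add: dist_norm)
        then obtain a where a: "a \<in> A y k j" "dist z a < \<epsilon> * t" using r(2)[OF t(1,2)] by fastforce
        have "\<bar>f (a + s *\<^sub>R i) - f a - s * (y \<bullet> i)\<bar> \<le> \<bar>s\<bar> * \<epsilon>"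
          using a(1) i \<open>\<bar>s\<bar> \<le> t\<close> t unfolding A_def \<epsilon>_def by simp
        also have "\<dots> \<le> t * \<epsilon>" using \<open>\<bar>s\<bar> \<le> t\<close> \<epsilon> by (intro mult_right_mono) auto
        finally have 1: "\<bar>f (a + s *\<^sub>R i) - f a - s * (y \<bullet> i)\<bar> \<le> t * \<epsilon>" .
        have az: "L * norm (z - a) \<le> L * (\<epsilon> * t)" using a(2) L by (intro mult_left_mono) (auto simp: dist_norm)
        have 2: "\<bar>f (z + s *\<^sub>R i) - f (a + s *\<^sub>R i)\<bar> \<le> L * (\<epsilon> * t)"
          using fl[of "z + s *\<^sub>R i" "a + s *\<^sub>R i"] az by simp
        have 3: "\<bar>f z - f a\<bar> \<le> L * (\<epsilon> * t)" using fl[of z a] az by simp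
        have W: "W (insert i S) = W S + s *\<^sub>R i" unfolding W_def s_def using insert by (simp add: add.commute)
        have IH: "\<bar>f z - f x - y \<bullet> W S\<bar> \<le> real (card S) * (1 + 2 * L) * \<epsilon> * t"
          unfolding z_def using insert.IH i by simp
        have "\<bar>f (x + W (insert i S)) - f x - y \<bullet> W (insert i S)\<bar>
            \<le> real (card S) * (1 + 2 * L) * \<epsilon> * t + (t * \<epsilon> + L * (\<epsilon> * t) + L * (\<epsilon> * t))"
          using 1 2 3 IH unfolding W by (simp add: z_def inner_add_right add.assoc)
        also have "\<dots> = real (card (insert i S)) * (1 + 2 * L) * \<epsilon> * t"
          using insert by (simp add: algebra_simps)
        finally show ?case .
      qed
      have "W Basis = w" unfolding W_def by (rule euclidean_representation)
      then have "\<bar>f (x + w) - f x - y \<bullet> w\<bar> \<le> C * \<epsilon> * t" using main[of Basis] unfolding C_def by simp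
      also have "\<dots> \<le> e * t" using \<epsilon> t by (intro mult_right_mono) auto
      finally show ?thesis unfolding t_def .
    qed auto
    moreover have "\<rho> > 0" unfolding \<rho>_def using r by simp
    ultimately show "\<exists>y. \<exists>\<rho>>0. \<forall>w. norm w < \<rho> \<longrightarrow> \<bar>f (x + w) - f x - y \<bullet> w\<bar> \<le> e * norm w" by blast
  qed
  show ?thesis
    by (rule negligible_subset[OF negligible_Un[OF negD negP]]) (use diff in auto)
qed

lemma rademacher:
  fixes f :: "'a::euclidean_space \<Rightarrow> 'b::euclidean_space"
  assumes lip: "L-lipschitz_on UNIV f"
  shows "negligible {x. \<not> f differentiable at x}"
proof -
  have "negligible {x. \<not> (\<lambda>x. f x \<bullet> i) differentiable at x}" if "i \<in> Basis" for i
  proof (rule rademacher_real)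
    show "L-lipschitz_on UNIV (\<lambda>x. f x \<bullet> i)"
    proof (rule lipschitz_onI)
      fix x y
      have "dist (f x \<bullet> i) (f y \<bullet> i) \<le> dist (f x) (f y)"
        using Basis_le_norm[OF that, of "f x - f y"] by (simp add: dist_norm inner_diff_left)
      also have "\<dots> \<le> L * dist x y" using lip by (rule lipschitz_onD) auto
      finally show "dist (f x \<bullet> i) (f y \<bullet> i) \<le> L * dist x y" .
    qed (use lipschitz_on_nonneg[OF lip] in auto)
  qed
  then have "negligible (\<Union>i\<in>Basis. {x. \<not> (\<lambda>x. f x \<bullet> i) differentiable at x})"
    by (intro negligible_countable_Union) (auto simp: countable_finite)
  then show ?thesis
    by (rule negligible_subset) (auto simp: differentiable_componentwise_within[of f])
qed

text \<open>Near each point, \<open>f\<close> is extended to a Lipschitz map on the whole space by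
  composing it with the nearest point projection onto a closed ball, which does not increase
  distances.\<close>

lemma rademacher_locally_lipschitz:
  fixes f :: "'a::euclidean_space \<Rightarrow> 'b::euclidean_space"
  assumes lip: "locally_lipschitz_on \<Omega> f"
  shows "negligible {x \<in> \<Omega>. \<not> f differentiable at x}"
  unfolding locally_negligible_alt[of "{x \<in> \<Omega>. \<not> f differentiable at x}"]
proof
  fix x assume "x \<in> {x \<in> \<Omega>. \<not> f differentiable at x}"
  then obtain r L where r: "r > 0" "L-lipschitz_on (ball x r) f"
    using lip unfolding locally_lipschitz_on_def by blast
  define B where "B = cball x (r / 2)"
  define F where "F z = f (closest_point B z)" for z
  have B: "closed B" "B \<noteq> {}" "convex B" "B \<subseteq> ball x r" unfolding B_def using r(1) by auto
  have "L-lipschitz_on UNIV F"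
  proof (rule lipschitz_onI)
    fix u v
    have in_ball: "closest_point B z \<in> ball x r" for z using closest_point_in_set[OF B(1,2)] B(4) by blast
    have "dist (F u) (F v) \<le> L * dist (closest_point B u) (closest_point B v)"
      unfolding F_def using r(2) in_ball by (intro lipschitz_onD)
    also have "\<dots> \<le> L * dist u v"
      using closest_point_lipschitz[OF B(3,1,2)] lipschitz_on_nonneg[OF r(2)] by (intro mult_left_mono)
    finally show "dist (F u) (F v) \<le> L * dist u v" .
  qed (use lipschitz_on_nonneg[OF r(2)] in auto)
  then have "negligible {x. \<not> F differentiable at x}" by (rule rademacher)
  moreover have "F differentiable at z \<Longrightarrow> f differentiable at z" if "z \<in> ball x (r / 2)" for z
  proof -
    assume "F differentiable at z"
    then obtain D where "(F has_derivative D) (at z)" by (auto simp: differentiable_def)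
    then have "(f has_derivative D) (at z)"
      by (rule has_derivative_transform_within_open[of F D z UNIV "ball x (r / 2)" f])
         (use that in \<open>auto simp: F_def B_def closest_point_self\<close>)
    then show "f differentiable at z" by (auto simp: differentiable_def)
  qed
  ultimately have "negligible ({x \<in> \<Omega>. \<not> f differentiable at x} \<inter> ball x (r / 2))"
    by (elim negligible_subset) auto
  then show "\<exists>U. openin (top_of_set {x \<in> \<Omega>. \<not> f differentiable at x}) U \<and> x \<in> U \<and> negligible U"
    using r(1) \<open>x \<in> _\<close> by (intro exI[of _ "{x \<in> \<Omega>. \<not> f differentiable at x} \<inter> ball x (r / 2)"]) auto
qed

subsection \<open>Transverse strips\<close>

text \<open>Only \<open>x\<close> is confined to \<open>K\<close>, while \<open>y\<close> may leave
  it: perturbed squares and short segments stay in \<Omega> but not in a given compact set. The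
  radius \<eta> is a Lebesgue number of a cover of \<open>K\<close> by balls.\<close>

lemma uniform_modulus_at_compact:
  fixes f :: "'a::metric_space \<Rightarrow> 'b::metric_space"
  assumes "open \<Omega>" "continuous_on \<Omega> f" "compact K" "K \<subseteq> \<Omega>" "e > 0"
  obtains \<eta> where "\<eta> > 0" "\<And>x y. x \<in> K \<Longrightarrow> dist x y < \<eta> \<Longrightarrow> y \<in> \<Omega> \<and> dist (f x) (f y) < e"
proof -
  have "\<exists>r>0. ball x r \<subseteq> \<Omega> \<and> (\<forall>y\<in>ball x r. dist (f x) (f y) < e / 2)" if x: "x \<in> K" for x
  proof -
    obtain r1 where r1: "r1 > 0" "ball x r1 \<subseteq> \<Omega>" using assms x by (meson openE subsetD)
    have "isCont f x" using assms x continuous_on_eq_continuous_at by blast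
    then obtain r2 where r2: "r2 > 0" "\<And>y. dist y x < r2 \<Longrightarrow> dist (f y) (f x) < e / 2"
      unfolding continuous_at_eps_delta using half_gt_zero[OF \<open>e > 0\<close>] by metis
    show ?thesis using r1 r2 by (intro exI[of _ "min r1 r2"]) (auto simp: dist_commute)
  qed
  then obtain r where r: "\<And>x. x \<in> K \<Longrightarrow> r x > 0" "\<And>x. x \<in> K \<Longrightarrow> ball x (r x) \<subseteq> \<Omega>"
    "\<And>x y. x \<in> K \<Longrightarrow> y \<in> ball x (r x) \<Longrightarrow> dist (f x) (f y) < e / 2" by metis
  obtain \<eta> where \<eta>: "\<eta> > 0" "\<And>x. x \<in> K \<Longrightarrow> \<exists>G \<in> (\<lambda>x. ball x (r x)) ` K. ball x \<eta> \<subseteq> G"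
  proof (rule Heine_Borel_lemma[of K "(\<lambda>x. ball x (r x)) ` K"])
    show "K \<subseteq> \<Union> ((\<lambda>x. ball x (r x)) ` K)" using r(1) by (auto intro!: bexI)
  qed (use assms(3) in auto)
  show ?thesis
  proof (rule that[OF \<eta>(1)])
    fix x y assume xy: "x \<in> K" "dist x y < \<eta>"
    obtain z where z: "z \<in> K" "ball x \<eta> \<subseteq> ball z (r z)" using \<eta>(2)[OF xy(1)] by auto
    then have "x \<in> ball z (r z)" "y \<in> ball z (r z)" using xy(2) \<eta>(1) by (simp_all add: subset_iff)
    then show "y \<in> \<Omega> \<and> dist (f x) (f y) < e"
      using r(2)[OF z(1)] r(3)[OF z(1), of x] r(3)[OF z(1), of y] dist_triangle_half_r by blast
  qed
qed

lemma locally_lipschitz_on_imp_continuous_on: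
  assumes "locally_lipschitz_on \<Omega> f"
  shows "continuous_on \<Omega> f"
  unfolding continuous_on_eq_continuous_within
proof
  fix x assume "x \<in> \<Omega>"
  then obtain r L where r: "r > 0" "L-lipschitz_on (ball x r) f"
    using assms unfolding locally_lipschitz_on_def by blast
  then have "isCont f x"
    using lipschitz_on_continuous_on[OF r(2)] by (simp add: continuous_on_eq_continuous_at)
  then show "continuous (at x within \<Omega>) f" by (rule continuous_at_imp_continuous_at_within)
qed

text \<open>Sard's theorem treats the points off \<open>Z\<close>. On \<open>Z\<close> a Lipschitz
  bound at each point keeps the image null, as domain and target have the same dimension.\<close>

lemma negligible_image_of_low_rank:
  fixes \<Phi> :: "real^2 \<Rightarrow> real^2"
  assumes Z: "negligible Z"
    and lip: "\<And>p. p \<in> S \<Longrightarrow> \<exists>B. \<forall>\<^sub>F y in at p. norm (\<Phi> y - \<Phi> p) \<le> B * norm (y - p)"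
    and der: "\<And>p. p \<in> S - Z \<Longrightarrow> (\<Phi> has_derivative (\<lambda>h. M p *v h)) (at p)"
    and rank: "\<And>p. p \<in> S - Z \<Longrightarrow> rank (M p) \<le> 1"
  shows "negligible (\<Phi> ` S)"
proof -
  have "negligible (\<Phi> ` (S - Z))"
  proof (rule baby_Sard)
    fix p assume p: "p \<in> S - Z"
    show "(\<Phi> has_derivative (\<lambda>h. M p *v h)) (at p within S - Z)"
      using der[OF p] by (rule has_derivative_at_withinI)
    show "rank (matrix (\<lambda>h. M p *v h)) < CARD(2)" using rank[OF p] by simp
  qed simp
  moreover have "negligible (\<Phi> ` (S \<inter> Z))"
  proof (rule negligible_locally_Lipschitz_image)
    show "negligible (S \<inter> Z)" using Z by (simp add: negligible_Int)
    fix p assume "p \<in> S \<inter> Z"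
    then obtain B where "\<forall>\<^sub>F y in at p. norm (\<Phi> y - \<Phi> p) \<le> B * norm (y - p)" using lip by blast
    then obtain T where T: "open T" "p \<in> T" "\<And>y. y \<in> T \<Longrightarrow> y \<noteq> p \<Longrightarrow> norm (\<Phi> y - \<Phi> p) \<le> B * norm (y - p)"
      unfolding eventually_at_topological by blast
    have "norm (\<Phi> y - \<Phi> p) \<le> B * norm (y - p)" if "y \<in> T" for y
      using T(3)[OF that] by (cases "y = p") auto
    then show "\<exists>T B. open T \<and> p \<in> T \<and> (\<forall>y\<in>S \<inter> Z \<inter> T. norm (\<Phi> y - \<Phi> p) \<le> B * norm (y - p))"
      using T(1,2) by blast
  qed simp
  ultimately have "negligible (\<Phi> ` (S - Z) \<union> \<Phi> ` (S \<inter> Z))" by (rule negligible_Un)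
  then show ?thesis by (rule negligible_subset) auto
qed

lemma eventually_lipschitz_of_differentiable:
  fixes g :: "'a::real_normed_vector \<Rightarrow> 'b::real_normed_vector"
  assumes "g differentiable at p"
  shows "\<exists>B\<ge>0. \<forall>\<^sub>F y in at p. norm (g y - g p) \<le> B * norm (y - p)"
proof -
  obtain D where D: "bounded_linear D"
    "\<And>e. e > 0 \<Longrightarrow> \<exists>d>0. \<forall>y. norm (y - p) < d \<longrightarrow> norm (g y - g p - D (y - p)) \<le> e * norm (y - p)"
    using assms unfolding differentiable_def has_derivative_at_alt by blast
  obtain d where d: "d > 0" "\<And>y. norm (y - p) < d \<Longrightarrow> norm (g y - g p - D (y - p)) \<le> 1 * norm (y - p)"
    using D(2)[of 1] by auto
  have "norm (g y - g p) \<le> (1 + onorm D) * norm (y - p)" if "norm (y - p) < d" for y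
    using d(2)[OF that] onorm[OF D(1), of "y - p"] norm_triangle_ineq[of "g y - g p - D (y - p)" "D (y - p)"]
    by (simp add: distrib_right)
  then show ?thesis using d(1) onorm_pos_le[OF D(1)]
    by (intro exI[of _ "1 + onorm D"]) (auto simp: eventually_at dist_norm intro!: exI[of _ d])
qed

text \<open>The given square may lie inside the null set where \<open>f\<close> has no derivative or
  one of larger rank. It is replaced by a polynomial map, for the sake of differentiability, and
  this by a generic small translate. At almost every parameter the chain rule then factors the
  derivative of the planar map through a matrix of rank at most 1.\<close>

lemma exists_generic_perturbation:
  fixes f :: "real^'n \<Rightarrow> real^'m" and \<Gamma> :: "real^2 \<Rightarrow> real^'n"
  assumes \<Omega>: "open \<Omega>" and lip: "locally_lipschitz_on \<Omega> f"
    and rk: "AE x in lebesgue. x \<in> \<Omega> \<longrightarrow> f differentiable at x \<longrightarrow> rank (jacobian f (at x)) \<le> 1"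
    and S: "compact S" "continuous_on S \<Gamma>" "\<Gamma> ` S \<subseteq> \<Omega>" and \<eta>: "\<eta> > 0"
  obtains \<Gamma>' where "continuous_on S \<Gamma>'" "\<Gamma>' ` S \<subseteq> \<Omega>" "\<And>p. p \<in> S \<Longrightarrow> dist (\<Gamma> p) (\<Gamma>' p) < \<eta>"
    "negligible ((\<lambda>p. vector [a \<bullet> f (\<Gamma>' p), b \<bullet> f (\<Gamma>' p)] :: real^2) ` S)"
proof -
  have "compact (\<Gamma> ` S)" using S by (simp add: compact_continuous_image)
  then obtain \<eta>0 where \<eta>0: "\<eta>0 > 0" "(\<Union>x\<in>\<Gamma> ` S. ball x \<eta>0) \<subseteq> \<Omega>"
    using compact_subset_open_imp_ball_epsilon_subset[OF _ \<Omega> S(3)] by blast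
  \<comment> \<open>The polynomial approximation and the translation may each move points by
    \<open>e\<close>.\<close>
  define e where "e = min \<eta> \<eta>0 / 2"
  have e: "e > 0" "2 * e \<le> \<eta>" "2 * e \<le> \<eta>0" unfolding e_def using \<eta> \<eta>0(1) by auto
  obtain g where g: "polynomial_function g" "\<And>p. p \<in> S \<Longrightarrow> norm (\<Gamma> p - g p) < e"
    using Stone_Weierstrass_polynomial_function[OF S(1,2) e(1)] by blast
  define N where "N = {x \<in> \<Omega>. \<not> (f differentiable at x \<and> rank (jacobian f (at x)) \<le> 1)}"
  have "negligible {x. \<not> (x \<in> \<Omega> \<longrightarrow> f differentiable at x \<longrightarrow> rank (jacobian f (at x)) \<le> 1)}"
    unfolding negligible_iff_AE_lborel
    by (rule eventually_mono[OF rk[unfolded AE_completion_iff]]) auto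
  then have "negligible ({x. \<not> (x \<in> \<Omega> \<longrightarrow> f differentiable at x \<longrightarrow> rank (jacobian f (at x)) \<le> 1)}
      \<union> {x \<in> \<Omega>. \<not> f differentiable at x})"
    using rademacher_locally_lipschitz[OF lip] by (rule negligible_Un)
  then have "negligible N" by (rule negligible_subset) (auto simp: N_def)
  \<comment> \<open>Fubini is applied to a Borel set, so the null set is enlarged to a Borel null
    set.\<close>
  then obtain N' where N': "N' \<in> null_sets lborel" "N \<subseteq> N'"
    unfolding negligible_iff_null_sets null_sets_completion_iff2 by blast
  have N'b: "N' \<in> sets borel" "negligible N'"
    using N'(1) by (auto simp: negligible_iff_null_sets null_sets_completionI dest: null_setsD2)
  have gm: "g \<in> borel_measurable borel"
    using continuous_on_polymonial_function[OF g(1)] by (rule borel_measurable_continuous_onI)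
  have "AE v in lborel. negligible {p. g p + v \<in> N'}"
    using AE_negligible_translate_preimage[OF N'b gm] .
  then have neg: "negligible {v. \<not> negligible {p. g p + v \<in> N'}}"
    by (simp add: negligible_iff_AE_lborel)
  have "\<not> negligible (ball (0::real^'n) e)"
    using e(1) by (intro open_not_negligible) auto
  then have "\<not> ball (0::real^'n) e \<subseteq> {v. \<not> negligible {p. g p + v \<in> N'}}"
    using neg negligible_subset by blast
  then obtain v where v: "norm v < e" "negligible {p. g p + v \<in> N'}" by auto
  define \<Gamma>' where "\<Gamma>' p = g p + v" for p
  define M where "M = (vector [a, b] :: real^'m^2)"
  define \<Phi> where "\<Phi> p = M *v f (\<Gamma>' p)" for p
  have close: "dist (\<Gamma> p) (\<Gamma>' p) < 2 * e" if "p \<in> S" for p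
    using g(2)[OF that] v(1) norm_triangle_ineq4[of "\<Gamma> p - g p" v]
    unfolding \<Gamma>'_def dist_norm by (simp add: algebra_simps)
  have sub: "\<Gamma>' ` S \<subseteq> \<Omega>" using close \<eta>0(2) e(3) by (fastforce simp: subset_iff)
  have diff\<Gamma>: "\<Gamma>' differentiable at p" for p
    unfolding \<Gamma>'_def using differentiable_at_polynomial_function[OF g(1)] by (intro differentiable_add) auto
  have "negligible (\<Phi> ` S)"
  proof (rule negligible_image_of_low_rank[OF v(2)])
    fix p assume p: "p \<in> S"
    then have "\<Gamma>' p \<in> \<Omega>" using sub by auto
    then obtain r L where r: "r > 0" "L-lipschitz_on (ball (\<Gamma>' p) r) f"
      using lip unfolding locally_lipschitz_on_def by blast
    have L: "L \<ge> 0" using r(2) lipschitz_on_nonneg by blast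
    obtain B where B: "B \<ge> 0" "\<forall>\<^sub>F y in at p. norm (\<Gamma>' y - \<Gamma>' p) \<le> B * norm (y - p)"
      using eventually_lipschitz_of_differentiable[OF diff\<Gamma>] by blast
    have "isCont \<Gamma>' p" using diff\<Gamma> by (rule differentiable_imp_continuous_within)
    then have "\<forall>\<^sub>F y in at p. dist (\<Gamma>' y) (\<Gamma>' p) < r" using r(1) unfolding isCont_def tendsto_iff by blast
    with B(2) have "\<forall>\<^sub>F y in at p. norm (\<Phi> y - \<Phi> p) \<le> (onorm ((*v) M) * (L * B)) * norm (y - p)"
    proof eventually_elim
      case (elim y)
      have "norm (f (\<Gamma>' y) - f (\<Gamma>' p)) \<le> L * norm (\<Gamma>' y - \<Gamma>' p)"
        using lipschitz_onD[OF r(2), of "\<Gamma>' y" "\<Gamma>' p"] elim(2) r(1) by (simp add: dist_norm norm_minus_commute)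
      also have "\<dots> \<le> L * (B * norm (y - p))" using elim(1) L by (rule mult_left_mono)
      finally have fl: "norm (f (\<Gamma>' y) - f (\<Gamma>' p)) \<le> L * (B * norm (y - p))" .
      have "norm (\<Phi> y - \<Phi> p) = norm (M *v (f (\<Gamma>' y) - f (\<Gamma>' p)))"
        unfolding \<Phi>_def by (simp add: matrix_vector_mult_diff_distrib)
      also have "\<dots> \<le> onorm ((*v) M) * norm (f (\<Gamma>' y) - f (\<Gamma>' p))"
        by (rule onorm) (rule matrix_vector_mul_bounded_linear)
      also have "\<dots> \<le> onorm ((*v) M) * (L * (B * norm (y - p)))"
        using fl by (rule mult_left_mono) (simp add: onorm_pos_le)
      finally show ?case by (simp add: mult.assoc)
    qed
    then show "\<exists>B. \<forall>\<^sub>F y in at p. norm (\<Phi> y - \<Phi> p) \<le> B * norm (y - p)" by blast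
  next
    fix p assume "p \<in> S - {p. g p + v \<in> N'}"
    then have "\<Gamma>' p \<in> \<Omega>" "\<Gamma>' p \<notin> N" using sub N'(2) unfolding \<Gamma>'_def by auto
    then have fd: "f differentiable at (\<Gamma>' p)" "rank (jacobian f (at (\<Gamma>' p))) \<le> 1" unfolding N_def by auto
    have 1: "(f has_derivative (\<lambda>h. jacobian f (at (\<Gamma>' p)) *v h)) (at (\<Gamma>' p))"
      using fd(1) jacobian_works by blast
    have 2: "(\<Gamma>' has_derivative (\<lambda>h. jacobian \<Gamma>' (at p) *v h)) (at p)"
      using diff\<Gamma> jacobian_works by blast
    have 3: "((\<lambda>z. M *v z) has_derivative (\<lambda>z. M *v z)) (at z)" for z
      by (intro bounded_linear_imp_has_derivative matrix_vector_mul_bounded_linear)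
    have "(\<Phi> has_derivative (\<lambda>h. M *v (jacobian f (at (\<Gamma>' p)) *v (jacobian \<Gamma>' (at p) *v h)))) (at p)"
      unfolding \<Phi>_def by (rule has_derivative_compose[OF has_derivative_compose[OF 2 1] 3])
    then show "(\<Phi> has_derivative (\<lambda>h. (M ** jacobian f (at (\<Gamma>' p)) ** jacobian \<Gamma>' (at p)) *v h)) (at p)"
      by (simp only: matrix_vector_mul_assoc matrix_mul_assoc)
    show "rank (M ** jacobian f (at (\<Gamma>' p)) ** jacobian \<Gamma>' (at p)) \<le> 1"
      using fd(2) rank_mul_le_left rank_mul_le_right by (meson le_trans)
  qed
  moreover have "\<Phi> p = vector [a \<bullet> f (\<Gamma>' p), b \<bullet> f (\<Gamma>' p)]" for p
    unfolding \<Phi>_def M_def by (simp add: vec_eq_iff forall_2 matrix_vector_mul_component)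
  ultimately have "negligible ((\<lambda>p. vector [a \<bullet> f (\<Gamma>' p), b \<bullet> f (\<Gamma>' p)] :: real^2) ` S)" by (simp add: image_def)
  moreover have "continuous_on S \<Gamma>'"
    by (rule continuous_at_imp_continuous_on) (use differentiable_imp_continuous_within[OF diff\<Gamma>] in blast)
  moreover have "dist (\<Gamma> p) (\<Gamma>' p) < \<eta>" if "p \<in> S" for p using close[OF that] e(2) by linarith
  ultimately show ?thesis using that sub by blast
qed

text \<open>Brouwer's theorem is applied to x - F x clamped to the cube. The sign conditions push
  the points of each face inward, so a fixed point lies on no face; there the clamp is inactive and
  F vanishes.\<close>

lemma poincare_miranda:
  fixes F :: "real^'n \<Rightarrow> real^'n"
  assumes cont: "continuous_on (cbox 0 1) F"
    and neg: "\<And>x i. x \<in> cbox 0 1 \<Longrightarrow> x $ i = 0 \<Longrightarrow> F x $ i < 0"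
    and pos: "\<And>x i. x \<in> cbox 0 1 \<Longrightarrow> x $ i = 1 \<Longrightarrow> F x $ i > 0"
  obtains x where "x \<in> cbox 0 1" "F x = 0"
proof -
  define T where "T x = (\<chi> i. max 0 (min 1 (x $ i - F x $ i)))" for x
  have "continuous_on (cbox 0 1) T"
    unfolding T_def by (intro continuous_intros cont)
  moreover have "T \<in> cbox 0 1 \<rightarrow> cbox 0 1" unfolding T_def by (auto simp: mem_box_cart)
  moreover have "(0::real^'n) \<in> cbox 0 1" by (simp add: mem_box_cart)
  ultimately obtain x where x: "x \<in> cbox 0 1" "T x = x"
    using brouwer[of "cbox 0 1" T] compact_cbox convex_box(1) by (metis empty_iff)
  have "F x $ i = 0" for i
  proof -
    have xi: "max 0 (min 1 (x $ i - F x $ i)) = x $ i"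
      using x(2) by (metis (no_types, lifting) T_def vec_lambda_beta)
    have "0 \<le> x $ i" "x $ i \<le> 1" using x(1) by (auto simp: mem_box_cart)
    then show ?thesis using xi neg[OF x(1), of i] pos[OF x(1), of i] by (auto simp: max_def min_def split: if_splits)
  qed
  then show ?thesis using that x(1) by (simp add: vec_eq_iff)
qed

text \<open>The penalty \<open>L * \<bar>v x - c\<bar>\<close> vanishes at the crossing, so it may be added with opposite
  signs at the bottom and at the top edge.\<close>

lemma crossing_in_square:
  fixes u v :: "real^2 \<Rightarrow> real"
  assumes cont: "continuous_on (cbox 0 1) u" "continuous_on (cbox 0 1) v"
    and left: "\<And>x. x \<in> cbox 0 1 \<Longrightarrow> x $ 1 = 0 \<Longrightarrow> v x < c"
    and right: "\<And>x. x \<in> cbox 0 1 \<Longrightarrow> x $ 1 = 1 \<Longrightarrow> c < v x"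
    and bottom: "\<And>x. x \<in> cbox 0 1 \<Longrightarrow> x $ 2 = 0 \<Longrightarrow> u x - \<gamma> - L * \<bar>v x - c\<bar> < 0"
    and top: "\<And>x. x \<in> cbox 0 1 \<Longrightarrow> x $ 2 = 1 \<Longrightarrow> u x - \<gamma> + L * \<bar>v x - c\<bar> > 0"
  obtains x where "x \<in> cbox 0 1" "u x = \<gamma>" "v x = c"
proof -
  \<comment> \<open>The factor \<open>2 * x $ 2 - 1\<close> passes continuously from -1 at the
    bottom edge to 1 at the top edge.\<close>
  define F :: "real^2 \<Rightarrow> real^2" where
    "F x = (\<chi> i. if i = 1 then v x - c else u x - \<gamma> + L * (2 * x $ 2 - 1) * \<bar>v x - c\<bar>)" for x
  have F: "F x $ 1 = v x - c" "F x $ 2 = u x - \<gamma> + L * (2 * x $ 2 - 1) * \<bar>v x - c\<bar>" for x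
    unfolding F_def by auto
  have "continuous_on (cbox 0 1) F"
    unfolding F_def
  proof (rule continuous_on_vec_lambda)
    fix i :: 2
    show "continuous_on (cbox 0 1) (\<lambda>x. if i = 1 then v x - c else u x - \<gamma> + L * (2 * x $ 2 - 1) * \<bar>v x - c\<bar>)"
      by (cases "i = 1") (auto intro!: continuous_intros cont)
  qed
  moreover have "F x $ i < 0" if "x \<in> cbox 0 1" "x $ i = 0" for x i
    using exhaust_2[of i] left[OF that(1)] bottom[OF that(1)] that(2) by (auto simp: F)
  moreover have "F x $ i > 0" if "x \<in> cbox 0 1" "x $ i = 1" for x i
    using exhaust_2[of i] right[OF that(1)] top[OF that(1)] that(2) by (auto simp: F)
  ultimately obtain x where x: "x \<in> cbox 0 1" "F x = 0" using poincare_miranda[of F] by blast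
  then have "v x = c" using F(1)[of x] by simp
  moreover then have "u x = \<gamma>" using F(2)[of x] x(2) by simp
  ultimately show ?thesis using that x(1) by blast
qed


text \<open>In the plane with coordinates u = \<open>a \<bullet> f - t1\<close> and v =
  \<open>b \<bullet> f\<close>, the path \<open>p\<close> stays near the axis u = 0 and
  \<open>q\<close> near the line u = t2 - t1 - s v, which at height \<open>c\<close> lies at least
  10 \<delta> to the right. Both paths climb past \<open>c\<close>. The perturbed square of a
  homotopy must then attain all points near (4 \<delta>, c), although its image is null.\<close>

lemma no_transverse_strips_aux:
  fixes f :: "real^'n \<Rightarrow> real^'m"
  assumes \<Omega>: "open \<Omega>" "simply_connected \<Omega>" and lip: "locally_lipschitz_on \<Omega> f"
    and rk: "AE x in lebesgue. x \<in> \<Omega> \<longrightarrow> f differentiable at x \<longrightarrow> rank (jacobian f (at x)) \<le> 1"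
    and p: "path p" "path_image p \<subseteq> \<Omega>" "pathstart p = x1" "pathfinish p = y1"
    and q: "path q" "path_image q \<subseteq> \<Omega>" "pathstart q = x2" "pathfinish q = y2"
    and pa: "\<And>z. z \<in> path_image p \<Longrightarrow> \<bar>a \<bullet> f z - t1\<bar> < \<delta>"
    and qa: "\<And>z. z \<in> path_image q \<Longrightarrow> \<bar>(a + s *\<^sub>R b) \<bullet> f z - t2\<bar> < \<delta>"
    and capx: "closed_segment x1 x2 \<subseteq> \<Omega>" "\<And>z. z \<in> closed_segment x1 x2 \<Longrightarrow> \<bar>b \<bullet> f z - b \<bullet> f x1\<bar> \<le> \<epsilon> / 5"
    and capy: "closed_segment y2 y1 \<subseteq> \<Omega>" "\<And>z. z \<in> closed_segment y2 y1 \<Longrightarrow> \<bar>b \<bullet> f z - b \<bullet> f y1\<bar> \<le> \<epsilon> / 5"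
    and \<delta>: "\<delta> > 0" "100 * \<delta> \<le> \<epsilon>"
    and c: "b \<bullet> f x1 + 2 / 5 * \<epsilon> \<le> c" "c \<le> b \<bullet> f y1 - 2 / 5 * \<epsilon>"
    and sc: "t2 - t1 - s * c \<ge> 10 * \<delta>"
  shows False
proof -
  let ?S = "cbox (0::real^2) 1"
  \<comment> \<open>Caps join the ends of \<open>q\<close> to those of \<open>p\<close>, so that the
    two paths are homotopic with fixed ends; on the caps \<open>b \<bullet> f\<close> stays away
    from \<open>c\<close>.\<close>
  define q' where "q' = linepath x1 x2 +++ q +++ linepath y2 y1"
  have q': "path q'" "pathstart q' = x1" "pathfinish q' = y1"
    unfolding q'_def using q by auto
  have q'im: "path_image q' = closed_segment x1 x2 \<union> path_image q \<union> closed_segment y2 y1"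
    unfolding q'_def using q by (simp add: path_image_join Un_assoc)
  have "homotopic_paths \<Omega> p q'"
    using \<Omega>(2) p q q' q'im capx(1) capy(1) unfolding simply_connected_eq_homotopic_paths by simp
  then have "\<exists>h :: real \<times> real \<Rightarrow> real^'n. continuous_on ({0..1} \<times> {0..1}) h \<and> h \<in> ({0..1} \<times> {0..1}) \<rightarrow> \<Omega> \<and>
      (\<forall>x\<in>{0..1}. h (0, x) = p x) \<and> (\<forall>x\<in>{0..1}. h (1, x) = q' x) \<and>
      (\<forall>t\<in>{0..1}. h (t, 0) = x1 \<and> h (t, 1) = y1)"
    unfolding homotopic_paths p(3,4) by (simp add: pathstart_def pathfinish_def)
  then obtain h :: "real \<times> real \<Rightarrow> real^'n" where h: "continuous_on ({0..1} \<times> {0..1}) h" "h \<in> ({0..1} \<times> {0..1}) \<rightarrow> \<Omega>"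
      "\<And>x. x \<in> {0..1} \<Longrightarrow> h (0, x) = p x" "\<And>x. x \<in> {0..1} \<Longrightarrow> h (1, x) = q' x"
      "\<And>t. t \<in> {0..1} \<Longrightarrow> h (t, 0) = x1" "\<And>t. t \<in> {0..1} \<Longrightarrow> h (t, 1) = y1"
    by blast
  define \<Gamma> where "\<Gamma> x = h (x $ 2, x $ 1)" for x :: "real^2"
  have unit: "x $ i \<in> {0..1}" if "x \<in> ?S" for x i using that by (auto simp: mem_box_cart)
  have cont\<Gamma>: "continuous_on ?S \<Gamma>"
    unfolding \<Gamma>_def
    by (rule continuous_on_compose2[OF h(1)]) (use unit in \<open>auto intro!: continuous_intros\<close>)
  have \<Gamma>\<Omega>: "\<Gamma> ` ?S \<subseteq> \<Omega>" unfolding \<Gamma>_def using h(2) unit by (auto simp: Pi_iff)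
  have fcont: "continuous_on \<Omega> f" using lip by (rule locally_lipschitz_on_imp_continuous_on)
  define u where "u z = a \<bullet> f z - t1" for z
  define v where "v z = b \<bullet> f z" for z
  have uv: "continuous_on \<Omega> (\<lambda>z. (u z, v z))" unfolding u_def v_def by (intro continuous_intros fcont)
  \<comment> \<open>The perturbation of \<open>v\<close> has to stay below \<delta> also after
    multiplication by \<open>s\<close>.\<close>
  define \<delta>' where "\<delta>' = \<delta> / (1 + \<bar>s\<bar>)"
  have \<delta>': "\<delta>' > 0" "\<delta>' \<le> \<delta>" "\<bar>s\<bar> * \<delta>' \<le> \<delta>" unfolding \<delta>'_def using \<delta>(1) by (auto simp: field_simps)
  have "compact (\<Gamma> ` ?S)" using cont\<Gamma> by (simp add: compact_continuous_image)
  then obtain \<eta> where \<eta>: "\<eta> > 0" "\<And>x y. x \<in> \<Gamma> ` ?S \<Longrightarrow> dist x y < \<eta> \<Longrightarrow> y \<in> \<Omega> \<and> dist (u x, v x) (u y, v y) < \<delta>'"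
    using uniform_modulus_at_compact[OF \<Omega>(1) uv _ \<Gamma>\<Omega> \<delta>'(1)] by metis
  obtain \<Gamma>' where \<Gamma>': "continuous_on ?S \<Gamma>'" "\<Gamma>' ` ?S \<subseteq> \<Omega>" "\<And>x. x \<in> ?S \<Longrightarrow> dist (\<Gamma> x) (\<Gamma>' x) < \<eta>"
    "negligible ((\<lambda>x. vector [a \<bullet> f (\<Gamma>' x), b \<bullet> f (\<Gamma>' x)] :: real^2) ` ?S)"
    by (rule exists_generic_perturbation[OF \<Omega>(1) lip rk compact_cbox cont\<Gamma> \<Gamma>\<Omega> \<eta>(1), of a b]) (rule that)
  define u' where "u' x = u (\<Gamma>' x)" for x
  define v' where "v' x = v (\<Gamma>' x)" for x
  have close: "\<bar>u (\<Gamma> x) - u' x\<bar> < \<delta>'" "\<bar>v (\<Gamma> x) - v' x\<bar> < \<delta>'" if "x \<in> ?S" for x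
  proof -
    have "dist (u (\<Gamma> x), v (\<Gamma> x)) (u' x, v' x) < \<delta>'"
      unfolding u'_def v'_def using \<eta>(2)[of "\<Gamma> x" "\<Gamma>' x"] \<Gamma>'(3)[OF that] that by blast
    then show "\<bar>u (\<Gamma> x) - u' x\<bar> < \<delta>'" "\<bar>v (\<Gamma> x) - v' x\<bar> < \<delta>'"
      using dist_fst_le[of "(u (\<Gamma> x), v (\<Gamma> x))" "(u' x, v' x)"] dist_snd_le[of "(u (\<Gamma> x), v (\<Gamma> x))" "(u' x, v' x)"]
      by (auto simp: dist_real_def)
  qed
  have cont': "continuous_on ?S u'" "continuous_on ?S v'"
  proof -
    have "continuous_on ?S (\<lambda>x. f (\<Gamma>' x))" using continuous_on_compose2[OF fcont \<Gamma>'(1,2)] .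
    then show "continuous_on ?S u'" "continuous_on ?S v'"
      unfolding u'_def v'_def u_def v_def by (auto intro!: continuous_intros)
  qed
  have "compact (u' ` ?S)" using cont'(1) by (simp add: compact_continuous_image)
  then have "bounded (u' ` ?S)" by (rule compact_imp_bounded)
  then have "\<exists>R. \<forall>y\<in>u' ` ?S. \<bar>y\<bar> \<le> R" unfolding bounded_real .
  then obtain R where R: "\<And>x. x \<in> ?S \<Longrightarrow> \<bar>u' x\<bar> \<le> R" by blast
  have "R \<ge> 0" using R[of 0] by (auto simp: mem_box_cart)
  \<comment> \<open>The penalty has two tasks on the top edge. Along \<open>q\<close> its slope, at
    least \<bar>s\<bar>, absorbs the inclination of the strip. On the caps, where \<open>v'\<close>
    is \<epsilon> / 10 away from the level, it outweighs the bound \<open>R\<close> on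
    \<open>u'\<close> plus 6 \<delta>, more than any \<gamma> in use.\<close>
  define L where "L = \<bar>s\<bar> + (R + 6 * \<delta>) / (\<epsilon> / 10)"
  have L: "L \<ge> \<bar>s\<bar>" "L * (\<epsilon> / 10) \<ge> R + 6 * \<delta>"
  proof -
    have "L * (\<epsilon> / 10) = \<bar>s\<bar> * (\<epsilon> / 10) + (R + 6 * \<delta>)"
      unfolding L_def using \<delta> by (simp add: field_simps)
    then show "L * (\<epsilon> / 10) \<ge> R + 6 * \<delta>" using \<delta> by simp
    show "L \<ge> \<bar>s\<bar>" unfolding L_def using \<delta> \<open>R \<ge> 0\<close> by simp
  qed
  \<comment> \<open>Levels of \<open>u\<close> between 3 \<delta> and 5 \<delta> separate the two
    paths: \<open>u'\<close> is below 2 \<delta> at the bottom and, up to the penalty, above 6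
    \<delta> along \<open>q\<close>, since the strip width and the perturbations use up four of the
    10 \<delta>.\<close>
  define W where "W = box (vector [t1 + 3 * \<delta>, c - \<delta>'] :: real^2) (vector [t1 + 5 * \<delta>, c + \<delta>'])"
  have "W \<subseteq> (\<lambda>x. vector [a \<bullet> f (\<Gamma>' x), b \<bullet> f (\<Gamma>' x)]) ` ?S"
  proof
    fix w assume "w \<in> W"
    define \<gamma> where "\<gamma> = w $ 1 - t1"
    define c' where "c' = w $ 2"
    have \<gamma>: "3 * \<delta> < \<gamma>" "\<gamma> < 5 * \<delta>" and c': "c - \<delta>' < c'" "c' < c + \<delta>'"
      using \<open>w \<in> W\<close> unfolding W_def \<gamma>_def c'_def by (auto simp: mem_box_cart forall_2)
    obtain x where x: "x \<in> ?S" "u' x = \<gamma>" "v' x = c'"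
    proof (rule crossing_in_square[OF cont'])
      fix x :: "real^2" assume x: "x \<in> ?S" "x $ 1 = 0"
      then have "\<Gamma> x = x1" unfolding \<Gamma>_def using h(5) unit by simp
      then show "v' x < c'" using close(2)[OF x(1)] c' c \<delta>' \<delta> unfolding v_def by simp
    next
      fix x :: "real^2" assume x: "x \<in> ?S" "x $ 1 = 1"
      then have "\<Gamma> x = y1" unfolding \<Gamma>_def using h(6) unit by simp
      then show "c' < v' x" using close(2)[OF x(1)] c' c \<delta>' \<delta> unfolding v_def by simp
    next
      fix x :: "real^2" assume x: "x \<in> ?S" "x $ 2 = 0"
      then have "\<Gamma> x = p (x $ 1)" "x $ 1 \<in> {0..1}" unfolding \<Gamma>_def using h(3) unit by auto
      then have "\<Gamma> x \<in> path_image p" by (simp add: path_image_def)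
      then have "\<bar>u (\<Gamma> x)\<bar> < \<delta>" using pa unfolding u_def by simp
      then have "u' x < 2 * \<delta>" using close(1)[OF x(1)] \<delta>' by linarith
      moreover have "L * \<bar>v' x - c'\<bar> \<ge> 0" using L(1) by simp
      ultimately show "u' x - \<gamma> - L * \<bar>v' x - c'\<bar> < 0" using \<gamma> \<delta> by linarith
    next
      fix x :: "real^2" assume x: "x \<in> ?S" "x $ 2 = 1"
      then have "\<Gamma> x = q' (x $ 1)" "x $ 1 \<in> {0..1}" unfolding \<Gamma>_def using h(4) unit by auto
      then have "\<Gamma> x \<in> path_image q'" by (simp add: path_image_def)
      then consider "\<Gamma> x \<in> closed_segment x1 x2" | "\<Gamma> x \<in> closed_segment y2 y1" | "\<Gamma> x \<in> path_image q"
        unfolding q'im by auto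
      then show "u' x - \<gamma> + L * \<bar>v' x - c'\<bar> > 0"
      proof cases
        case 3
        have "\<bar>u (\<Gamma> x) + s * v (\<Gamma> x) - (t2 - t1)\<bar> < \<delta>"
          using qa[OF 3] unfolding u_def v_def by (simp add: inner_add_left algebra_simps)
        moreover have "\<bar>s * v (\<Gamma> x) - s * v' x\<bar> \<le> \<delta>"
        proof -
          have "\<bar>s * v (\<Gamma> x) - s * v' x\<bar> = \<bar>s\<bar> * \<bar>v (\<Gamma> x) - v' x\<bar>" by (simp add: abs_mult flip: right_diff_distrib)
          also have "\<dots> \<le> \<bar>s\<bar> * \<delta>'" using close(2)[OF x(1)] by (intro mult_left_mono) auto
          finally show ?thesis using \<delta>' by linarith
        qed
        moreover have "\<bar>s * c - s * c'\<bar> \<le> \<delta>"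
        proof -
          have "\<bar>s * c - s * c'\<bar> = \<bar>s\<bar> * \<bar>c - c'\<bar>" by (simp add: abs_mult flip: right_diff_distrib)
          also have "\<dots> \<le> \<bar>s\<bar> * \<delta>'" using c' by (intro mult_left_mono) auto
          finally show ?thesis using \<delta>' by linarith
        qed
        moreover have "s * v' x - s * c' \<le> L * \<bar>v' x - c'\<bar>"
        proof -
          have "s * v' x - s * c' \<le> \<bar>s\<bar> * \<bar>v' x - c'\<bar>" by (metis abs_ge_self abs_mult right_diff_distrib)
          also have "\<dots> \<le> L * \<bar>v' x - c'\<bar>" using L(1) by (intro mult_right_mono) auto
          finally show ?thesis .
        qed
        ultimately show ?thesis using close(1)[OF x(1)] \<delta>' \<gamma> sc by linarith
      next
        case 1
        have "v (\<Gamma> x) \<le> b \<bullet> f x1 + \<epsilon> / 5" using capx(2)[OF 1] unfolding v_def by linarith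
        \<comment> \<open>The level \<open>c\<close> is at least 2/5 \<epsilon> above the value at
          \<open>x1\<close>, the cap takes 1/5 \<epsilon>, and moving to \<open>v'\<close> and to
          \<open>c'\<close> takes \<delta>' each, at most \<epsilon> / 100.\<close>
        then have "\<bar>v' x - c'\<bar> \<ge> \<epsilon> / 10" using close(2)[OF x(1)] c' c \<delta>' \<delta> by linarith
        then have "L * \<bar>v' x - c'\<bar> \<ge> L * (\<epsilon> / 10)" using L(1) by (intro mult_left_mono) auto
        then show ?thesis using L(2) R[OF x(1)] \<gamma> \<delta> by linarith
      next
        case 2
        have "v (\<Gamma> x) \<ge> b \<bullet> f y1 - \<epsilon> / 5" using capy(2)[OF 2] unfolding v_def by linarith
        then have "\<bar>v' x - c'\<bar> \<ge> \<epsilon> / 10" using close(2)[OF x(1)] c' c \<delta>' \<delta> by linarith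
        then have "L * \<bar>v' x - c'\<bar> \<ge> L * (\<epsilon> / 10)" using L(1) by (intro mult_left_mono) auto
        then show ?thesis using L(2) R[OF x(1)] \<gamma> \<delta> by linarith
      qed
    qed
    have "w = vector [a \<bullet> f (\<Gamma>' x), b \<bullet> f (\<Gamma>' x)]"
      using x(2,3) unfolding u'_def v'_def u_def v_def \<gamma>_def c'_def by (simp add: vec_eq_iff forall_2)
    then show "w \<in> (\<lambda>x. vector [a \<bullet> f (\<Gamma>' x), b \<bullet> f (\<Gamma>' x)]) ` ?S" using x(1) by blast
  qed
  then have "negligible W" using \<Gamma>'(4) negligible_subset by blast
  moreover have "vector [t1 + 4 * \<delta>, c] \<in> W"
    unfolding W_def using \<delta>(1) \<delta>'(1) by (simp add: mem_box_cart forall_2)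
  moreover have "open W" unfolding W_def by (rule open_box)
  ultimately show False using open_not_negligible[of W] by auto
qed

text \<open>It remains to find a height at which the strips are 10 \<delta> apart. The heights
  \<open>c1\<close> and \<open>c2\<close> differ by \<epsilon> / 5, so with \<bar>s\<bar> \<ge> 1
  the signed distances of the centre lines there differ by at least 20 \<delta>, and one of them is
  large. If it is negative, \<open>a\<close>, \<open>s\<close>, \<open>t1\<close> and
  \<open>t2\<close> change sign.\<close>

lemma no_transverse_strips:
  fixes f :: "real^'n \<Rightarrow> real^'m"
  assumes \<Omega>: "open \<Omega>" "simply_connected \<Omega>" and lip: "locally_lipschitz_on \<Omega> f"
    and rk: "AE x in lebesgue. x \<in> \<Omega> \<longrightarrow> f differentiable at x \<longrightarrow> rank (jacobian f (at x)) \<le> 1"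
    and p: "path p" "path_image p \<subseteq> \<Omega>" "pathstart p = x1" "pathfinish p = y1"
    and q: "path q" "path_image q \<subseteq> \<Omega>" "pathstart q = x2" "pathfinish q = y2"
    and pa: "\<And>z. z \<in> path_image p \<Longrightarrow> \<bar>a \<bullet> f z - t1\<bar> < \<delta>"
    and qa: "\<And>z. z \<in> path_image q \<Longrightarrow> \<bar>(a + s *\<^sub>R b) \<bullet> f z - t2\<bar> < \<delta>"
    and s: "\<bar>s\<bar> \<ge> 1"
    and capx: "closed_segment x1 x2 \<subseteq> \<Omega>" "\<And>z. z \<in> closed_segment x1 x2 \<Longrightarrow> \<bar>b \<bullet> f z - b \<bullet> f x1\<bar> \<le> \<epsilon> / 5"
    and capy: "closed_segment y2 y1 \<subseteq> \<Omega>" "\<And>z. z \<in> closed_segment y2 y1 \<Longrightarrow> \<bar>b \<bullet> f z - b \<bullet> f y1\<bar> \<le> \<epsilon> / 5"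
    and \<delta>: "\<delta> > 0" "100 * \<delta> \<le> \<epsilon>"
    and osc: "b \<bullet> f y1 - b \<bullet> f x1 \<ge> \<epsilon>"
  shows False
proof -
  define c1 where "c1 = b \<bullet> f x1 + 2 / 5 * \<epsilon>"
  define c2 where "c2 = b \<bullet> f x1 + 3 / 5 * \<epsilon>"
  have "1 * (\<epsilon> / 5) \<le> \<bar>s\<bar> * (\<epsilon> / 5)" using s \<delta> by (intro mult_right_mono) auto
  moreover have "\<bar>s * c2 - s * c1\<bar> = \<bar>s\<bar> * (\<epsilon> / 5)"
    unfolding c1_def c2_def using \<delta> by (simp add: abs_mult flip: right_diff_distrib)
  ultimately have "\<bar>t2 - t1 - s * c1\<bar> \<ge> 10 * \<delta> \<or> \<bar>t2 - t1 - s * c2\<bar> \<ge> 10 * \<delta>"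
    using \<delta> by linarith
  moreover have "b \<bullet> f x1 + 2 / 5 * \<epsilon> \<le> c1" "c1 \<le> b \<bullet> f y1 - 2 / 5 * \<epsilon>"
    "b \<bullet> f x1 + 2 / 5 * \<epsilon> \<le> c2" "c2 \<le> b \<bullet> f y1 - 2 / 5 * \<epsilon>"
    using osc \<delta> unfolding c1_def c2_def by linarith+
  ultimately obtain c where c: "b \<bullet> f x1 + 2 / 5 * \<epsilon> \<le> c" "c \<le> b \<bullet> f y1 - 2 / 5 * \<epsilon>" "\<bar>t2 - t1 - s * c\<bar> \<ge> 10 * \<delta>"
    by blast
  then consider "t2 - t1 - s * c \<ge> 10 * \<delta>" | "(- t2) - (- t1) - (- s) * c \<ge> 10 * \<delta>" by fastforce
  then show False
  proof cases
    case 1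
    show False by (rule no_transverse_strips_aux[OF \<Omega> lip rk p q pa qa capx capy \<delta> c(1,2) 1])
  next
    case 2
    have "\<bar>(- a) \<bullet> f z - (- t1)\<bar> < \<delta>" if "z \<in> path_image p" for z
      using pa[OF that] by (simp add: abs_minus_commute)
    moreover have "\<bar>(- a + (- s) *\<^sub>R b) \<bullet> f z - (- t2)\<bar> < \<delta>" if "z \<in> path_image q" for z
      using qa[OF that] by (simp add: inner_add_left inner_diff_left)
    ultimately show False
      by (rule no_transverse_strips_aux[OF \<Omega> lip rk p q _ _ capx capy \<delta> c(1,2) 2])
  qed
qed

subsection \<open>Directions with small oscillation on slabs\<close>

text \<open>In the grid of functions with values below \<open>N\<close>, the bad set of
  \<open>j\<close> meets each line parallel to axis \<open>j\<close> in at most \<open>M\<close>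
  points, hence has at most M N^(m-1) elements, where m is the number of axes. The union over all
  \<open>j\<close> is smaller than N^m.\<close>

lemma exists_function_avoiding_line_sparse_sets:
  fixes B :: "'m::finite \<Rightarrow> ('m \<Rightarrow> nat) \<Rightarrow> bool"
  assumes M: "\<And>j \<tau>. card {k \<in> {..<N}. B j (\<tau>(j := k))} \<le> M" and N: "CARD('m) * M < N"
  obtains \<sigma> where "\<And>j. \<not> B j \<sigma>"
proof -
  define P where "P = (PiE UNIV (\<lambda>_. {..<N}) :: ('m \<Rightarrow> nat) set)"
  have P: "\<sigma> \<in> P \<longleftrightarrow> (\<forall>i. \<sigma> i < N)" for \<sigma> unfolding P_def by auto
  have finP: "finite P" unfolding P_def by (intro finite_PiE) auto
  have cardP: "card P = N ^ CARD('m)" unfolding P_def by (simp add: card_PiE)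
  have N0: "N > 0" using N by simp
  have bad: "card {\<sigma> \<in> P. B j \<sigma>} \<le> N ^ (CARD('m) - 1) * M" for j
  proof -
    \<comment> \<open>One representative, with \<open>j\<close>-th coordinate 0, for each grid line
      parallel to axis \<open>j\<close>.\<close>
    define Q where "Q = (PiE UNIV (\<lambda>i. if i = j then {0} else {..<N}) :: ('m \<Rightarrow> nat) set)"
    have Q: "\<sigma> \<in> Q \<longleftrightarrow> \<sigma> j = 0 \<and> (\<forall>i. i \<noteq> j \<longrightarrow> \<sigma> i < N)" for \<sigma>
      unfolding Q_def by (auto simp: PiE_iff split: if_splits)
    have finQ: "finite Q" unfolding Q_def by (intro finite_PiE) auto
    have cardQ: "card Q = N ^ (CARD('m) - 1)"
    proof -
      have "card Q = (\<Prod>i\<in>UNIV. if i = j then 1 else N)"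
        unfolding Q_def by (subst card_PiE) (auto intro!: prod.cong)
      also have "\<dots> = (\<Prod>i\<in>UNIV - {j}. N)" by (subst prod.remove[of _ j]) auto
      finally show ?thesis by (simp add: card_Diff_singleton)
    qed
    have "{\<sigma> \<in> P. B j \<sigma>} \<subseteq> (\<Union>\<tau>\<in>Q. (\<lambda>k. \<tau>(j := k)) ` {k \<in> {..<N}. B j (\<tau>(j := k))})"
    proof
      fix \<sigma> assume "\<sigma> \<in> {\<sigma> \<in> P. B j \<sigma>}"
      then show "\<sigma> \<in> (\<Union>\<tau>\<in>Q. (\<lambda>k. \<tau>(j := k)) ` {k \<in> {..<N}. B j (\<tau>(j := k))})"
        by (intro UN_I[of "\<sigma>(j := 0)"] image_eqI[of _ _ "\<sigma> j"]) (auto simp: P Q)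
    qed
    then have "card {\<sigma> \<in> P. B j \<sigma>} \<le> card (\<Union>\<tau>\<in>Q. (\<lambda>k. \<tau>(j := k)) ` {k \<in> {..<N}. B j (\<tau>(j := k))})"
      using finQ by (intro card_mono) auto
    also have "\<dots> \<le> (\<Sum>\<tau>\<in>Q. card ((\<lambda>k. \<tau>(j := k)) ` {k \<in> {..<N}. B j (\<tau>(j := k))}))"
      by (rule card_UN_le[OF finQ])
    also have "\<dots> \<le> (\<Sum>\<tau>\<in>Q. M)"
      by (intro sum_mono order_trans[OF card_image_le M]) auto
    finally show ?thesis by (simp add: cardQ)
  qed
  have "\<exists>\<sigma>\<in>P. \<forall>j. \<not> B j \<sigma>"
  proof (rule ccontr)
    assume "\<not> (\<exists>\<sigma>\<in>P. \<forall>j. \<not> B j \<sigma>)"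
    then have "P \<subseteq> (\<Union>j\<in>UNIV. {\<sigma> \<in> P. B j \<sigma>})" by auto
    then have "card P \<le> card (\<Union>j\<in>UNIV. {\<sigma> \<in> P. B j \<sigma>})" using finP by (intro card_mono) auto
    also have "\<dots> \<le> (\<Sum>j\<in>UNIV. card {\<sigma> \<in> P. B j \<sigma>})" by (rule card_UN_le) simp
    also have "\<dots> \<le> (\<Sum>j\<in>(UNIV :: 'm set). N ^ (CARD('m) - 1) * M)" by (intro sum_mono bad)
    also have "\<dots> = (CARD('m) * M) * N ^ (CARD('m) - 1)" by simp
    also have "\<dots> < N * N ^ (CARD('m) - 1)" using N N0 by (intro mult_strict_right_mono) auto
    also have "\<dots> = N ^ CARD('m)" by (simp flip: power_Suc)
    finally show False using cardP by simp
  qed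
  then show ?thesis using that by blast
qed

text \<open>A bad path is classified by the pair of balls, from a fixed finite cover of
  \<open>K\<close>, that contain its two ends. If two directions that differ by a nonzero integer
  multiple of \<open>E j\<close> had bad paths of the same class, these would be transverse strips
  with nearby ends. So every line of directions has at most \<open>card (Z \<times> Z)\<close> bad
  integer points, a bound that is known before the size of the grid is chosen.\<close>

lemma exists_good_direction:
  fixes f :: "real^'n \<Rightarrow> real^'m"
  assumes \<Omega>: "open \<Omega>" "simply_connected \<Omega>" and lip: "locally_lipschitz_on \<Omega> f"
    and rk: "AE x in lebesgue. x \<in> \<Omega> \<longrightarrow> f differentiable at x \<longrightarrow> rank (jacobian f (at x)) \<le> 1"
    and K: "compact K" "K \<subseteq> \<Omega>" and \<epsilon>: "\<epsilon> > 0"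
  obtains a \<delta> where "\<delta> > 0"
    "\<And>p t. \<lbrakk>path p; path_image p \<subseteq> \<Omega>; pathstart p \<in> K; pathfinish p \<in> K;
        \<And>z. z \<in> path_image p \<Longrightarrow> \<bar>a \<bullet> f z - t\<bar> < \<delta>\<rbrakk> \<Longrightarrow> norm (f (pathfinish p) - f (pathstart p)) \<le> \<epsilon>"
proof -
  \<comment> \<open>The norm is at most the sum of the absolute values of the coordinates, so each
    coordinate may change by \<open>e\<close>.\<close>
  define e where "e = \<epsilon> / real CARD('m)"
  define \<delta> where "\<delta> = e / 100"
  have e: "e > 0" unfolding e_def using \<epsilon> by simp
  then have \<delta>: "\<delta> > 0" "100 * \<delta> \<le> e" unfolding \<delta>_def by auto
  have fcont: "continuous_on \<Omega> f" using lip by (rule locally_lipschitz_on_imp_continuous_on)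
  obtain \<eta> where \<eta>: "\<eta> > 0" "\<And>x y. x \<in> K \<Longrightarrow> dist x y < \<eta> \<Longrightarrow> y \<in> \<Omega> \<and> dist (f x) (f y) < e / 5"
    using uniform_modulus_at_compact[OF \<Omega>(1) fcont K, of "e / 5"] e by auto
  \<comment> \<open>With radius \<eta> / 2, two points of one ball are closer than \<eta>, and by
    convexity the same holds along the segment between them; this bounds the caps.\<close>
  obtain Z where Z: "finite Z" "Z \<subseteq> K" "K \<subseteq> (\<Union>z\<in>Z. ball z (\<eta> / 2))"
  proof (rule compactE_image[OF K(1), of K "\<lambda>z. ball z (\<eta> / 2)"])
    show "K \<subseteq> (\<Union>z\<in>K. ball z (\<eta> / 2))" using \<eta>(1) by (auto intro!: bexI)
  qed auto
  define E where "E j = axis j (1::real)" for j :: 'm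
  \<comment> \<open>Only an increase of the coordinate is recorded; a decrease becomes one along the
    reversed path.\<close>
  define bad where "bad j a p t \<longleftrightarrow> path p \<and> path_image p \<subseteq> \<Omega> \<and> pathstart p \<in> K \<and> pathfinish p \<in> K \<and>
    (\<forall>z\<in>path_image p. \<bar>a \<bullet> f z - t\<bar> < \<delta>) \<and> E j \<bullet> f (pathfinish p) - E j \<bullet> f (pathstart p) \<ge> e" for j a p t
  have seg: "closed_segment x1 x2 \<subseteq> \<Omega> \<and> (\<forall>w\<in>closed_segment x1 x2. \<bar>E j \<bullet> f w - E j \<bullet> f x1\<bar> \<le> e / 5)"
    if x: "x1 \<in> K" "x1 \<in> ball z (\<eta> / 2)" "x2 \<in> ball z (\<eta> / 2)" for x1 x2 z j
  proof -
    have "w \<in> \<Omega> \<and> \<bar>E j \<bullet> f w - E j \<bullet> f x1\<bar> \<le> e / 5" if "w \<in> closed_segment x1 x2" for w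
    proof -
      have "w \<in> ball z (\<eta> / 2)"
        using closed_segment_subset[OF x(2,3) convex_ball] that by blast
      then have "dist x1 w < \<eta>" using x(2) dist_triangle_half_r[of z x1 \<eta> w] by simp
      then have "w \<in> \<Omega>" "dist (f x1) (f w) < e / 5" using \<eta>(2)[OF x(1)] by auto
      moreover have "\<bar>E j \<bullet> f w - E j \<bullet> f x1\<bar> \<le> norm (f w - f x1)"
        using Cauchy_Schwarz_ineq2[of "E j" "f w - f x1"] by (simp add: E_def inner_diff_right)
      ultimately show ?thesis by (simp add: dist_norm norm_minus_commute)
    qed
    then show ?thesis by blast
  qed
  have sparse: "card {k \<in> {..<N}. \<exists>p t. bad j (a + real k *\<^sub>R E j) p t} \<le> card (Z \<times> Z)" for N j a
  proof -
    define Bk where "Bk = {k \<in> {..<N}. \<exists>p t. bad j (a + real k *\<^sub>R E j) p t}"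
    have "\<forall>k\<in>Bk. \<exists>p t. bad j (a + real k *\<^sub>R E j) p t" unfolding Bk_def by auto
    then obtain p t where p: "\<And>k. k \<in> Bk \<Longrightarrow> bad j (a + real k *\<^sub>R E j) (p k) (t k)" by metis
    have "\<forall>k\<in>Bk. \<exists>z\<in>Z. pathstart (p k) \<in> ball z (\<eta> / 2)" "\<forall>k\<in>Bk. \<exists>z\<in>Z. pathfinish (p k) \<in> ball z (\<eta> / 2)"
      using p Z(3) unfolding bad_def by blast+
    then obtain zx zy where zx: "\<And>k. k \<in> Bk \<Longrightarrow> zx k \<in> Z \<and> pathstart (p k) \<in> ball (zx k) (\<eta> / 2)"
      and zy: "\<And>k. k \<in> Bk \<Longrightarrow> zy k \<in> Z \<and> pathfinish (p k) \<in> ball (zy k) (\<eta> / 2)" by metis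
    have "inj_on (\<lambda>k. (zx k, zy k)) Bk"
    proof (rule inj_onI, rule ccontr)
      fix k l assume k: "k \<in> Bk" and l: "l \<in> Bk" and eq: "(zx k, zy k) = (zx l, zy l)" and "k \<noteq> l"
      define s where "s = real l - real k"
      have s: "\<bar>s\<bar> \<ge> 1" unfolding s_def using \<open>k \<noteq> l\<close> by linarith
      note bk = p[OF k, unfolded bad_def] and bl = p[OF l, unfolded bad_def]
      have eqa: "a + real k *\<^sub>R E j + s *\<^sub>R E j = a + real l *\<^sub>R E j"
        unfolding s_def by (simp add: algebra_simps)
      have capx: "closed_segment (pathstart (p k)) (pathstart (p l)) \<subseteq> \<Omega>"
        "\<And>z. z \<in> closed_segment (pathstart (p k)) (pathstart (p l)) \<Longrightarrow> \<bar>E j \<bullet> f z - E j \<bullet> f (pathstart (p k))\<bar> \<le> e / 5"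
        using seg[of "pathstart (p k)" "zx k" "pathstart (p l)" j] zx[OF k] zx[OF l] bk eq by auto
      have capy: "closed_segment (pathfinish (p l)) (pathfinish (p k)) \<subseteq> \<Omega>"
        "\<And>z. z \<in> closed_segment (pathfinish (p l)) (pathfinish (p k)) \<Longrightarrow> \<bar>E j \<bullet> f z - E j \<bullet> f (pathfinish (p k))\<bar> \<le> e / 5"
        using seg[of "pathfinish (p k)" "zy k" "pathfinish (p l)" j] zy[OF k] zy[OF l] bk eq
        by (auto simp: closed_segment_commute)
      show False
        by (rule no_transverse_strips[OF \<Omega> lip rk, where p = "p k" and q = "p l" and a = "a + real k *\<^sub>R E j"
              and s = s and b = "E j" and ?t1.0 = "t k" and ?t2.0 = "t l" and \<delta> = \<delta> and \<epsilon> = e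
              and ?x1.0 = "pathstart (p k)" and ?x2.0 = "pathstart (p l)"
              and ?y1.0 = "pathfinish (p k)" and ?y2.0 = "pathfinish (p l)"])
           (use bk bl s capx capy \<delta> in \<open>simp_all add: eqa\<close>)
    qed
    moreover have "(\<lambda>k. (zx k, zy k)) ` Bk \<subseteq> Z \<times> Z" using zx zy by auto
    ultimately have "card Bk \<le> card (Z \<times> Z)" using Z(1) by (intro card_inj_on_le) auto
    then show ?thesis unfolding Bk_def .
  qed
  define dir where "dir \<sigma> = (\<chi> i. real (\<sigma> i))" for \<sigma> :: "'m \<Rightarrow> nat"
  \<comment> \<open>Changing one entry of the grid function walks along a line in direction
    \<open>E j\<close> from a base point independent of \<open>k\<close>, which is the form that
    \<open>sparse\<close> treats.\<close>
  have dir: "dir (\<tau>(j := k)) = dir (\<tau>(j := 0)) + real k *\<^sub>R E j" for \<tau> j k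
    unfolding dir_def E_def by (simp add: vec_eq_iff axis_def)
  obtain \<sigma> where \<sigma>: "\<And>j. \<not> (\<exists>p t. bad j (dir \<sigma>) p t)"
  proof (rule exists_function_avoiding_line_sparse_sets[of "Suc (CARD('m) * card (Z \<times> Z))" "\<lambda>j \<sigma>. \<exists>p t. bad j (dir \<sigma>) p t"])
    fix j \<tau>
    show "card {k \<in> {..<Suc (CARD('m) * card (Z \<times> Z))}. \<exists>p t. bad j (dir (\<tau>(j := k))) p t} \<le> card (Z \<times> Z)"
      by (subst dir) (rule sparse)
  qed auto
  show ?thesis
  proof (rule that[OF \<delta>(1)])
    fix p t
    assume p: "path p" "path_image p \<subseteq> \<Omega>" "pathstart p \<in> K" "pathfinish p \<in> K"
      and pt: "\<And>z. z \<in> path_image p \<Longrightarrow> \<bar>dir \<sigma> \<bullet> f z - t\<bar> < \<delta>"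
    have "\<bar>(f (pathfinish p) - f (pathstart p)) $ j\<bar> \<le> e" for j
    proof -
      have "\<not> bad j (dir \<sigma>) p t" "\<not> bad j (dir \<sigma>) (reversepath p) t" using \<sigma> by auto
      then show ?thesis using p pt unfolding bad_def E_def by (auto simp: inner_axis' not_le)
    qed
    then have "(\<Sum>j\<in>UNIV. \<bar>(f (pathfinish p) - f (pathstart p)) $ j\<bar>) \<le> (\<Sum>j\<in>(UNIV::'m set). e)"
      by (intro sum_mono)
    also have "\<dots> = \<epsilon>" unfolding e_def by simp
    finally show "norm (f (pathfinish p) - f (pathstart p)) \<le> \<epsilon>"
      using norm_le_l1_cart order_trans by blast
  qed
qed

subsection \<open>Smooth functions\<close>

lemma Ck_on_cong:
  assumes S: "open S" and eq: "\<And>x. x \<in> S \<Longrightarrow> f x = g x" and f: "Ck_on k S f"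
  shows "Ck_on k S g"
  using eq f
proof (induction k arbitrary: f g)
  case 0 then show ?case using continuous_on_cong[of S S f g] by simp
next
  case (Suc k)
  have der: "(g has_derivative frechet_derivative f (at x)) (at x)" if x: "x \<in> S" for x
  proof (rule has_derivative_transform_within_open[OF _ S x])
    show "(f has_derivative frechet_derivative f (at x)) (at x)"
      using Suc.prems(2) x by (simp add: frechet_derivative_works)
  qed (use Suc.prems in auto)
  have "Ck_on k S (\<lambda>x. frechet_derivative g (at x) v)" for v
  proof (rule Suc.IH)
    fix x assume "x \<in> S"
    then show "frechet_derivative f (at x) v = frechet_derivative g (at x) v"
      using frechet_derivative_at[OF der] by metis
  next
    show "Ck_on k S (\<lambda>x. frechet_derivative f (at x) v)" using Suc.prems(2) by simp
  qed
  then show ?case using der by (auto simp: differentiable_def)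
qed

text \<open>By uniqueness of derivatives, the closure proofs can work with the explicit formulas of
  the calculus rules instead of \<open>frechet_derivative\<close>.\<close>

lemma Ck_on_SucI:
  assumes S: "open S" and der: "\<And>x. x \<in> S \<Longrightarrow> (f has_derivative D x) (at x)"
    and D: "\<And>v. Ck_on k S (\<lambda>x. D x v)"
  shows "Ck_on (Suc k) S f"
proof -
  have "D x = frechet_derivative f (at x)" if "x \<in> S" for x
    using frechet_derivative_at[OF der[OF that]] .
  then have "Ck_on k S (\<lambda>x. frechet_derivative f (at x) v)" for v
    by (intro Ck_on_cong[OF S _ D[of v]]) auto
  then show ?thesis using der by (auto simp: differentiable_def)
qed

lemma Ck_on_SucE:
  assumes "Ck_on (Suc k) S f"
  obtains D where "\<And>x. x \<in> S \<Longrightarrow> (f has_derivative D x) (at x)" "\<And>v. Ck_on k S (\<lambda>x. D x v)"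
  by (rule that[of "\<lambda>x. frechet_derivative f (at x)"]) (use assms in \<open>auto simp: frechet_derivative_works\<close>)

lemma Ck_on_Suc_imp: "Ck_on (Suc k) S f \<Longrightarrow> Ck_on k S f"
proof (induction k arbitrary: f)
  case 0
  then show ?case
    by (auto intro!: continuous_at_imp_continuous_on differentiable_imp_continuous_within)
qed auto

lemma Ck_on_subset: "Ck_on k S f \<Longrightarrow> T \<subseteq> S \<Longrightarrow> Ck_on k T f"
  by (induction k arbitrary: f) (auto intro: continuous_on_subset)

text \<open>Serves maps that are given by one formula near each point but by no common formula on
  all of \<open>S\<close>.\<close>

lemma Ck_on_local:
  assumes "\<And>x. x \<in> S \<Longrightarrow> \<exists>T. open T \<and> x \<in> T \<and> Ck_on k T f"
  shows "Ck_on k S f"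
  using assms
proof (induction k arbitrary: f)
  case 0
  show ?case
    unfolding Ck_on.simps
  proof (rule continuous_at_imp_continuous_on, rule ballI)
    fix x assume "x \<in> S"
    then obtain T where "open T" "x \<in> T" "continuous_on T f" using 0 by auto
    then show "isCont f x" by (simp add: continuous_on_eq_continuous_at)
  qed
next
  case (Suc k)
  have "f differentiable at x" if "x \<in> S" for x using Suc.prems[OF that] by auto
  moreover have "Ck_on k S (\<lambda>x. frechet_derivative f (at x) v)" for v
    by (rule Suc.IH) (use Suc.prems in fastforce)
  ultimately show ?case by simp
qed

lemma Ck_on_const: "open S \<Longrightarrow> Ck_on k S (\<lambda>x. c)"
proof (induction k arbitrary: c)
  case (Suc k) show ?case by (rule Ck_on_SucI[where D = "\<lambda>x v. 0"]) (use Suc in auto)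
qed auto

lemma Ck_on_add:
  assumes "open S" "Ck_on k S f" "Ck_on k S g"
  shows "Ck_on k S (\<lambda>x. f x + g x)"
  using assms(2,3)
proof (induction k arbitrary: f g)
  case 0 then show ?case by (auto intro: continuous_intros)
next
  case (Suc k)
  obtain Df where f: "\<And>x. x \<in> S \<Longrightarrow> (f has_derivative Df x) (at x)" "\<And>v. Ck_on k S (\<lambda>x. Df x v)"
    using Ck_on_SucE[OF Suc.prems(1)] by blast
  obtain Dg where g: "\<And>x. x \<in> S \<Longrightarrow> (g has_derivative Dg x) (at x)" "\<And>v. Ck_on k S (\<lambda>x. Dg x v)"
    using Ck_on_SucE[OF Suc.prems(2)] by blast
  show ?case
    by (rule Ck_on_SucI[OF assms(1) has_derivative_add[OF f(1) g(1)]]) (auto intro: Suc.IH f(2) g(2))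
qed

lemma Ck_on_scaleR:
  fixes f :: "_ \<Rightarrow> real"
  assumes "open S" "Ck_on k S f" "Ck_on k S g"
  shows "Ck_on k S (\<lambda>x. f x *\<^sub>R g x)"
  using assms(2,3)
proof (induction k arbitrary: f g)
  case 0 then show ?case by (auto intro: continuous_intros)
next
  case (Suc k)
  obtain Df where f: "\<And>x. x \<in> S \<Longrightarrow> (f has_derivative Df x) (at x)" "\<And>v. Ck_on k S (\<lambda>x. Df x v)"
    using Ck_on_SucE[OF Suc.prems(1)] by blast
  obtain Dg where g: "\<And>x. x \<in> S \<Longrightarrow> (g has_derivative Dg x) (at x)" "\<And>v. Ck_on k S (\<lambda>x. Dg x v)"
    using Ck_on_SucE[OF Suc.prems(2)] by blast
  note low = Suc.prems[THEN Ck_on_Suc_imp]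
  have "Ck_on k S (\<lambda>x. f x *\<^sub>R Dg x v + Df x v *\<^sub>R g x)" for v
    by (rule Ck_on_add[OF assms(1) Suc.IH[OF low(1) g(2)] Suc.IH[OF f(2) low(2)]])
  then show ?case
    by (intro Ck_on_SucI[OF assms(1) has_derivative_scaleR[OF f(1) g(1)]])
qed

lemma Ck_on_mult:
  fixes f g :: "_ \<Rightarrow> real"
  assumes "open S" "Ck_on k S f" "Ck_on k S g"
  shows "Ck_on k S (\<lambda>x. f x * g x)"
  using Ck_on_scaleR[OF assms] by simp

lemma Ck_on_diff:
  assumes "open S" "Ck_on k S f" "Ck_on k S g"
  shows "Ck_on k S (\<lambda>x. f x - g x)"
  using Ck_on_add[OF assms(1,2) Ck_on_scaleR[OF assms(1) Ck_on_const[OF assms(1)] assms(3), of "-1"]] by simp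

lemma Ck_on_sum:
  assumes "open S" "\<And>i. i \<in> I \<Longrightarrow> Ck_on k S (f i)"
  shows "Ck_on k S (\<lambda>x. \<Sum>i\<in>I. f i x)"
  using assms(2) by (induction I rule: infinite_finite_induct) (auto intro!: Ck_on_const Ck_on_add assms(1))

lemma Ck_on_prod:
  fixes f :: "'i \<Rightarrow> _ \<Rightarrow> real"
  assumes "open S" "\<And>i. i \<in> I \<Longrightarrow> Ck_on k S (f i)"
  shows "Ck_on k S (\<lambda>x. \<Prod>i\<in>I. f i x)"
  using assms(2) by (induction I rule: infinite_finite_induct) (auto intro!: Ck_on_const Ck_on_mult assms(1))

lemma Ck_on_inverse:
  fixes f :: "_ \<Rightarrow> real"
  assumes "open S" "Ck_on k S f" "\<And>x. x \<in> S \<Longrightarrow> f x \<noteq> 0"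
  shows "Ck_on k S (\<lambda>x. inverse (f x))"
  using assms(2)
proof (induction k)
  case 0 then show ?case using assms(3) by (auto intro: continuous_intros)
next
  case (Suc k)
  obtain Df where f: "\<And>x. x \<in> S \<Longrightarrow> (f has_derivative Df x) (at x)" "\<And>v. Ck_on k S (\<lambda>x. Df x v)"
    using Ck_on_SucE[OF Suc.prems] by blast
  have inv: "Ck_on k S (\<lambda>x. inverse (f x))" by (rule Suc.IH[OF Ck_on_Suc_imp[OF Suc.prems]])
  have "Ck_on k S (\<lambda>x. 0 - (inverse (f x) * Df x v * inverse (f x)))" for v
    by (intro Ck_on_diff[OF assms(1)] Ck_on_mult[OF assms(1)] Ck_on_const[OF assms(1)] inv f(2))
  then have "Ck_on k S (\<lambda>x. - (inverse (f x) * Df x v * inverse (f x)))" for v by simp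
  then show ?case
    by (intro Ck_on_SucI[OF assms(1) Deriv.has_derivative_inverse[OF assms(3) f(1)]])
qed

lemma Ck_on_compose_real:
  fixes s :: "real \<Rightarrow> real"
  assumes "open S" "Ck_on k UNIV s" "Ck_on k S g"
  shows "Ck_on k S (\<lambda>x. s (g x))"
  using assms(2,3)
proof (induction k arbitrary: s g)
  case 0
  then show ?case using continuous_on_compose2[of UNIV s S g] by auto
next
  case (Suc k)
  obtain Ds where s: "\<And>x. (s has_derivative Ds x) (at x)" "\<And>v. Ck_on k UNIV (\<lambda>x. Ds x v)"
    using Ck_on_SucE[OF Suc.prems(1)] by (metis UNIV_I)
  obtain Dg where g: "\<And>x. x \<in> S \<Longrightarrow> (g has_derivative Dg x) (at x)" "\<And>v. Ck_on k S (\<lambda>x. Dg x v)"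
    using Ck_on_SucE[OF Suc.prems(2)] by blast
  \<comment> \<open>A derivative on the line is multiplication by a number, so the chain rule
    becomes a product whose first factor is again a real function composed with \<open>g\<close>;
    the induction hypothesis covers it.\<close>
  have lin: "Ds y v = Ds y 1 * v" for y v
    using linear_cmul[OF has_derivative_linear[OF s(1)], of y v 1] by (simp add: mult.commute)
  have "Ck_on k S (\<lambda>x. Ds (g x) 1 * Dg x v)" for v
    by (rule Ck_on_mult[OF assms(1) Suc.IH[OF s(2) Ck_on_Suc_imp[OF Suc.prems(2)]] g(2)])
  then have "Ck_on k S (\<lambda>x. Ds (g x) (Dg x v))" for v by (subst lin)
  then show ?case
    by (intro Ck_on_SucI[OF assms(1) has_derivative_compose[OF g(1) s(1)]])
qed

lemma Ck_on_norm_diff_square: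
  fixes a :: "'a::euclidean_space"
  assumes "open S"
  shows "Ck_on k S (\<lambda>x. (norm (x - a))\<^sup>2)"
proof (cases k)
  case 0 then show ?thesis by (auto intro!: continuous_intros)
next
  case (Suc k')
  have inner: "Ck_on k' S (\<lambda>x. 2 * ((x - a) \<bullet> v))" for v
  proof (cases k')
    case 0 then show ?thesis by (auto intro!: continuous_intros)
  next
    case (Suc k'')
    show ?thesis
      unfolding Suc
      by (rule Ck_on_SucI[OF assms, where D = "\<lambda>x w. 2 * (w \<bullet> v)"])
         (auto intro!: derivative_eq_intros Ck_on_const[OF assms])
  qed
  have "((\<lambda>x. (norm (x - a))\<^sup>2) has_derivative (\<lambda>v. 2 * ((x - a) \<bullet> v))) (at x)" for x
    unfolding power2_norm_eq_inner by (auto intro!: derivative_eq_intros simp: inner_commute)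
  then show ?thesis unfolding Suc using inner by (intro Ck_on_SucI[OF assms])
qed

text \<open>The classical flat function exp (-1/x), extended by 0, is the case n = 0. The powers of
  1/x are included because the derivative of each member is a combination of two later members, so
  induction gives all orders of smoothness at once.\<close>

definition flat_exp :: "nat \<Rightarrow> real \<Rightarrow> real" where
  "flat_exp n x = (if x \<le> 0 then 0 else inverse x ^ n * exp (- inverse x))"

text \<open>With y = 1/x, the single term of order n + 2 of the exponential series gives y^(n+2)
  \<le> (n+2)! exp y. The exponent 2 that remains on \<open>x\<close> yields the derivative 0 at the
  origin.\<close>

lemma flat_exp_le:
  "\<bar>flat_exp n x\<bar> \<le> fact (n + 2) * x\<^sup>2"
proof (cases "x \<le> 0")
  case False
  define y where "y = inverse x"
  have y: "y > 0" "x = inverse y" using False unfolding y_def by auto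
  have "y ^ (n + 2) / fact (n + 2) \<le> exp y"
  proof -
    have "(\<Sum>i\<in>{n + 2}. inverse (fact i) *\<^sub>R y ^ i) \<le> (\<Sum>i. inverse (fact i) *\<^sub>R y ^ i)"
      using y(1) by (intro sum_le_suminf summable_exp_generic) auto
    then show ?thesis unfolding exp_def using y(1) by (simp add: divide_inverse mult.commute)
  qed
  then have "y ^ (n + 2) \<le> exp y * fact (n + 2)" by (simp only: divide_le_eq fact_gt_zero if_True)
  then have "y ^ (n + 2) * exp (- y) \<le> exp y * fact (n + 2) * exp (- y)" by (rule mult_right_mono) simp
  moreover have "exp y * fact (n + 2) * exp (- y) = fact (n + 2)"
    by (simp add: exp_minus field_simps del: fact_Suc)
  ultimately have "y ^ (n + 2) * exp (- y) \<le> fact (n + 2)" by linarith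
  then have "y ^ n * exp (- y) * y\<^sup>2 \<le> fact (n + 2)" by (simp add: power_add mult_ac power2_eq_square)
  then have "y ^ n * exp (- y) \<le> fact (n + 2) * (inverse y)\<^sup>2"
    using y(1) by (simp add: field_simps)
  then show ?thesis using False y unfolding flat_exp_def by (simp add: abs_mult)
qed (simp add: flat_exp_def)

lemma flat_exp_has_derivative:
  "(flat_exp n has_real_derivative flat_exp (n + 2) x - real n * flat_exp (n + 1) x) (at x)"
proof -
  consider "x < 0" | "x = 0" | "x > 0" by linarith
  then show ?thesis
  proof cases
    case 1
    have "((\<lambda>x. 0) has_real_derivative 0) (at x)" by simp
    then have "(flat_exp n has_real_derivative 0) (at x)"
      by (rule has_field_derivative_transform_within_open[where S = "{..<0}"]) (use 1 in \<open>auto simp: flat_exp_def\<close>)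
    then show ?thesis using 1 by (simp add: flat_exp_def)
  next
    case 2
    have "((\<lambda>h. flat_exp n h / h) \<longlongrightarrow> 0) (at 0)"
    proof (rule Lim_null_comparison)
      show "\<forall>\<^sub>F h in at 0. norm (flat_exp n h / h) \<le> fact (n + 2) * \<bar>h\<bar>"
        unfolding eventually_at_filter
      proof (intro always_eventually allI impI)
        fix h :: real assume "h \<noteq> 0"
        then show "norm (flat_exp n h / h) \<le> fact (n + 2) * \<bar>h\<bar>"
          using flat_exp_le[of n h] by (simp add: divide_le_eq power2_eq_square abs_mult_self_eq mult.assoc)
      qed
      show "((\<lambda>h::real. fact (n + 2) * \<bar>h\<bar>) \<longlongrightarrow> 0) (at 0)" by (auto intro!: tendsto_eq_intros)
    qed
    then show ?thesis unfolding 2 has_field_derivative_iff by (simp add: flat_exp_def)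
  next
    case 3
    have "((\<lambda>x. inverse x ^ n * exp (- inverse x)) has_real_derivative
        inverse x ^ (n + 2) * exp (- inverse x) - real n * (inverse x ^ (n + 1) * exp (- inverse x))) (at x)"
    proof -
      define y where "y = inverse x"
      have "((\<lambda>y. y ^ n * exp (- y)) has_real_derivative
          real n * y ^ (n - 1) * exp (- y) - y ^ n * exp (- y)) (at (inverse x))"
        unfolding y_def by (auto intro!: derivative_eq_intros)
      moreover have "(inverse has_real_derivative - (y ^ Suc (Suc 0))) (at x)"
        unfolding y_def using DERIV_inverse[of x UNIV] 3 by simp
      ultimately have "((\<lambda>x. inverse x ^ n * exp (- inverse x)) has_real_derivative
          (real n * y ^ (n - 1) * exp (- y) - y ^ n * exp (- y)) * - (y ^ Suc (Suc 0))) (at x)"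
        by (rule DERIV_chain2)
      moreover have "(real n * y ^ (n - 1) * exp (- y) - y ^ n * exp (- y)) * - (y ^ Suc (Suc 0)) =
          y ^ (n + 2) * exp (- y) - real n * (y ^ (n + 1) * exp (- y))"
        by (cases n) (simp_all add: algebra_simps)
      ultimately show ?thesis unfolding y_def by simp
    qed
    then have "(flat_exp n has_real_derivative
        inverse x ^ (n + 2) * exp (- inverse x) - real n * (inverse x ^ (n + 1) * exp (- inverse x))) (at x)"
      by (rule has_field_derivative_transform_within_open[where S = "{0<..}"]) (use 3 in \<open>auto simp: flat_exp_def\<close>)
    then show ?thesis using 3 by (simp add: flat_exp_def)
  qed
qed

lemma Ck_on_flat_exp: "Ck_on k UNIV (flat_exp n)"
proof (induction k arbitrary: n)
  case 0
  show ?case using DERIV_isCont[OF flat_exp_has_derivative]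
    by (auto intro!: continuous_at_imp_continuous_on)
next
  case (Suc k)
  have "Ck_on k UNIV (\<lambda>x. (flat_exp (n + 2) x - real n * flat_exp (n + 1) x) * v)" for v
    by (intro Ck_on_mult Ck_on_diff Ck_on_const Suc open_UNIV)
  then show ?case
    using flat_exp_has_derivative[of n] by (intro Ck_on_SucI) (auto simp: has_field_derivative_def)
qed

text \<open>The denominator is positive everywhere, since \<open>x\<close> or \<open>1 - x\<close>
  is.\<close>

definition smooth_step :: "real \<Rightarrow> real" where
  "smooth_step x = flat_exp 0 x * inverse (flat_exp 0 x + flat_exp 0 (1 - x))"

lemma Ck_on_affine: "Ck_on k UNIV (\<lambda>x::real. a * x + b)"
  by (cases k)
     (auto intro!: continuous_intros Ck_on_SucI[where D = "\<lambda>x v. a * v"] Ck_on_const derivative_eq_intros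
       simp del: Ck_on.simps(2))

lemma flat_exp_0: "flat_exp 0 x \<ge> 0" "flat_exp 0 x > 0 \<longleftrightarrow> x > 0" "flat_exp 0 x = 0 \<longleftrightarrow> x \<le> 0"
  by (auto simp: flat_exp_def)

lemma smooth_step_eq_0: "x \<le> 0 \<Longrightarrow> smooth_step x = 0"
  by (simp add: smooth_step_def flat_exp_def)

lemma smooth_step_eq_1: "x \<ge> 1 \<Longrightarrow> smooth_step x = 1"
  by (simp add: smooth_step_def flat_exp_def)

lemma smooth_step_bounds: "0 \<le> smooth_step x" "smooth_step x \<le> 1"
  using flat_exp_0[of x] flat_exp_0[of "1 - x"]
  by (auto simp: smooth_step_def divide_simps simp flip: divide_inverse)

lemma Ck_on_smooth_step: "Ck_on k UNIV smooth_step"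
proof -
  have pos: "flat_exp 0 x + flat_exp 0 (1 - x) \<noteq> 0" for x
    using flat_exp_0[of x] flat_exp_0[of "1 - x"] by (cases "x > 0") (auto simp: add_nonneg_eq_0_iff)
  have "Ck_on k UNIV (\<lambda>x. flat_exp 0 ((-1) * x + 1))"
    by (intro Ck_on_compose_real[OF _ Ck_on_flat_exp Ck_on_affine]) simp
  then have "Ck_on k UNIV (\<lambda>x. flat_exp 0 (1 - x))" by simp
  then show ?thesis
    unfolding smooth_step_def[abs_def] using pos
    by (intro Ck_on_mult Ck_on_inverse Ck_on_add Ck_on_flat_exp open_UNIV) auto
qed

text \<open>The partition of unity is built by telescoping: bump \<open>j\<close> is weighted by the
  product of all earlier 1 - \<beta>, so the first \<open>n\<close> weights sum to 1 minus the
  product over the first \<open>n\<close>. Where a bump equals 1, all later weights vanish, and any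
  countable cover by balls leads to finite sums locally.\<close>

lemma smooth_approximation:
  fixes g :: "'a::euclidean_space \<Rightarrow> real"
  assumes \<Omega>: "open \<Omega>" and cont: "continuous_on \<Omega> g" and \<delta>: "\<delta> > 0"
  obtains G where "smooth_on \<Omega> G" "\<And>x. x \<in> \<Omega> \<Longrightarrow> \<bar>G x - g x\<bar> \<le> \<delta>"
proof (cases "\<Omega> = {}")
  case True
  have "smooth_on \<Omega> (\<lambda>x. 0 :: real)" unfolding smooth_on_def using Ck_on_const[OF \<Omega>] by blast
  then show ?thesis using that True by blast
next
  case False
  \<comment> \<open>The modulus holds on the ball of twice the radius because a bump equal to 1 on
    the ball vanishes only outside the doubled one.\<close>
  have "\<exists>r>0. \<forall>y\<in>\<Omega>. dist x y < 2 * r \<longrightarrow> \<bar>g y - g x\<bar> < \<delta>" if "x \<in> \<Omega>" for x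
  proof -
    have "\<exists>d>0. \<forall>y\<in>\<Omega>. dist y x < d \<longrightarrow> dist (g y) (g x) < \<delta>"
      using cont that \<delta> unfolding continuous_on_iff by simp
    then obtain d where "d > 0" "\<And>y. y \<in> \<Omega> \<Longrightarrow> dist y x < d \<Longrightarrow> dist (g y) (g x) < \<delta>" by blast
    then show ?thesis by (intro exI[of _ "d / 2"]) (auto simp: dist_commute dist_real_def)
  qed
  then obtain r where r: "\<And>x. x \<in> \<Omega> \<Longrightarrow> r x > 0"
    "\<And>x y. x \<in> \<Omega> \<Longrightarrow> y \<in> \<Omega> \<Longrightarrow> dist x y < 2 * r x \<Longrightarrow> \<bar>g y - g x\<bar> < \<delta>" by metis
  obtain \<F> where \<F>: "\<F> \<subseteq> (\<lambda>x. ball x (r x)) ` \<Omega>" "countable \<F>" "\<Union>\<F> = \<Union>((\<lambda>x. ball x (r x)) ` \<Omega>)"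
    by (rule Lindelof[of "(\<lambda>x. ball x (r x)) ` \<Omega>"]) auto
  obtain C where C: "C \<subseteq> \<Omega>" "countable C" "\<F> = (\<lambda>x. ball x (r x)) ` C"
    using \<F>(1,2) countable_subset_image[of \<F> "\<lambda>x. ball x (r x)" \<Omega>] by metis
  have cover: "\<exists>c\<in>C. y \<in> ball c (r c)" if "y \<in> \<Omega>" for y
  proof -
    have "y \<in> \<Union>\<F>" unfolding \<F>(3) using that r(1) by force
    then show ?thesis unfolding C(3) by auto
  qed
  then have "C \<noteq> {}" using False by auto
  then obtain z :: "nat \<Rightarrow> 'a" where z: "range z = C" using C(2) by (metis range_from_nat_into)
  have z\<Omega>: "z k \<in> \<Omega>" for k using z C(1) by auto
  define \<rho> where "\<rho> k = r (z k)" for k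
  have \<rho>: "\<rho> k > 0" for k unfolding \<rho>_def using r(1) z\<Omega> by blast
  have cover': "\<exists>k. y \<in> ball (z k) (\<rho> k)" if "y \<in> \<Omega>" for y
    using cover[OF that] z unfolding \<rho>_def by auto
  \<comment> \<open>The argument of the step is (d^2 - \<rho>^2) / (3 \<rho>^2), with d the distance
    to the centre: it is 0 at d = \<rho> and 1 at d = 2 \<rho>. The squared norm is used because it
    is smooth at the centre too.\<close>
  define \<beta> where "\<beta> k y = 1 - smooth_step (1 / (3 * (\<rho> k)\<^sup>2) * (norm (y - z k))\<^sup>2 + (- 1 / 3))" for k y
  have \<beta>_smooth: "Ck_on n \<Omega> (\<beta> k)" for n k
    unfolding \<beta>_def
    by (intro Ck_on_diff[OF \<Omega>] Ck_on_const[OF \<Omega>] Ck_on_compose_real[OF \<Omega> Ck_on_smooth_step]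
        Ck_on_add[OF \<Omega>] Ck_on_mult[OF \<Omega>] Ck_on_norm_diff_square[OF \<Omega>])
  have \<beta>_bounds: "0 \<le> \<beta> k y" "\<beta> k y \<le> 1" for k y unfolding \<beta>_def using smooth_step_bounds by auto
  have \<beta>1: "\<beta> k y = 1" if "y \<in> ball (z k) (\<rho> k)" for k y
  proof -
    have "(norm (y - z k))\<^sup>2 \<le> (\<rho> k)\<^sup>2"
      using that by (intro power_mono) (auto simp: dist_norm norm_minus_commute)
    then have "1 / (3 * (\<rho> k)\<^sup>2) * (norm (y - z k))\<^sup>2 + (- 1 / 3) \<le> 0"
      using \<rho>[of k] by (simp add: field_simps)
    then show ?thesis unfolding \<beta>_def by (simp add: smooth_step_eq_0)
  qed
  have \<beta>0: "\<beta> k y = 0" if "2 * \<rho> k \<le> dist (z k) y" for k y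
  proof -
    have "(2 * \<rho> k)\<^sup>2 \<le> (norm (y - z k))\<^sup>2"
      using that \<rho>[of k] by (intro power_mono) (auto simp: dist_norm norm_minus_commute)
    then have "1 \<le> 1 / (3 * (\<rho> k)\<^sup>2) * (norm (y - z k))\<^sup>2 + (- 1 / 3)"
      using \<rho>[of k] by (simp add: field_simps)
    then show ?thesis unfolding \<beta>_def by (simp add: smooth_step_eq_1)
  qed
  define P where "P k y = (\<Prod>j<k. 1 - \<beta> j y)" for k y
  define G where "G n y = (\<Sum>j<n. (\<beta> j y * P j y) * g (z j))" for n y
  have G_smooth: "Ck_on m \<Omega> (G n)" for m n
    unfolding G_def P_def
    by (intro Ck_on_sum[OF \<Omega>] Ck_on_mult[OF \<Omega>] Ck_on_prod[OF \<Omega>] Ck_on_diff[OF \<Omega>] Ck_on_const[OF \<Omega>] \<beta>_smooth)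
  have total: "(\<Sum>j<n. \<beta> j y * P j y) = 1 - P n y" for n y
    by (induction n) (auto simp: P_def algebra_simps)
  have P0: "P n y = 0" if "y \<in> ball (z k) (\<rho> k)" "k < n" for k n y
    unfolding P_def using \<beta>1[OF that(1)] that(2) by (intro prod_zero) auto
  have stable: "G n y = G (Suc k) y" if "y \<in> ball (z k) (\<rho> k)" "Suc k \<le> n" for k n y
    unfolding G_def using that P0[OF that(1)]
    by (intro sum.mono_neutral_right) auto
  \<comment> \<open>The sums \<open>G n y\<close> are constant in \<open>n\<close> once a ball
    around \<open>y\<close> has been passed; \<open>H\<close> is this stable value.\<close>
  define N where "N y = (LEAST k. y \<in> ball (z k) (\<rho> k))" for y
  define H where "H y = G (Suc (N y)) y" for y
  have N: "y \<in> ball (z (N y)) (\<rho> (N y))" if "y \<in> \<Omega>" for y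
    unfolding N_def using cover'[OF that] by (rule LeastI_ex)
  have HG: "H y = G (Suc k) y" if "y \<in> ball (z k) (\<rho> k)" "y \<in> \<Omega>" for k y
  proof -
    have "N y \<le> k" unfolding N_def using that(1) by (rule Least_le)
    then show ?thesis unfolding H_def using stable[OF N[OF that(2)], of "Suc k"] by simp
  qed
  show ?thesis
  proof (rule that[of H])
    show "smooth_on \<Omega> H"
      unfolding smooth_on_def
    proof (intro allI Ck_on_local)
      fix m x assume x: "x \<in> \<Omega>"
      then obtain k where k: "x \<in> ball (z k) (\<rho> k)" using cover' by blast
      define T where "T = \<Omega> \<inter> ball (z k) (\<rho> k)"
      have T: "open T" unfolding T_def using \<Omega> by auto
      have "Ck_on m T H"
        by (rule Ck_on_cong[OF T _ Ck_on_subset[OF G_smooth[of m "Suc k"]]]) (auto simp: T_def HG)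
      then show "\<exists>T. open T \<and> x \<in> T \<and> Ck_on m T H" using T x k unfolding T_def by blast
    qed
    fix x assume x: "x \<in> \<Omega>"
    define n where "n = Suc (N x)"
    have sum1: "(\<Sum>j<n. \<beta> j x * P j x) = 1" unfolding total using P0[OF N[OF x]] unfolding n_def by simp
    have wpos: "\<beta> j x * P j x \<ge> 0" for j
      unfolding P_def using \<beta>_bounds by (intro mult_nonneg_nonneg prod_nonneg) (auto simp: diff_ge_0_iff_ge)
    have "H x - g x = (\<Sum>j<n. (\<beta> j x * P j x) * (g (z j) - g x))"
      unfolding H_def n_def[symmetric] G_def using sum1 by (simp add: right_diff_distrib sum_subtractf flip: sum_distrib_right)
    also have "\<bar>\<dots>\<bar> \<le> (\<Sum>j<n. (\<beta> j x * P j x) * \<delta>)"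
    proof (rule sum_abs[THEN order_trans], rule sum_mono)
      fix j
      show "\<bar>\<beta> j x * P j x * (g (z j) - g x)\<bar> \<le> \<beta> j x * P j x * \<delta>"
      proof (cases "dist (z j) x < 2 * \<rho> j")
        case True
        then have "\<bar>g (z j) - g x\<bar> \<le> \<delta>" using r(2)[OF z\<Omega> x, of j] unfolding \<rho>_def by (simp add: abs_minus_commute)
        then have "\<beta> j x * P j x * \<bar>g (z j) - g x\<bar> \<le> \<beta> j x * P j x * \<delta>" using wpos by (rule mult_left_mono)
        then show ?thesis by (subst abs_mult, subst abs_of_nonneg[OF wpos])
      qed (simp add: \<beta>0)
    qed
    also have "\<dots> = \<delta>" using sum1 by (simp flip: sum_distrib_right)
    finally show "\<bar>H x - g x\<bar> \<le> \<delta>" .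
  qed
qed

subsection \<open>Approximation through a graph\<close>

text \<open>No three components of the sets \<open>{z. \<bar>G z - k\<bar> < 1}\<close> meet, so the nerve of the cover that they
  form is a graph; each of its edges is mapped to a segment in the target.\<close>

lemma nerve_approximation:
  fixes f :: "real^'n \<Rightarrow> real^'m" and G :: "real^'n \<Rightarrow> real"
  assumes \<Omega>: "open \<Omega>" and G: "smooth_on \<Omega> G" and K: "K \<subseteq> \<Omega>"
    and osc: "\<And>x y k. \<lbrakk>x \<in> K; y \<in> K; connected_component {z \<in> \<Omega>. \<bar>G z - of_int k\<bar> < 1} x y\<rbrakk>
      \<Longrightarrow> norm (f y - f x) \<le> \<epsilon>"
  obtains F :: "real^'n \<Rightarrow> real^'m" where "smooth_on \<Omega> F" "\<And>x. x \<in> \<Omega> \<Longrightarrow> rank (jacobian F (at x)) \<le> 1"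
    "\<And>x. x \<in> K \<Longrightarrow> norm (F x - f x) \<le> \<epsilon>"
proof -
  define A where "A k = {z \<in> \<Omega>. \<bar>G z - of_int k\<bar> < 1}" for k :: int
  define C where "C k x = connected_component_set (A k) x" for k x
  \<comment> \<open>A component is sent to a value of \<open>f\<close> on its part in
    \<open>K\<close>; one that misses \<open>K\<close> gets the default 0, as accuracy is claimed
    only on \<open>K\<close>.\<close>
  define Q where "Q S = (if K \<inter> S = {} then 0 else f (SOME y. y \<in> K \<inter> S))" for S
  define q where "q k x = Q (C k x)" for k x
  \<comment> \<open>Equal to 0 up to 1/3 and to 1 from 2/3 on, so that \<open>F\<close> is locally
    constant near the integer levels of \<open>G\<close>, where the floor jumps.\<close>
  define s where "s t = smooth_step (3 * t - 1)" for t
  \<comment> \<open>If \<open>G x\<close> is an integer, \<open>x\<close> is outside the slab of the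
    next integer, the component there is empty and its value 0 enters with weight 0.\<close>
  define F where "F x = q \<lfloor>G x\<rfloor> x + s (G x - of_int \<lfloor>G x\<rfloor>) *\<^sub>R (q (\<lfloor>G x\<rfloor> + 1) x - q \<lfloor>G x\<rfloor> x)" for x
  have GC: "Ck_on n \<Omega> G" for n using G unfolding smooth_on_def by blast
  then have Gcont: "continuous_on \<Omega> G" by (metis Ck_on.simps(1))
  have openG: "open {z \<in> \<Omega>. G z \<in> U}" if "open U" for U
    using continuous_open_preimage[OF Gcont \<Omega> that] by (simp add: Int_def vimage_def)
  have "A k = {z \<in> \<Omega>. G z \<in> ball (of_int k) 1}" for k
    unfolding A_def by (auto simp: dist_real_def)
  then have openA: "open (A k)" for k using openG[OF open_ball] by simp
  have openC: "open (C k x)" for k x unfolding C_def using openA by (rule open_connected_component)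
  have Cself: "x \<in> C k x" if "x \<in> A k" for k x unfolding C_def using that by simp
  have CA: "C k x \<subseteq> A k" for k x unfolding C_def by (rule connected_component_subset)
  have qC: "q k y = q k x" if "y \<in> C k x" for k x y
    unfolding q_def using that unfolding C_def by (metis connected_component_eq)
  have err: "norm (q k x - f x) \<le> \<epsilon>" if x: "x \<in> K" "x \<in> A k" for k x
  proof -
    have "x \<in> K \<inter> C k x" using Cself x by auto
    then have ne: "K \<inter> C k x \<noteq> {}" by blast
    then have "(SOME y. y \<in> K \<inter> C k x) \<in> K \<inter> C k x" by (rule some_in_eq[THEN iffD2])
    then obtain y where y: "q k x = f y" "y \<in> K" "y \<in> C k x" unfolding q_def Q_def using ne by auto
    then show ?thesis using osc[of x y k] x(1) unfolding C_def A_def by simp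
  qed
  have local_form: "\<exists>T c d. \<exists>k::int. open T \<and> x \<in> T \<and> T \<subseteq> \<Omega> \<and> (\<forall>y\<in>T. F y = c + s (G y - of_int k) *\<^sub>R d)"
    if x: "x \<in> \<Omega>" for x
  proof (cases "G x = of_int \<lfloor>G x\<rfloor>")
    case True
    define k where "k = \<lfloor>G x\<rfloor>"
    \<comment> \<open>Within 1/3 of level \<open>k\<close> the floor of \<open>G\<close> is
      \<open>k\<close> or \<open>k - 1\<close>; in both cases the whole weight is on the component
      of level \<open>k\<close>.\<close>
    define T where "T = C k x \<inter> {z \<in> \<Omega>. G z \<in> ball (of_int k) (1/3)}"
    have "open T" unfolding T_def using openC openG[OF open_ball] by blast
    moreover have "x \<in> T" unfolding T_def using x True Cself[of x k] by (auto simp: A_def k_def)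
    moreover have "F y = q k x + s (G y - of_int k) *\<^sub>R 0" if y: "y \<in> T" for y
    proof -
      have q: "q k y = q k x" using y qC unfolding T_def by auto
      have Gy: "\<bar>G y - of_int k\<bar> < 1/3" using y unfolding T_def by (auto simp: dist_real_def abs_minus_commute)
      show ?thesis
      proof (cases "G y \<ge> of_int k")
        case True
        then have fl: "\<lfloor>G y\<rfloor> = k" using Gy by linarith
        then have "s (G y - of_int \<lfloor>G y\<rfloor>) = 0" unfolding s_def using Gy by (intro smooth_step_eq_0) auto
        then show ?thesis unfolding F_def using q fl by simp
      next
        case False
        then have fl: "\<lfloor>G y\<rfloor> = k - 1" using Gy by linarith
        have "1 \<le> 3 * (G y - of_int (k - 1)) - 1" using abs_less_iff[THEN iffD1, OF Gy] by (simp add: field_simps)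
        then have "s (G y - of_int \<lfloor>G y\<rfloor>) = 1" unfolding s_def fl by (rule smooth_step_eq_1)
        then show ?thesis unfolding F_def using q fl by simp
      qed
    qed
    moreover have "T \<subseteq> \<Omega>" unfolding T_def by auto
    ultimately show ?thesis by blast
  next
    case False
    define k where "k = \<lfloor>G x\<rfloor>"
    have kx: "of_int k < G x" "G x < of_int k + 1" unfolding k_def using False by linarith+
    define T where "T = C k x \<inter> C (k + 1) x \<inter> {z \<in> \<Omega>. G z \<in> {of_int k<..<of_int k + 1}}"
    have "open T" unfolding T_def by (intro open_Int openC openG open_greaterThanLessThan)
    moreover have "x \<in> T" unfolding T_def using x kx Cself[of x k] Cself[of x "k + 1"] by (auto simp: A_def)
    moreover have "F y = q k x + s (G y - of_int k) *\<^sub>R (q (k + 1) x - q k x)" if y: "y \<in> T" for y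
    proof -
      have "q k y = q k x" "q (k + 1) y = q (k + 1) x" using y qC unfolding T_def by auto
      moreover have "\<lfloor>G y\<rfloor> = k" using y unfolding T_def by (auto simp: floor_eq_iff)
      ultimately show ?thesis unfolding F_def by simp
    qed
    moreover have "T \<subseteq> \<Omega>" unfolding T_def by auto
    ultimately show ?thesis by blast
  qed
  have s_Ck: "Ck_on n UNIV s" for n
  proof -
    have "Ck_on n UNIV (\<lambda>t. smooth_step (3 * t + (- 1)))"
      by (rule Ck_on_compose_real[OF open_UNIV Ck_on_smooth_step Ck_on_affine])
    then show ?thesis by (simp add: s_def[abs_def])
  qed
  have sG: "Ck_on n T (\<lambda>y. s (G y - of_int k))" if "open T" "T \<subseteq> \<Omega>" for n T and k :: int
    by (intro Ck_on_compose_real[OF that(1) s_Ck] Ck_on_diff[OF that(1)] Ck_on_const[OF that(1)] Ck_on_subset[OF GC that(2)])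
  show ?thesis
  proof (rule that)
    show "smooth_on \<Omega> F"
      unfolding smooth_on_def
    proof (intro allI Ck_on_local)
      fix n x assume "x \<in> \<Omega>"
      then obtain T c d k where T: "open T" "x \<in> T" "T \<subseteq> \<Omega>" "\<And>y. y \<in> T \<Longrightarrow> F y = c + s (G y - of_int k) *\<^sub>R d"
        using local_form[OF \<open>x \<in> \<Omega>\<close>] by blast
      have "Ck_on n T (\<lambda>y. c + s (G y - of_int k) *\<^sub>R d)"
        by (intro Ck_on_add[OF T(1)] Ck_on_scaleR[OF T(1)] Ck_on_const[OF T(1)] sG[OF T(1,3)])
      then have "Ck_on n T F" by (rule Ck_on_cong[OF T(1), rotated]) (simp add: T(4))
      then show "\<exists>T. open T \<and> x \<in> T \<and> Ck_on n T F" using T by blast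
    qed
  next
    fix x assume "x \<in> \<Omega>"
    then obtain T c d k where T: "open T" "x \<in> T" "T \<subseteq> \<Omega>" "\<And>y. y \<in> T \<Longrightarrow> F y = c + s (G y - of_int k) *\<^sub>R d"
      using local_form[OF \<open>x \<in> \<Omega>\<close>] by blast
    obtain D where D: "((\<lambda>y. s (G y - of_int k)) has_derivative D) (at x)"
      using Ck_on_SucE[OF sG[OF T(1,3), of "Suc 0" k]] T(2) by metis
    have "((\<lambda>y. c + s (G y - of_int k) *\<^sub>R d) has_derivative (\<lambda>v. D v *\<^sub>R d)) (at x)"
      using D by (auto intro!: derivative_eq_intros)
    then have F: "(F has_derivative (\<lambda>v. D v *\<^sub>R d)) (at x)"
      by (rule has_derivative_transform_within_open[OF _ T(1,2)]) (simp add: T(4))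
    then have "(F has_derivative (\<lambda>v. jacobian F (at x) *v v)) (at x)"
      using jacobian_works differentiable_def by blast
    then have "(\<lambda>v. jacobian F (at x) *v v) = (\<lambda>v. D v *\<^sub>R d)" using F by (rule has_derivative_unique)
    then have "jacobian F (at x) *v v = D v *\<^sub>R d" for v by (rule fun_cong)
    \<comment> \<open>All values of the derivative lie on the line spanned by \<open>d\<close>, the
      direction of the edge.\<close>
    then have "range ((*v) (jacobian F (at x))) \<subseteq> span {d}"
      by (auto simp: span_singleton)
    then have "dim (range ((*v) (jacobian F (at x)))) \<le> card {d}"
      by (intro dim_le_card) auto
    then show "rank (jacobian F (at x)) \<le> 1" by (simp add: rank_dim_range)
  next
    fix x assume x: "x \<in> K"
    define k where "k = \<lfloor>G x\<rfloor>"
    define w where "w = s (G x - of_int k)"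
    have k: "of_int k \<le> G x" "G x < of_int k + 1" unfolding k_def by linarith+
    have w: "0 \<le> w" "w \<le> 1" unfolding w_def s_def using smooth_step_bounds by auto
    have e0: "norm (q k x - f x) \<le> \<epsilon>" using x k K by (intro err) (auto simp: A_def)
    have e1: "w * norm (q (k + 1) x - f x) \<le> w * \<epsilon>"
    proof (cases "G x = of_int k")
      case True
      then have "w = 0" unfolding w_def s_def by (simp add: smooth_step_eq_0)
      then show ?thesis by simp
    next
      case False
      then have "norm (q (k + 1) x - f x) \<le> \<epsilon>" using x k K by (intro err) (auto simp: A_def)
      then show ?thesis using w by (intro mult_left_mono)
    qed
    have "F x - f x = (1 - w) *\<^sub>R (q k x - f x) + w *\<^sub>R (q (k + 1) x - f x)"
      unfolding F_def k_def[symmetric] w_def[symmetric] by (simp add: algebra_simps)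
    then have "norm (F x - f x) \<le> (1 - w) * norm (q k x - f x) + w * norm (q (k + 1) x - f x)"
      using norm_triangle_ineq[of "(1 - w) *\<^sub>R (q k x - f x)" "w *\<^sub>R (q (k + 1) x - f x)"] w by simp
    also have "\<dots> \<le> (1 - w) * \<epsilon> + w * \<epsilon>" using mult_left_mono[OF e0, of "1 - w"] e1 w by simp
    finally show "norm (F x - f x) \<le> \<epsilon>" by (simp add: algebra_simps)
  qed
qed

text \<open>With \<open>G\<close> within 1 of 2 / \<delta> times \<open>a \<bullet> f\<close>, the
  slab of \<open>G\<close> of half width 1 around \<open>k\<close> lies in the slab of
  \<open>a \<bullet> f\<close> of half width \<delta> around \<delta> k / 2, where the good
  direction controls \<open>f\<close>.\<close>

lemma smooth_rank_one_approximation_on_compact: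
  fixes f :: "real^'n \<Rightarrow> real^'m"
  assumes \<Omega>: "open \<Omega>" "simply_connected \<Omega>" and lip: "locally_lipschitz_on \<Omega> f"
    and rk: "AE x in lebesgue. x \<in> \<Omega> \<longrightarrow> f differentiable at x \<longrightarrow> rank (jacobian f (at x)) \<le> 1"
    and K: "compact K" "K \<subseteq> \<Omega>" and \<epsilon>: "\<epsilon> > 0"
  shows "\<exists>F :: real^'n \<Rightarrow> real^'m. smooth_on \<Omega> F \<and> (\<forall>x\<in>\<Omega>. rank (jacobian F (at x)) \<le> 1) \<and>
    (\<forall>x\<in>K. norm (F x - f x) \<le> \<epsilon>)"
proof -
  obtain a \<delta> where \<delta>: "\<delta> > 0" and a: "\<And>p t. \<lbrakk>path p; path_image p \<subseteq> \<Omega>; pathstart p \<in> K; pathfinish p \<in> K;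
        \<And>z. z \<in> path_image p \<Longrightarrow> \<bar>a \<bullet> f z - t\<bar> < \<delta>\<rbrakk> \<Longrightarrow> norm (f (pathfinish p) - f (pathstart p)) \<le> \<epsilon>"
    using exists_good_direction[OF \<Omega> lip rk K \<epsilon>] by metis
  have "continuous_on \<Omega> (\<lambda>x. 2 / \<delta> * (a \<bullet> f x))"
    by (intro continuous_intros locally_lipschitz_on_imp_continuous_on lip)
  then obtain G where G: "smooth_on \<Omega> G" "\<And>x. x \<in> \<Omega> \<Longrightarrow> \<bar>G x - 2 / \<delta> * (a \<bullet> f x)\<bar> \<le> 1"
    using smooth_approximation[OF \<Omega>(1), of _ 1] by auto
  have osc: "norm (f y - f x) \<le> \<epsilon>"
    if xy: "x \<in> K" "y \<in> K" "connected_component {z \<in> \<Omega>. \<bar>G z - of_int k\<bar> < 1} x y" for x y and k :: int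
  proof -
    define A where "A = {z \<in> \<Omega>. \<bar>G z - of_int k\<bar> < 1}"
    have "continuous_on \<Omega> G" using G(1) unfolding smooth_on_def by (metis Ck_on.simps(1))
    then have "open (\<Omega> \<inter> G -` ball (of_int k) 1)" by (intro continuous_open_preimage \<Omega> open_ball)
    moreover have "\<Omega> \<inter> G -` ball (of_int k) 1 = A" unfolding A_def by (auto simp: dist_real_def)
    ultimately have "open (connected_component_set A x)" by (simp add: open_connected_component)
    \<comment> \<open>The estimate for the good direction concerns paths, whereas the nerve is built
      from connected components; for open sets the two notions agree.\<close>
    then have "path_connected (connected_component_set A x)"
      by (intro connected_open_path_connected) auto
    moreover have "x \<in> connected_component_set A x" "y \<in> connected_component_set A x"
      using xy(3) connected_component_in[OF xy(3)] unfolding A_def by auto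
    ultimately obtain p where p: "path p" "path_image p \<subseteq> connected_component_set A x" "pathstart p = x" "pathfinish p = y"
      unfolding path_connected_def by blast
    have pA: "path_image p \<subseteq> A" using p(2) connected_component_subset by blast
    have "norm (f (pathfinish p) - f (pathstart p)) \<le> \<epsilon>"
    proof (rule a[OF p(1)])
      show "path_image p \<subseteq> \<Omega>" using pA unfolding A_def by auto
      fix z assume "z \<in> path_image p"
      then have z: "z \<in> \<Omega>" "\<bar>G z - of_int k\<bar> < 1" using pA unfolding A_def by auto
      then have "\<bar>2 / \<delta> * (a \<bullet> f z) - of_int k\<bar> < 2" using G(2)[OF z(1)] by linarith
      moreover have "2 / \<delta> * (a \<bullet> f z) - of_int k = 2 / \<delta> * (a \<bullet> f z - \<delta> / 2 * of_int k)"
        using \<delta> by (simp add: field_simps)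
      moreover have "\<bar>2 / \<delta> * (a \<bullet> f z - \<delta> / 2 * of_int k)\<bar> = 2 / \<delta> * \<bar>a \<bullet> f z - \<delta> / 2 * of_int k\<bar>"
        using \<delta> by (subst abs_mult) simp
      ultimately have "2 / \<delta> * \<bar>a \<bullet> f z - \<delta> / 2 * of_int k\<bar> < 2" by linarith
      then show "\<bar>a \<bullet> f z - \<delta> / 2 * of_int k\<bar> < \<delta>" using \<delta> by (simp add: field_simps)
    qed (use p xy in auto)
    then show ?thesis using p by simp
  qed
  show ?thesis
    by (rule nerve_approximation[OF \<Omega>(1) G(1) K(2) osc]) blast+
qed

theorem theorem1p7:
  fixes \<Omega> :: "(real ^ 'n) set" and f :: "real ^ 'n \<Rightarrow> real ^ 'm"
  assumes "domain \<Omega>"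
    and "simply_connected \<Omega>"
    and "locally_lipschitz_on \<Omega> f"
    and "AE x in lebesgue. x \<in> \<Omega> \<longrightarrow> f differentiable at x \<longrightarrow> rank (jacobian f (at x)) \<le> 1"
  shows "\<exists>F :: nat \<Rightarrow> real ^ 'n \<Rightarrow> real ^ 'm.
           (\<forall>i. smooth_on \<Omega> (F i)) \<and>
           (\<forall>i. \<forall>x\<in>\<Omega>. rank (jacobian (F i) (at x)) \<le> 1) \<and>
           (\<forall>K. compact K \<and> K \<subseteq> \<Omega> \<longrightarrow> uniform_limit K F f sequentially)"
proof -
  have \<Omega>: "open \<Omega>" using assms(1) unfolding domain_def by blast
  \<comment> \<open>Every compact subset of \<Omega> is contained in all \<open>C n\<close> from
    some index on, so accuracy 1 / (i + 1) on \<open>C i\<close> alone gives uniform convergence on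
    each of them.\<close>
  obtain C :: "nat \<Rightarrow> (real^'n) set" where C: "\<And>n. compact (C n)" "\<And>n. C n \<subseteq> \<Omega>"
    "\<And>K. \<lbrakk>compact K; K \<subseteq> \<Omega>\<rbrakk> \<Longrightarrow> \<exists>N. \<forall>n\<ge>N. K \<subseteq> C n"
    using open_Union_compact_subsets[OF \<Omega>] by metis
  have "\<forall>i::nat. \<exists>F :: real^'n \<Rightarrow> real^'m. smooth_on \<Omega> F \<and> (\<forall>x\<in>\<Omega>. rank (jacobian F (at x)) \<le> 1) \<and>
    (\<forall>x\<in>C i. norm (F x - f x) \<le> 1 / (real i + 1))"
    using smooth_rank_one_approximation_on_compact[OF \<Omega> assms(2-4) C(1,2)] by simp
  then obtain F :: "nat \<Rightarrow> real^'n \<Rightarrow> real^'m" where F: "\<And>i. smooth_on \<Omega> (F i)"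
    "\<And>i x. x \<in> \<Omega> \<Longrightarrow> rank (jacobian (F i) (at x)) \<le> 1"
    "\<And>i x. x \<in> C i \<Longrightarrow> norm (F i x - f x) \<le> 1 / (real i + 1)" by metis
  have "uniform_limit K F f sequentially" if K: "compact K" "K \<subseteq> \<Omega>" for K
    unfolding uniform_limit_iff
  proof (intro allI impI)
    fix e :: real assume "e > 0"
    obtain N where N: "\<And>n. n \<ge> N \<Longrightarrow> K \<subseteq> C n" using C(3)[OF K] by blast
    have "(\<lambda>n. 1 / (real n + 1)) \<longlonglongrightarrow> 0"
      using LIMSEQ_inverse_real_of_nat by (simp add: inverse_eq_divide add.commute)
    then have "\<forall>\<^sub>F n in sequentially. 1 / (real n + 1) < e" using \<open>e > 0\<close> by (rule order_tendstoD)
    then show "\<forall>\<^sub>F n in sequentially. \<forall>x\<in>K. dist (F n x) (f x) < e"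
      using eventually_ge_at_top[of N]
    proof eventually_elim
      case (elim n)
      then show ?case using N[of n] F(3)[of _ n] by (fastforce simp: dist_norm)
    qed
  qed
  then show ?thesis using F by blast
qed

end
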